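(* Let $A$ be an idempotented $*$-algebra and let $\{V_i\}_{i\in I}$ be a family of unitary representations of $A$ such that $\widehat{\bigoplus}_iV_i\in\mathrm{Rep}^u(A)$, i.e. $\sup_i\|a|_{V_i}\|<\infty$ for all $a\in A$. Then $$\mathrm{Spec}_A\Big(\widehat{\bigoplus}_iV_i\Big)=\overline{\bigcup_i\mathrm{Spec}_A(V_i)},$$ where the closure is taken in the unitary dual $\widehat A$.
   Context: Algebras are associative $\mathbb{C}$-algebras, not necessarily unital. A $*$-algebra is an algebra $A$ with an additive, conjugate-linear map $*:A\to A$ with $(ab)^*=b^*a^*$ and $a^{**}=a$. It is idempotented if for every finite $T\subseteq A$ there is an idempotent $e=e^*\in A$ with $eae=a$ for all $a\in T$. A unitary representation of $A$ is a Hilbert space $V$ with a left $A$-module structure by bounded operators such that $\langle au,v\rangle=\langle u,a^*v\rangle$ and $AV$ is dense in $V$; $\mathrm{Rep}^u(A)$ denotes the class of these; $a|_V$ is the operator $v\mapsto av$. It is irreducible if it is nonzero and has no closed $A$-submodules other than $0$ and $V$. $\widehat{\bigoplus}_iV_i$ is the Hilbert space direct sum with diagonal action. $\widehat A$ is the set of unitary isomorphism classes $[V]$ of irreducible unitary representations, topologized by the subbasis of sets $N_{V,v,\varepsilon,T}$ ($[V]\in\widehat A$, $v\in V$ a unit vector, $\varepsilon>0$, $T\subseteq A$ finite) consisting of all $[U]\in\widehat A$ for which there is $u\in U$ (not necessarily a unit vector) with $|\langle av,v\rangle-\langle au,u\rangle|<\varepsilon$ for all $a\in T$. For $V$ irreducible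 and $V'$ a unitary representation, $V\prec V'$ means: for every unit $v\in V$, $\varepsilon>0$ and finite $T\subseteq A$ there is a unit $v'\in V'$ with $|\langle av,v\rangle-\langle av',v'\rangle|<\varepsilon$ for all $a\in T$. $\mathrm{Spec}_A(V')=\{[V]\in\widehat A:V\prec V'\}$. *)

theory Defs
  imports "HOL-Analysis.Analysis" "HOL-Library.Function_Algebras"
begin

section \<open>Star-algebras\<close>

class complex_vector = ab_group_add +
  fixes scaleC :: "complex \<Rightarrow> 'a \<Rightarrow> 'a"  (infixr \<open>*\<^sub>C\<close> 75)
  assumes scaleC_add_right: "c *\<^sub>C (x + y) = c *\<^sub>C x + c *\<^sub>C y"
    and scaleC_add_left: "(c + d) *\<^sub>C x = c *\<^sub>C x + d *\<^sub>C x"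
    and scaleC_scaleC: "c *\<^sub>C d *\<^sub>C x = (c * d) *\<^sub>C x"
    and scaleC_one: "1 *\<^sub>C x = x"

text \<open>The class \<open>ring\<close> does not require a unit.\<close>

class star_algebra = complex_vector + ring +
  fixes star :: "'a \<Rightarrow> 'a"
  assumes mult_scaleC_left: "(c *\<^sub>C x) * y = c *\<^sub>C (x * y)"
    and mult_scaleC_right: "x * (c *\<^sub>C y) = c *\<^sub>C (x * y)"
    and star_add: "star (x + y) = star x + star y"
    and star_scaleC: "star (c *\<^sub>C x) = cnj c *\<^sub>C star x"
    and star_mult: "star (x * y) = star y * star x"
    and star_star: "star (star x) = x"

class idempotented_star_algebra = star_algebra +
  assumes idempotented:
    "finite T \<Longrightarrow> \<exists>e. e * e = e \<and> star e = e \<and> (\<forall>a\<in>T. e * a * e = a)"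

instantiation complex :: complex_vector
begin
definition scaleC_complex :: "complex \<Rightarrow> complex \<Rightarrow> complex" where "scaleC_complex c x = c * x"
instance by standard (simp_all add: scaleC_complex_def algebra_simps)
end

instantiation "fun" :: (type, complex_vector) complex_vector
begin
definition scaleC_fun :: "complex \<Rightarrow> ('a \<Rightarrow> 'b) \<Rightarrow> 'a \<Rightarrow> 'b" where "scaleC_fun c f = (\<lambda>x. c *\<^sub>C f x)"
instance
  by standard
    (simp_all add: scaleC_fun_def fun_eq_iff scaleC_add_right scaleC_add_left scaleC_scaleC scaleC_one)
end


section \<open>Hilbert spaces\<close>

text \<open>
  A Hilbert space is carried by a linear subspace \<open>hcarrier\<close> of an arbitrary complex vector space
  type. The inner product is part of the structure and is linear in its first argument. Its values
  outside of the carrier are irrelevant.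
\<close>

record 'v inner_space =
  hcarrier :: "'v set"
  hinner :: "'v \<Rightarrow> 'v \<Rightarrow> complex"

definition hnorm :: "('v, 'm) inner_space_scheme \<Rightarrow> 'v \<Rightarrow> real" where
  "hnorm V v = sqrt (Re (hinner V v v))"

definition is_subspace :: "'v::complex_vector set \<Rightarrow> bool" where
  "is_subspace W \<longleftrightarrow> 0 \<in> W \<and> (\<forall>x\<in>W. \<forall>y\<in>W. x + y \<in> W) \<and> (\<forall>c. \<forall>x\<in>W. c *\<^sub>C x \<in> W)"

locale hilbert_space =
  fixes V :: "('v::complex_vector, 'm) inner_space_scheme"
  assumes subspace: "is_subspace (hcarrier V)"
    and inner_add_left: "\<lbrakk>x \<in> hcarrier V; y \<in> hcarrier V; z \<in> hcarrier V\<rbrakk>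
      \<Longrightarrow> hinner V (x + y) z = hinner V x z + hinner V y z"
    and inner_scaleC_left: "\<lbrakk>x \<in> hcarrier V; z \<in> hcarrier V\<rbrakk>
      \<Longrightarrow> hinner V (c *\<^sub>C x) z = c * hinner V x z"
    and inner_cnj: "\<lbrakk>x \<in> hcarrier V; y \<in> hcarrier V\<rbrakk>
      \<Longrightarrow> hinner V y x = cnj (hinner V x y)"
    and inner_pos: "\<lbrakk>x \<in> hcarrier V; x \<noteq> 0\<rbrakk> \<Longrightarrow> Re (hinner V x x) > 0"
    and complete: "\<lbrakk>\<And>n::nat. X n \<in> hcarrier V;
        \<And>\<epsilon>. \<epsilon> > 0 \<Longrightarrow> \<exists>N. \<forall>m\<ge>N. \<forall>n\<ge>N. hnorm V (X m - X n) < \<epsilon>\<rbrakk>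
      \<Longrightarrow> \<exists>x\<in>hcarrier V. (\<lambda>n. hnorm V (X n - x)) \<longlonglongrightarrow> 0"


section \<open>Unitary representations\<close>

record ('a, 'v) representation = "'v inner_space" +
  action :: "'a \<Rightarrow> 'v \<Rightarrow> 'v"

text \<open>
  In the density condition, the set of all products \<open>av\<close> is used as it is. For idempotented
  algebras this set is already a linear subspace.
\<close>

locale unitary_rep = hilbert_space V
  for V :: "('a::star_algebra, 'v::complex_vector) representation" +
  assumes action_closed: "v \<in> hcarrier V \<Longrightarrow> action V a v \<in> hcarrier V"
    and action_add_right: "\<lbrakk>v \<in> hcarrier V; w \<in> hcarrier V\<rbrakk>
      \<Longrightarrow> action V a (v + w) = action V a v + action V a w"
    and action_scaleC_right: "v \<in> hcarrier V \<Longrightarrow> action V a (c *\<^sub>C v) = c *\<^sub>C action V a v"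
    and action_add_left: "v \<in> hcarrier V \<Longrightarrow> action V (a + b) v = action V a v + action V b v"
    and action_scaleC_left: "v \<in> hcarrier V \<Longrightarrow> action V (c *\<^sub>C a) v = c *\<^sub>C action V a v"
    and action_mult: "v \<in> hcarrier V \<Longrightarrow> action V (a * b) v = action V a (action V b v)"
    and action_bounded: "\<exists>C. \<forall>v\<in>hcarrier V. hnorm V (action V a v) \<le> C * hnorm V v"
    and action_star: "\<lbrakk>v \<in> hcarrier V; w \<in> hcarrier V\<rbrakk>
      \<Longrightarrow> hinner V (action V a v) w = hinner V v (action V (star a) w)"
    and action_dense: "\<lbrakk>v \<in> hcarrier V; \<epsilon> > 0\<rbrakk>
      \<Longrightarrow> \<exists>a. \<exists>w\<in>hcarrier V. hnorm V (v - action V a w) < \<epsilon>"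

definition closed_submodule ::
  "('a, 'v::complex_vector) representation \<Rightarrow> 'v set \<Rightarrow> bool" where
  "closed_submodule V W \<longleftrightarrow> W \<subseteq> hcarrier V \<and> is_subspace W
    \<and> (\<forall>a. \<forall>w\<in>W. action V a w \<in> W)
    \<and> (\<forall>X. \<forall>x\<in>hcarrier V. (\<forall>n::nat. X n \<in> W) \<longrightarrow> (\<lambda>n. hnorm V (X n - x)) \<longlonglongrightarrow> 0 \<longrightarrow> x \<in> W)"

definition irreducible_unitary_rep ::
  "('a::star_algebra, 'v::complex_vector) representation \<Rightarrow> bool" where
  "irreducible_unitary_rep V \<longleftrightarrow> unitary_rep V \<and> hcarrier V \<noteq> {0}
    \<and> (\<forall>W. closed_submodule V W \<longrightarrow> W = {0} \<or> W = hcarrier V)"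

definition unitarily_isomorphic ::
  "('a, 'v::complex_vector) representation \<Rightarrow> ('a, 'w::complex_vector) representation \<Rightarrow> bool"
  (infix \<open>\<cong>\<^sub>u\<close> 50) where
  "V \<cong>\<^sub>u U \<longleftrightarrow> (\<exists>f. bij_betw f (hcarrier V) (hcarrier U)
    \<and> (\<forall>x\<in>hcarrier V. \<forall>y\<in>hcarrier V. f (x + y) = f x + f y)
    \<and> (\<forall>c. \<forall>x\<in>hcarrier V. f (c *\<^sub>C x) = c *\<^sub>C f x)
    \<and> (\<forall>x\<in>hcarrier V. \<forall>y\<in>hcarrier V. hinner U (f x) (f y) = hinner V x y)
    \<and> (\<forall>a. \<forall>x\<in>hcarrier V. f (action V a x) = action U a (f x)))"

text \<open>Hilbert space direct sum; families are extended by 0 outside of the index set.\<close>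

definition direct_sum ::
  "'i set \<Rightarrow> ('i \<Rightarrow> ('a, 'v::complex_vector) representation) \<Rightarrow> ('a, 'i \<Rightarrow> 'v) representation" where
  "direct_sum I V = \<lparr>
     hcarrier = {x. (\<forall>i\<in>I. x i \<in> hcarrier (V i)) \<and> (\<forall>i. i \<notin> I \<longrightarrow> x i = 0)
       \<and> (\<lambda>i. (hnorm (V i) (x i))\<^sup>2) summable_on I},
     hinner = (\<lambda>x y. \<Sum>\<^sub>\<infinity>i\<in>I. hinner (V i) (x i) (y i)),
     action = (\<lambda>a x i. if i \<in> I then action (V i) a (x i) else 0)\<rparr>"


section \<open>The unitary dual\<close>

text \<open>
  An isomorphism class ranges over the representations carried by subspaces of the fixed type
  \<open>'a \<Rightarrow> complex\<close>, but \<open>iso_class V\<close> makes sense for \<open>V\<close> carried by any type. This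
  universe is large enough: if \<open>V\<close> is irreducible and \<open>v\<close> is a nonzero vector, then mapping \<open>w\<close> to
  the function taking \<open>a\<close> to the inner product of \<open>w\<close> and \<open>av\<close> embeds \<open>V\<close> into \<open>'a \<Rightarrow> complex\<close>.
  See \<open>irreducible_has_copy\<close> and \<open>iso_class_in_unitary_dual\<close> below.
\<close>

type_synonym 'a small_rep = "('a, 'a \<Rightarrow> complex) representation"

definition iso_class ::
  "('a::star_algebra, 'v::complex_vector) representation \<Rightarrow> 'a small_rep set" where
  "iso_class V = {U. unitary_rep U \<and> V \<cong>\<^sub>u U}"

definition unitary_dual :: "'a::star_algebra small_rep set set" where
  "unitary_dual = {iso_class V |V :: 'a small_rep. irreducible_unitary_rep V}"

definition dual_nbhd ::
  "'a::star_algebra small_rep \<Rightarrow> ('a \<Rightarrow> complex) \<Rightarrow> real \<Rightarrow> 'a set \<Rightarrow> 'a small_rep set set" where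
  "dual_nbhd V v \<epsilon> T = {iso_class U |U :: 'a small_rep. irreducible_unitary_rep U \<and>
     (\<exists>u\<in>hcarrier U. \<forall>a\<in>T. cmod (hinner V (action V a v) v - hinner U (action U a u) u) < \<epsilon>)}"

definition unitary_dual_topology :: "'a::star_algebra small_rep set topology" where
  "unitary_dual_topology = topology_generated_by
     {dual_nbhd V v \<epsilon> T |V v \<epsilon> T. irreducible_unitary_rep V \<and> v \<in> hcarrier V \<and> hnorm V v = 1
        \<and> \<epsilon> > 0 \<and> finite T}"

definition weakly_contained ::
  "('a, 'v) representation \<Rightarrow> ('a, 'w) representation \<Rightarrow> bool"  (infix \<open>\<prec>\<close> 50) where
  "V \<prec> V' \<longleftrightarrow> (\<forall>v\<in>hcarrier V. \<forall>\<epsilon>>0. \<forall>T. hnorm V v = 1 \<longrightarrow> finite T \<longrightarrow>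
     (\<exists>v'\<in>hcarrier V'. hnorm V' v' = 1 \<and>
       (\<forall>a\<in>T. cmod (hinner V (action V a v) v - hinner V' (action V' a v') v') < \<epsilon>)))"

definition Spec ::
  "('a::star_algebra, 'v::complex_vector) representation \<Rightarrow> 'a small_rep set set" where
  "Spec V' = {iso_class V |V :: 'a small_rep. irreducible_unitary_rep V \<and> V \<prec> V'}"


section \<open>The choice of universe\<close>

lemma scaleC_minus1: "(-1) *\<^sub>C x = - (x :: 'v::complex_vector)"
proof -
  have z: "0 *\<^sub>C x = 0" using scaleC_add_left[of 0 0 x] by simp
  have "(-1) *\<^sub>C x + x = 0"
    using scaleC_add_left[of "-1" 1 x] z by (simp add: scaleC_one)
  then show ?thesis by (simp add: eq_neg_iff_add_eq_0)
qed

context hilbert_space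
begin

lemma zero_closed: "0 \<in> hcarrier V"
  and add_closed: "\<lbrakk>x \<in> hcarrier V; y \<in> hcarrier V\<rbrakk> \<Longrightarrow> x + y \<in> hcarrier V"
  and scaleC_closed: "x \<in> hcarrier V \<Longrightarrow> c *\<^sub>C x \<in> hcarrier V"
  using subspace by (auto simp: is_subspace_def)

lemma diff_closed: "\<lbrakk>x \<in> hcarrier V; y \<in> hcarrier V\<rbrakk> \<Longrightarrow> x - y \<in> hcarrier V"
  using add_closed[of x "(-1) *\<^sub>C y"] scaleC_closed[of y "-1"] by (simp add: scaleC_minus1)

lemma inner_diff_left:
  assumes "x \<in> hcarrier V" "y \<in> hcarrier V" "z \<in> hcarrier V"
  shows "hinner V (x - y) z = hinner V x z - hinner V y z"
  using inner_add_left[of "x - y" y z] diff_closed assms by simp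

lemma inner_add_right:
  assumes "x \<in> hcarrier V" "y \<in> hcarrier V" "z \<in> hcarrier V"
  shows "hinner V z (x + y) = hinner V z x + hinner V z y"
  using assms inner_add_left[of x y z] inner_cnj[of _ z] add_closed
  by (metis complex_cnj_add)

lemma inner_diff_right:
  assumes "x \<in> hcarrier V" "y \<in> hcarrier V" "z \<in> hcarrier V"
  shows "hinner V z (x - y) = hinner V z x - hinner V z y"
  using inner_add_right[of "x - y" y z] diff_closed assms by simp

lemma inner_scaleC_right:
  assumes "x \<in> hcarrier V" "z \<in> hcarrier V"
  shows "hinner V z (c *\<^sub>C x) = cnj c * hinner V z x"
  using assms inner_scaleC_left[of x z c] inner_cnj[of _ z] scaleC_closed
  by (metis complex_cnj_mult)

lemma inner_zero_left: "z \<in> hcarrier V \<Longrightarrow> hinner V 0 z = 0"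
  using inner_add_left[of 0 0 z] zero_closed by simp

lemma inner_zero_right: "z \<in> hcarrier V \<Longrightarrow> hinner V z 0 = 0"
  using inner_add_right[of 0 0 z] zero_closed by simp

lemma inner_nonneg: "x \<in> hcarrier V \<Longrightarrow> Re (hinner V x x) \<ge> 0"
  using inner_pos[of x] inner_zero_left[OF zero_closed] by (cases "x = 0") auto

lemma hnorm_nonneg: "x \<in> hcarrier V \<Longrightarrow> hnorm V x \<ge> 0"
  by (simp add: hnorm_def inner_nonneg)

lemma hnorm_zero: "hnorm V 0 = 0"
  by (simp add: hnorm_def inner_zero_left zero_closed)

lemma hnorm_eq_0_iff: "x \<in> hcarrier V \<Longrightarrow> hnorm V x = 0 \<longleftrightarrow> x = 0"
  using inner_pos[of x] hnorm_zero by (cases "x = 0") (simp_all add: hnorm_def)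

lemma inner_self: "x \<in> hcarrier V \<Longrightarrow> hinner V x x = complex_of_real ((hnorm V x)\<^sup>2)"
  using inner_cnj[of x x] inner_nonneg[of x] by (auto simp: hnorm_def complex_eq_iff)

lemma Cauchy_Schwarz:
  assumes x: "x \<in> hcarrier V" and y: "y \<in> hcarrier V"
  shows "cmod (hinner V x y) \<le> hnorm V x * hnorm V y"
proof (cases "y = 0")
  case True
  then show ?thesis using inner_zero_right[of x] hnorm_nonneg assms by simp
next
  case False
  define s where "s = hnorm V y"
  have s: "s > 0" using False y hnorm_nonneg[of y] hnorm_eq_0_iff[of y] by (auto simp: s_def)
  define p where "p = hinner V x y"
  define t where "t = p / complex_of_real (s\<^sup>2)"
  define w where "w = x - t *\<^sub>C y"
  have ty: "t *\<^sub>C y \<in> hcarrier V" using y scaleC_closed by blast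
  have w: "w \<in> hcarrier V" using x ty diff_closed by (simp add: w_def)
  have st: "complex_of_real (s\<^sup>2) * t = p" using s by (simp add: t_def)
  have "hinner V w y = 0"
    using st x y ty by (simp add: w_def inner_diff_left inner_scaleC_left inner_self p_def s_def
        mult.commute)
  then have "hinner V w w = hinner V w x"
    using inner_diff_right[OF x ty w] inner_scaleC_right[OF y w] by (simp add: w_def[symmetric])
  also have "\<dots> = hinner V x x - t * cnj p"
    using x y ty inner_cnj[of x y] by (simp add: w_def inner_diff_left inner_scaleC_left p_def)
  also have "t * cnj p = complex_of_real ((cmod p)\<^sup>2 / s\<^sup>2)"
    by (simp add: t_def complex_norm_square del: of_real_power)
  finally have "Re (hinner V w w) = (hnorm V x)\<^sup>2 - (cmod p)\<^sup>2 / s\<^sup>2"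
    using x by (simp add: inner_self del: of_real_power of_real_divide)
  then have "(cmod p)\<^sup>2 / s\<^sup>2 \<le> (hnorm V x)\<^sup>2" using inner_nonneg[OF w] by simp
  then have "(cmod p)\<^sup>2 \<le> (hnorm V x * s)\<^sup>2"
    using s by (simp add: divide_le_eq power_mult_distrib)
  then show ?thesis
    using s hnorm_nonneg[OF x] by (simp add: p_def s_def abs_le_square_iff [symmetric])
qed

lemma hnorm_triangle:
  assumes "x \<in> hcarrier V" "y \<in> hcarrier V"
  shows "hnorm V (x + y) \<le> hnorm V x + hnorm V y"
proof -
  have "(hnorm V (x + y))\<^sup>2 = (hnorm V x)\<^sup>2 + (hnorm V y)\<^sup>2 + 2 * Re (hinner V x y)"
    using assms inner_cnj[of x y] arg_cong[OF inner_self[of "x+y"], of Re]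
      arg_cong[OF inner_self[of "x"], of Re] arg_cong[OF inner_self[of "y"], of Re]
    by (simp add: inner_add_left inner_add_right add_closed)
  also have "\<dots> \<le> (hnorm V x + hnorm V y)\<^sup>2"
    using Cauchy_Schwarz[OF assms] complex_Re_le_cmod[of "hinner V x y"]
    by (simp add: power2_sum)
  finally show ?thesis
    using hnorm_nonneg assms by (intro power2_le_imp_le[of "hnorm V (x + y)"]) simp_all
qed

lemma hnorm_minus_commute:
  assumes "x \<in> hcarrier V" "y \<in> hcarrier V"
  shows "hnorm V (x - y) = hnorm V (y - x)"
  using assms by (simp add: hnorm_def inner_diff_left inner_diff_right diff_closed)

lemma eq_0_if_inner_small:
  assumes "x \<in> hcarrier V"
    and "\<And>\<epsilon>. \<epsilon> > 0 \<Longrightarrow> \<exists>y\<in>hcarrier V. hnorm V (x - y) < \<epsilon> \<and> hinner V y x = 0"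
  shows "x = 0"
proof (rule ccontr)
  assume "x \<noteq> 0"
  then have pos: "hnorm V x > 0" using assms(1) hnorm_nonneg[of x] hnorm_eq_0_iff[of x] by auto
  obtain y where y: "y \<in> hcarrier V" "hnorm V (x - y) < hnorm V x" "hinner V y x = 0"
    using assms(2) pos by blast
  have "(hnorm V x)\<^sup>2 = cmod (hinner V (x - y) x)"
    using assms(1) y by (simp add: inner_diff_left inner_self norm_power)
  also have "\<dots> \<le> hnorm V (x - y) * hnorm V x"
    using assms(1) y by (intro Cauchy_Schwarz diff_closed)
  also have "\<dots> < hnorm V x * hnorm V x"
    using pos y by simp
  finally show False by (simp add: power2_eq_square)
qed

lemma inner_eq_0_limit:
  assumes "x \<in> hcarrier V" "z \<in> hcarrier V" "\<And>n::nat. X n \<in> hcarrier V"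
    and "\<And>n. hinner V (X n) z = 0" and "(\<lambda>n. hnorm V (X n - x)) \<longlonglongrightarrow> 0"
  shows "hinner V x z = 0"
proof -
  have "cmod (hinner V x z) \<le> hnorm V (X n - x) * hnorm V z" for n
    using Cauchy_Schwarz[of "X n - x" z] assms by (simp add: diff_closed inner_diff_left)
  moreover have "(\<lambda>n. hnorm V (X n - x) * hnorm V z) \<longlonglongrightarrow> 0 * hnorm V z"
    by (intro tendsto_intros assms)
  ultimately have "cmod (hinner V x z) \<le> 0"
    by (intro LIMSEQ_le_const[of "\<lambda>n. hnorm V (X n - x) * hnorm V z" 0]) auto
  then show ?thesis by simp
qed

end

lemma unitarily_isomorphic_refl: "V \<cong>\<^sub>u V"
  unfolding unitarily_isomorphic_def by (rule exI[of _ "\<lambda>x. x"]) (auto simp: bij_betw_def)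

lemma unitarily_isomorphic_trans:
  assumes "V \<cong>\<^sub>u U" and "U \<cong>\<^sub>u W"
  shows "V \<cong>\<^sub>u W"
proof -
  obtain f where f: "bij_betw f (hcarrier V) (hcarrier U)"
    "\<forall>x\<in>hcarrier V. \<forall>y\<in>hcarrier V. f (x + y) = f x + f y"
    "\<forall>c. \<forall>x\<in>hcarrier V. f (c *\<^sub>C x) = c *\<^sub>C f x"
    "\<forall>x\<in>hcarrier V. \<forall>y\<in>hcarrier V. hinner U (f x) (f y) = hinner V x y"
    "\<forall>a. \<forall>x\<in>hcarrier V. f (action V a x) = action U a (f x)"
    using assms(1) unfolding unitarily_isomorphic_def by blast
  obtain g where g: "bij_betw g (hcarrier U) (hcarrier W)"
    "\<forall>x\<in>hcarrier U. \<forall>y\<in>hcarrier U. g (x + y) = g x + g y"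
    "\<forall>c. \<forall>x\<in>hcarrier U. g (c *\<^sub>C x) = c *\<^sub>C g x"
    "\<forall>x\<in>hcarrier U. \<forall>y\<in>hcarrier U. hinner W (g x) (g y) = hinner U x y"
    "\<forall>a. \<forall>x\<in>hcarrier U. g (action U a x) = action W a (g x)"
    using assms(2) unfolding unitarily_isomorphic_def by blast
  have fU: "f x \<in> hcarrier U" if "x \<in> hcarrier V" for x using f(1) that bij_betwE by blast
  show ?thesis unfolding unitarily_isomorphic_def
    by (rule exI[of _ "\<lambda>x. g (f x)"])
      (use f g fU bij_betw_trans[OF f(1) g(1)] in \<open>simp add: comp_def\<close>)
qed

lemma unitarily_isomorphic_sym:
  assumes "V \<cong>\<^sub>u U" and "unitary_rep V"
  shows "U \<cong>\<^sub>u V"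
proof -
  interpret unitary_rep V by fact
  obtain f where f: "bij_betw f (hcarrier V) (hcarrier U)"
    "\<forall>x\<in>hcarrier V. \<forall>y\<in>hcarrier V. f (x + y) = f x + f y"
    "\<forall>c. \<forall>x\<in>hcarrier V. f (c *\<^sub>C x) = c *\<^sub>C f x"
    "\<forall>x\<in>hcarrier V. \<forall>y\<in>hcarrier V. hinner U (f x) (f y) = hinner V x y"
    "\<forall>a. \<forall>x\<in>hcarrier V. f (action V a x) = action U a (f x)"
    using assms(1) unfolding unitarily_isomorphic_def by blast
  define g where "g = inv_into (hcarrier V) f"
  have gb: "bij_betw g (hcarrier U) (hcarrier V)" unfolding g_def by (rule bij_betw_inv_into[OF f(1)])
  have gV: "g x \<in> hcarrier V" and fg: "f (g x) = x" if "x \<in> hcarrier U" for x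
    using gb that f(1) by (auto simp: g_def bij_betwE bij_betw_inv_into_right)
  have gf: "g (f x) = x" if "x \<in> hcarrier V" for x
    using f(1) that by (simp add: g_def bij_betw_inv_into_left)
  have "g (x + y) = g x + g y" if "x \<in> hcarrier U" "y \<in> hcarrier U" for x y
    using gf[of "g x + g y"] f(2) gV fg that by (simp add: add_closed)
  moreover have "g (c *\<^sub>C x) = c *\<^sub>C g x" if "x \<in> hcarrier U" for c x
    using gf[of "c *\<^sub>C g x"] f(3) gV fg that by (simp add: scaleC_closed)
  moreover have "g (action U a x) = action V a (g x)" if "x \<in> hcarrier U" for a x
    using gf[of "action V a (g x)"] f(5) gV fg that by (simp add: action_closed)
  moreover have "hinner V (g x) (g y) = hinner U x y" if "x \<in> hcarrier U" "y \<in> hcarrier U" for x y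
    using f(4) gV fg that by metis
  ultimately show ?thesis
    using gb unfolding unitarily_isomorphic_def by (intro exI[of _ g]) auto
qed

lemma iso_class_eq_iff:
  fixes U :: "'a::star_algebra small_rep"
  assumes "unitary_rep V" and "unitary_rep U"
  shows "iso_class V = iso_class U \<longleftrightarrow> V \<cong>\<^sub>u U"
proof
  assume "iso_class V = iso_class U"
  moreover have "U \<in> iso_class U" using assms by (simp add: iso_class_def unitarily_isomorphic_refl)
  ultimately show "V \<cong>\<^sub>u U" by (auto simp: iso_class_def)
next
  assume VU: "V \<cong>\<^sub>u U"
  have "V \<cong>\<^sub>u W \<longleftrightarrow> U \<cong>\<^sub>u W" for W :: "'a small_rep"
    using unitarily_isomorphic_trans[OF VU]
      unitarily_isomorphic_trans[OF unitarily_isomorphic_sym[OF VU assms(1)]] by blast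
  then show "iso_class V = iso_class U" by (simp add: iso_class_def)
qed

lemma irreducible_isomorphic:
  assumes iso: "V \<cong>\<^sub>u U" and U: "unitary_rep U" and V: "irreducible_unitary_rep V"
  shows "irreducible_unitary_rep U"
proof -
  interpret V: unitary_rep V using V by (simp add: irreducible_unitary_rep_def)
  interpret U: unitary_rep U by fact
  obtain f where f: "bij_betw f (hcarrier V) (hcarrier U)"
    and f_add: "\<And>x y. x \<in> hcarrier V \<Longrightarrow> y \<in> hcarrier V \<Longrightarrow> f (x + y) = f x + f y"
    and f_scaleC: "\<And>c x. x \<in> hcarrier V \<Longrightarrow> f (c *\<^sub>C x) = c *\<^sub>C f x"
    and f_inner: "\<And>x y. x \<in> hcarrier V \<Longrightarrow> y \<in> hcarrier V \<Longrightarrow> hinner U (f x) (f y) = hinner V x y"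
    and f_action: "\<And>a x. x \<in> hcarrier V \<Longrightarrow> f (action V a x) = action U a (f x)"
    using iso unfolding unitarily_isomorphic_def by blast
  have f0: "f 0 = 0" using f_add[of 0 0] V.zero_closed by simp
  have fU: "f x \<in> hcarrier U" if "x \<in> hcarrier V" for x using f that bij_betwE by blast
  have f_diff: "f (x - y) = f x - f y" if "x \<in> hcarrier V" "y \<in> hcarrier V" for x y
    using f_add[of "x - y" y] that V.diff_closed by (simp add: algebra_simps)
  have f_norm: "hnorm U (f x) = hnorm V x" if "x \<in> hcarrier V" for x
    using f_inner that by (simp add: hnorm_def)
  have f_img: "f ` hcarrier V = hcarrier U" using f by (simp add: bij_betw_def)
  have "W = {0} \<or> W = hcarrier U" if W: "closed_submodule U W" for W
  proof -
    define W' where "W' = {x \<in> hcarrier V. f x \<in> W}"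
    have WU: "W \<subseteq> hcarrier U" and Wsub: "is_subspace W" and Wact: "\<And>a w. w \<in> W \<Longrightarrow> action U a w \<in> W"
      and Wcl: "\<And>X x. x \<in> hcarrier U \<Longrightarrow> (\<And>n::nat. X n \<in> W) \<Longrightarrow> (\<lambda>n. hnorm U (X n - x)) \<longlonglongrightarrow> 0 \<Longrightarrow> x \<in> W"
      using W unfolding closed_submodule_def by blast+
    have img: "f ` W' = W" using WU f_img by (force simp: W'_def)
    have "closed_submodule V W'"
      unfolding closed_submodule_def
    proof (intro conjI allI ballI impI)
      show "W' \<subseteq> hcarrier V" by (auto simp: W'_def)
      show "is_subspace W'"
        using Wsub f0 V.zero_closed V.add_closed V.scaleC_closed
        by (auto simp: is_subspace_def W'_def f_add f_scaleC)
      show "action V a w \<in> W'" if "w \<in> W'" for a w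
        using that Wact V.action_closed by (auto simp: W'_def f_action)
    next
      fix X x assume x: "x \<in> hcarrier V" and X: "\<forall>n::nat. X n \<in> W'"
        and lim: "(\<lambda>n. hnorm V (X n - x)) \<longlonglongrightarrow> 0"
      have "hnorm V (X n - x) = hnorm U (f (X n) - f x)" for n
        using X x f_norm[of "X n - x"] f_diff[of "X n" x] V.diff_closed by (auto simp: W'_def)
      then have "f x \<in> W" using Wcl[of "f x" "\<lambda>n. f (X n)"] X x lim fU by (auto simp: W'_def)
      then show "x \<in> W'" using x by (simp add: W'_def)
    qed
    then have "W' = {0} \<or> W' = hcarrier V"
      using V by (simp add: irreducible_unitary_rep_def)
    then show ?thesis using img f0 f_img by auto
  qed
  moreover have "hcarrier U \<noteq> {0}"
  proof
    assume U0: "hcarrier U = {0}"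
    have "x = 0" if "x \<in> hcarrier V" for x
      using f_norm[OF that] fU[OF that] U0 that U.hnorm_eq_0_iff[of 0] V.hnorm_eq_0_iff[of x] by simp
    then have "hcarrier V = {0}" using V.zero_closed by auto
    then show False using V by (simp add: irreducible_unitary_rep_def)
  qed
  ultimately show ?thesis using U by (simp add: irreducible_unitary_rep_def)
qed

lemma (in unitary_rep) transport:
  fixes f :: "'v \<Rightarrow> 'w::complex_vector"
  assumes inj: "inj_on f (hcarrier V)"
    and f_add: "\<And>x y. x \<in> hcarrier V \<Longrightarrow> y \<in> hcarrier V \<Longrightarrow> f (x + y) = f x + f y"
    and f_scaleC: "\<And>c x. x \<in> hcarrier V \<Longrightarrow> f (c *\<^sub>C x) = c *\<^sub>C f x"
  shows "\<exists>U :: ('a, 'w) representation. unitary_rep U \<and> V \<cong>\<^sub>u U"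
proof -
  define g where "g = inv_into (hcarrier V) f"
  have gf: "g (f x) = x" if "x \<in> hcarrier V" for x using inj that by (simp add: g_def)
  have f0: "f 0 = 0" using f_add[of 0 0] zero_closed by simp
  have f_diff: "f x - f y = f (x - y)" if "x \<in> hcarrier V" "y \<in> hcarrier V" for x y
    using f_add[of "x - y" y] that diff_closed by (simp add: algebra_simps)
  define U :: "('a, 'w) representation" where
    "U = \<lparr>hcarrier = f ` hcarrier V, hinner = (\<lambda>x y. hinner V (g x) (g y)),
       action = (\<lambda>a x. f (action V a (g x)))\<rparr>"
  have cU: "hcarrier U = f ` hcarrier V" by (simp add: U_def)
  have iU: "hinner U (f x) (f y) = hinner V x y" if "x \<in> hcarrier V" "y \<in> hcarrier V" for x y
    using that gf by (simp add: U_def)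
  have aU: "action U a (f x) = f (action V a x)" if "x \<in> hcarrier V" for a x
    using that gf by (simp add: U_def)
  have nU: "hnorm U (f x) = hnorm V x" if "x \<in> hcarrier V" for x
    using that iU by (simp add: hnorm_def)
  note cl = add_closed scaleC_closed diff_closed action_closed zero_closed
  have "unitary_rep U"
  proof
    show "is_subspace (hcarrier U)"
      unfolding is_subspace_def cU using cl f0 
      by (auto simp: f_add[symmetric] f_scaleC[symmetric] intro: image_eqI[of _ _ 0])
  next
    fix x y z assume "x \<in> hcarrier U" "y \<in> hcarrier U" "z \<in> hcarrier U"
    then show "hinner U (x + y) z = hinner U x z + hinner U y z"
      using cl by (auto simp: cU f_add[symmetric] iU inner_add_left)
  next
    fix x z c assume "x \<in> hcarrier U" "z \<in> hcarrier U"
    then show "hinner U (c *\<^sub>C x) z = c * hinner U x z"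
      using cl by (auto simp: cU f_scaleC[symmetric] iU inner_scaleC_left)
  next
    fix x y assume "x \<in> hcarrier U" "y \<in> hcarrier U"
    then obtain x' y' where *: "x' \<in> hcarrier V" "x = f x'" "y' \<in> hcarrier V" "y = f y'"
      by (auto simp: cU)
    show "hinner U y x = cnj (hinner U x y)"
      using * inner_cnj[of x' y'] by (simp add: iU)
  next
    fix x assume "x \<in> hcarrier U" "x \<noteq> 0"
    then obtain x' where "x' \<in> hcarrier V" "x = f x'" "x' \<noteq> 0"
      using f0 by (auto simp: cU)
    then show "0 < Re (hinner U x x)" using inner_pos by (simp add: iU)
  next
    fix X :: "nat \<Rightarrow> 'w"
    assume X: "\<And>n. X n \<in> hcarrier U"
      and Cau: "\<And>\<epsilon>. \<epsilon> > 0 \<Longrightarrow> \<exists>N. \<forall>m\<ge>N. \<forall>n\<ge>N. hnorm U (X m - X n) < \<epsilon>"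
    define Y where "Y n = g (X n)" for n
    have Y: "Y n \<in> hcarrier V" and XY: "X n = f (Y n)" for n
      using X[of n] gf by (auto simp: Y_def cU)
    have d: "hnorm U (X m - f y) = hnorm V (Y m - y)" if "y \<in> hcarrier V" for m y
      using that Y nU cl by (simp add: XY f_diff)
    obtain y where y: "y \<in> hcarrier V" "(\<lambda>n. hnorm V (Y n - y)) \<longlonglongrightarrow> 0"
      using complete[of Y] Y Cau d[OF Y] by (metis XY)
    then show "\<exists>x\<in>hcarrier U. (\<lambda>n. hnorm U (X n - x)) \<longlonglongrightarrow> 0"
      by (intro bexI[of _ "f y"]) (auto simp: d cU)
  next
    fix a v assume "v \<in> hcarrier U"
    then show "action U a v \<in> hcarrier U" using cl by (auto simp: cU aU)
  next
    fix a v w assume "v \<in> hcarrier U" "w \<in> hcarrier U"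
    then show "action U a (v + w) = action U a v + action U a w"
      using cl by (auto simp: cU aU f_add[symmetric] action_add_right)
  next
    fix a v c assume "v \<in> hcarrier U"
    then show "action U a (c *\<^sub>C v) = c *\<^sub>C action U a v"
      using cl by (auto simp: cU aU f_scaleC[symmetric] action_scaleC_right)
  next
    fix a b v assume "v \<in> hcarrier U"
    then show "action U (a + b) v = action U a v + action U b v"
      using cl by (auto simp: cU aU f_add[symmetric] action_add_left)
  next
    fix a v c assume "v \<in> hcarrier U"
    then show "action U (c *\<^sub>C a) v = c *\<^sub>C action U a v"
      using cl by (auto simp: cU aU f_scaleC[symmetric] action_scaleC_left)
  next
    fix a b v assume "v \<in> hcarrier U"
    then show "action U (a * b) v = action U a (action U b v)"
      using cl by (auto simp: cU aU action_mult)
  next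
    fix a
    show "\<exists>C. \<forall>v\<in>hcarrier U. hnorm U (action U a v) \<le> C * hnorm U v"
      using action_bounded[of a] cl by (auto simp: cU aU nU)
  next
    fix a v w assume "v \<in> hcarrier U" "w \<in> hcarrier U"
    then show "hinner U (action U a v) w = hinner U v (action U (star a) w)"
      using cl action_star by (auto simp: cU aU iU)
  next
    fix v and \<epsilon> :: real assume "v \<in> hcarrier U" "\<epsilon> > 0"
    then obtain x where x: "x \<in> hcarrier V" "v = f x" by (auto simp: cU)
    obtain a w where w: "w \<in> hcarrier V" "hnorm V (x - action V a w) < \<epsilon>"
      using action_dense x \<open>\<epsilon> > 0\<close> by blast
    have "hnorm U (v - action U a (f w)) < \<epsilon>"
      using x w cl nU by (simp add: aU f_diff)
    then show "\<exists>a. \<exists>w\<in>hcarrier U. hnorm U (v - action U a w) < \<epsilon>"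
      using w by (auto simp: cU)
  qed
  moreover have "V \<cong>\<^sub>u U"
    unfolding unitarily_isomorphic_def
    by (rule exI[of _ f]) (use inj iU aU f_add f_scaleC in \<open>auto simp: bij_betw_def cU\<close>)
  ultimately show ?thesis by blast
qed

lemma irreducible_has_copy:
  fixes V :: "('a::star_algebra, 'v::complex_vector) representation"
  assumes "irreducible_unitary_rep V"
  shows "\<exists>U :: 'a small_rep. irreducible_unitary_rep U \<and> V \<cong>\<^sub>u U"
proof -
  interpret unitary_rep V using assms by (simp add: irreducible_unitary_rep_def)
  have "\<exists>v\<in>hcarrier V. v \<noteq> 0"
    using assms zero_closed by (auto simp: irreducible_unitary_rep_def)
  then obtain v where v: "v \<in> hcarrier V" "v \<noteq> 0" by blast
  define W where "W = {w \<in> hcarrier V. \<forall>a. hinner V w (action V a v) = 0}"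
  have "closed_submodule V W"
    unfolding closed_submodule_def
  proof (intro conjI allI ballI impI)
    show "W \<subseteq> hcarrier V" by (auto simp: W_def)
    show "is_subspace W"
      using v by (auto simp: is_subspace_def W_def zero_closed add_closed scaleC_closed action_closed
          inner_zero_left inner_add_left inner_scaleC_left)
    show "action V b w \<in> W" if "w \<in> W" for b w
      using v that by (auto simp: W_def action_closed action_star action_mult[symmetric])
  next
    fix X x assume "x \<in> hcarrier V" "\<forall>n::nat. X n \<in> W" "(\<lambda>n. hnorm V (X n - x)) \<longlonglongrightarrow> 0"
    then show "x \<in> W"
      using v inner_eq_0_limit[of x _ X] by (auto simp: W_def action_closed)
  qed
  moreover have "W \<noteq> hcarrier V"
  proof
    assume W: "W = hcarrier V"
    have "hinner V (action V a w) v = 0" if "w \<in> hcarrier V" for a w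
      using that v W by (auto simp: W_def action_star)
    then have "v = 0"
      using action_dense[of v] v by (intro eq_0_if_inner_small) (blast intro: action_closed)+
    then show False using v by simp
  qed
  ultimately have W: "W = {0}" using assms by (auto simp: irreducible_unitary_rep_def)
  define f where "f w = (\<lambda>a. hinner V w (action V a v))" for w
  have "inj_on f (hcarrier V)"
  proof (rule inj_onI)
    fix x y assume xy: "x \<in> hcarrier V" "y \<in> hcarrier V" and "f x = f y"
    then have "hinner V (x - y) (action V a v) = 0" for a
      using v by (simp add: inner_diff_left action_closed f_def fun_eq_iff)
    then have "x - y \<in> W" using xy by (simp add: W_def diff_closed)
    then show "x = y" using W by simp
  qed
  moreover have "f (x + y) = f x + f y" if "x \<in> hcarrier V" "y \<in> hcarrier V" for x y
    using that v by (simp add: f_def inner_add_left action_closed fun_eq_iff)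
  moreover have "f (c *\<^sub>C x) = c *\<^sub>C f x" if "x \<in> hcarrier V" for c x
    using that v
    by (simp add: f_def inner_scaleC_left action_closed fun_eq_iff scaleC_fun_def scaleC_complex_def)
  ultimately obtain U :: "'a small_rep" where "unitary_rep U" "V \<cong>\<^sub>u U"
    using transport[of f] by blast
  then show ?thesis using irreducible_isomorphic assms by blast
qed

lemma iso_class_in_unitary_dual:
  fixes V :: "('a::star_algebra, 'v::complex_vector) representation"
  assumes "irreducible_unitary_rep V"
  shows "iso_class V \<in> unitary_dual"
proof -
  obtain U :: "'a small_rep" where U: "irreducible_unitary_rep U" "V \<cong>\<^sub>u U"
    using irreducible_has_copy assms by blast
  then have "iso_class V = iso_class U"
    using assms iso_class_eq_iff by (auto simp: irreducible_unitary_rep_def)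
  then show ?thesis using U by (auto simp: unitary_dual_def)
qed

lemma topspace_unitary_dual_topology: "topspace unitary_dual_topology = unitary_dual"
proof
  show "topspace unitary_dual_topology \<subseteq> unitary_dual"
    by (auto simp: unitary_dual_topology_def unitary_dual_def dual_nbhd_def)
next
  show "unitary_dual \<subseteq> topspace (unitary_dual_topology :: 'a::star_algebra small_rep set topology)"
  proof
    fix c :: "'a small_rep set" assume "c \<in> unitary_dual"
    then obtain V where V: "irreducible_unitary_rep V" "c = iso_class (V :: 'a small_rep)"
      by (auto simp: unitary_dual_def)
    interpret unitary_rep V using V by (simp add: irreducible_unitary_rep_def)
    have "\<exists>v\<in>hcarrier V. v \<noteq> 0"
      using V zero_closed by (auto simp: irreducible_unitary_rep_def)
    then obtain v where v: "v \<in> hcarrier V" "v \<noteq> 0" by blast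
    define s where "s = hnorm V v"
    have s: "s > 0" using v hnorm_nonneg[of v] hnorm_eq_0_iff[of v] by (auto simp: s_def)
    define u where "u = complex_of_real (1 / s) *\<^sub>C v"
    have u: "u \<in> hcarrier V" using v by (simp add: u_def scaleC_closed)
    have "hinner V u u = 1"
      using v s inner_self[of v] by (simp add: u_def inner_scaleC_left inner_scaleC_right scaleC_closed
          s_def[symmetric] power2_eq_square)
    then have "hnorm V u = 1" by (simp add: hnorm_def)
    moreover have "c \<in> dual_nbhd V u 1 {}" using V u by (auto simp: dual_nbhd_def)
    ultimately show "c \<in> topspace unitary_dual_topology"
      unfolding unitary_dual_topology_def topology_generated_by_topspace
      using V u by (intro UnionI[of "dual_nbhd V u 1 {}"] CollectI exI[of _ V] exI[of _ u]
        exI[of _ 1] exI[of _ "{}"]) simp_all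
  qed
qed


section \<open>Direct sums of unitary representations\<close>

lemma direct_sum_simps:
  "x \<in> hcarrier (direct_sum I V) \<longleftrightarrow> (\<forall>i\<in>I. x i \<in> hcarrier (V i)) \<and> (\<forall>i. i \<notin> I \<longrightarrow> x i = 0)
     \<and> (\<lambda>i. (hnorm (V i) (x i))\<^sup>2) summable_on I"
  "hinner (direct_sum I V) x y = (\<Sum>\<^sub>\<infinity>i\<in>I. hinner (V i) (x i) (y i))"
  "action (direct_sum I V) a x = (\<lambda>i. if i \<in> I then action (V i) a (x i) else 0)"
  by (auto simp: direct_sum_def)

context
  fixes I :: "'i set"
    and V :: "'i \<Rightarrow> ('a::star_algebra, 'v::complex_vector) representation"
  assumes V: "\<And>i. i \<in> I \<Longrightarrow> unitary_rep (V i)"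
begin

lemma hilbert_space_summand: "i \<in> I \<Longrightarrow> hilbert_space (V i)"
  using V unitary_rep_def by blast

lemma direct_sum_inner_summable:
  assumes "x \<in> hcarrier (direct_sum I V)" and "y \<in> hcarrier (direct_sum I V)"
  shows "(\<lambda>i. hinner (V i) (x i) (y i)) summable_on I"
proof -
  have sq: "(\<lambda>i. (hnorm (V i) (x i))\<^sup>2 + (hnorm (V i) (y i))\<^sup>2) summable_on I"
    using assms by (intro summable_on_add) (auto simp: direct_sum_simps)
  have "norm (hinner (V i) (x i) (y i)) \<le> (hnorm (V i) (x i))\<^sup>2 + (hnorm (V i) (y i))\<^sup>2"
    if i: "i \<in> I" for i
  proof -
    interpret hilbert_space "V i" using i by (rule hilbert_space_summand)
    have *: "x i \<in> hcarrier (V i)" "y i \<in> hcarrier (V i)"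
      using assms i by (auto simp: direct_sum_simps)
    have "0 \<le> hnorm (V i) (x i) * hnorm (V i) (y i)" using * hnorm_nonneg by simp
    then show ?thesis
      using Cauchy_Schwarz[OF *] sum_squares_bound[of "hnorm (V i) (x i)" "hnorm (V i) (y i)"]
      by linarith
  qed
  from Infinite_Sum.abs_summable_on_comparison_test'[OF sq this] show ?thesis
    by (rule Infinite_Sum.abs_summable_summable)
qed

lemma direct_sum_inner_self:
  assumes "x \<in> hcarrier (direct_sum I V)"
  shows "hinner (direct_sum I V) x x = of_real (\<Sum>\<^sub>\<infinity>i\<in>I. (hnorm (V i) (x i))\<^sup>2)"
proof -
  have "hinner (direct_sum I V) x x = (\<Sum>\<^sub>\<infinity>i\<in>I. of_real ((hnorm (V i) (x i))\<^sup>2))"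
    using assms hilbert_space.inner_self[OF hilbert_space_summand]
    unfolding direct_sum_simps by (intro infsum_cong) auto
  moreover have "((\<lambda>i. (hnorm (V i) (x i))\<^sup>2) has_sum (\<Sum>\<^sub>\<infinity>i\<in>I. (hnorm (V i) (x i))\<^sup>2)) I"
    using assms by (intro has_sum_infsum) (simp add: direct_sum_simps)
  ultimately show ?thesis by (simp only: infsumI[OF has_sum_of_real])
qed

lemma direct_sum_hnorm:
  assumes "x \<in> hcarrier (direct_sum I V)"
  shows "(hnorm (direct_sum I V) x)\<^sup>2 = (\<Sum>\<^sub>\<infinity>i\<in>I. (hnorm (V i) (x i))\<^sup>2)"
    and "hnorm (direct_sum I V) x \<ge> 0"
proof -
  have "(\<Sum>\<^sub>\<infinity>i\<in>I. (hnorm (V i) (x i))\<^sup>2) \<ge> 0" by (rule infsum_nonneg) simp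
  then show "(hnorm (direct_sum I V) x)\<^sup>2 = (\<Sum>\<^sub>\<infinity>i\<in>I. (hnorm (V i) (x i))\<^sup>2)"
    "hnorm (direct_sum I V) x \<ge> 0"
    using direct_sum_inner_self[OF assms] by (auto simp: hnorm_def)
qed

lemma direct_sum_subspace: "is_subspace (hcarrier (direct_sum I V))"
  unfolding is_subspace_def
proof (intro conjI allI ballI)
  show "0 \<in> hcarrier (direct_sum I V)"
    using hilbert_space.zero_closed[OF hilbert_space_summand]
      hilbert_space.hnorm_zero[OF hilbert_space_summand]
      summable_on_cong[of I "\<lambda>i. (hnorm (V i) 0)\<^sup>2" "\<lambda>_. 0"]
    by (auto simp: direct_sum_simps)
next
  fix x y assume x: "x \<in> hcarrier (direct_sum I V)" and y: "y \<in> hcarrier (direct_sum I V)"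
  have "(\<lambda>i. (hnorm (V i) (x i + y i))\<^sup>2) summable_on I"
  proof (rule summable_on_comparison_test)
    show "(\<lambda>i. 2 * (hnorm (V i) (x i))\<^sup>2 + 2 * (hnorm (V i) (y i))\<^sup>2) summable_on I"
      using x y by (intro summable_on_add summable_on_cmult_right) (auto simp: direct_sum_simps)
    fix i assume i: "i \<in> I"
    interpret hilbert_space "V i" using i by (rule hilbert_space_summand)
    have *: "x i \<in> hcarrier (V i)" "y i \<in> hcarrier (V i)"
      using x y i by (auto simp: direct_sum_simps)
    have "(hnorm (V i) (x i + y i))\<^sup>2 \<le> (hnorm (V i) (x i) + hnorm (V i) (y i))\<^sup>2"
      using * hnorm_triangle hnorm_nonneg add_closed by (intro power_mono) auto
    also have "\<dots> \<le> 2 * (hnorm (V i) (x i))\<^sup>2 + 2 * (hnorm (V i) (y i))\<^sup>2"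
      using sum_squares_bound[of "hnorm (V i) (x i)" "hnorm (V i) (y i)"] by (simp add: power2_sum)
    finally show "(hnorm (V i) (x i + y i))\<^sup>2 \<le> 2 * (hnorm (V i) (x i))\<^sup>2 + 2 * (hnorm (V i) (y i))\<^sup>2" .
  qed auto
  then show "x + y \<in> hcarrier (direct_sum I V)"
    using x y hilbert_space.add_closed[OF hilbert_space_summand] by (auto simp: direct_sum_simps)
next
  fix c x assume x: "x \<in> hcarrier (direct_sum I V)"
  have z: "c *\<^sub>C (0 :: 'v) = 0" using scaleC_add_right[of c "0::'v" 0] by simp
  have "(hnorm (V i) (c *\<^sub>C x i))\<^sup>2 = (cmod c)\<^sup>2 * (hnorm (V i) (x i))\<^sup>2" if i: "i \<in> I" for i
  proof -
    interpret hilbert_space "V i" using i by (rule hilbert_space_summand)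
    have *: "x i \<in> hcarrier (V i)" using x i by (auto simp: direct_sum_simps)
    have "complex_of_real ((hnorm (V i) (c *\<^sub>C x i))\<^sup>2) = (c * cnj c) * hinner (V i) (x i) (x i)"
      using * by (simp add: inner_self[symmetric] scaleC_closed inner_scaleC_left inner_scaleC_right
          del: of_real_power)
    also have "\<dots> = complex_of_real ((cmod c)\<^sup>2 * (hnorm (V i) (x i))\<^sup>2)"
      using * by (simp add: inner_self complex_norm_square[symmetric])
    finally show ?thesis by (simp only: of_real_eq_iff)
  qed
  then have "(\<lambda>i. (hnorm (V i) (c *\<^sub>C x i))\<^sup>2) summable_on I"
    using x by (auto simp: direct_sum_simps summable_on_cmult_right cong: summable_on_cong)
  then show "c *\<^sub>C x \<in> hcarrier (direct_sum I V)"
    using x z hilbert_space.scaleC_closed[OF hilbert_space_summand]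
    by (auto simp: direct_sum_simps scaleC_fun_def)
qed

lemma direct_sum_diff_closed:
  assumes "x \<in> hcarrier (direct_sum I V)" and "y \<in> hcarrier (direct_sum I V)"
  shows "x - y \<in> hcarrier (direct_sum I V)"
proof -
  have "x + (-1) *\<^sub>C y \<in> hcarrier (direct_sum I V)"
    using direct_sum_subspace assms by (simp add: is_subspace_def)
  then show ?thesis by (simp add: scaleC_minus1)
qed

lemma direct_sum_le:
  assumes "x \<in> hcarrier (direct_sum I V)" and "finite F" and "F \<subseteq> I"
  shows "(\<Sum>i\<in>F. (hnorm (V i) (x i))\<^sup>2) \<le> (hnorm (direct_sum I V) x)\<^sup>2"
  using assms unfolding direct_sum_hnorm(1)[OF assms(1)]
  by (intro finite_sum_le_infsum) (auto simp: direct_sum_simps)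

lemma direct_sum_complete:
  fixes X :: "nat \<Rightarrow> 'i \<Rightarrow> 'v"
  assumes X: "\<And>n. X n \<in> hcarrier (direct_sum I V)"
    and Cau: "\<And>\<epsilon>. \<epsilon> > 0 \<Longrightarrow> \<exists>N. \<forall>m\<ge>N. \<forall>n\<ge>N. hnorm (direct_sum I V) (X m - X n) < \<epsilon>"
  shows "\<exists>x\<in>hcarrier (direct_sum I V). (\<lambda>n. hnorm (direct_sum I V) (X n - x)) \<longlonglongrightarrow> 0"
proof -
  have "\<exists>z\<in>hcarrier (V i). (\<lambda>n. hnorm (V i) (X n i - z)) \<longlonglongrightarrow> 0" if i: "i \<in> I" for i
  proof -
    interpret hilbert_space "V i" using i by (rule hilbert_space_summand)
    have "hnorm (V i) (X m i - X n i) \<le> hnorm (direct_sum I V) (X m - X n)" for m n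
      using direct_sum_le[OF direct_sum_diff_closed[OF X X], of "{i}" m n] i
        direct_sum_hnorm(2)[OF direct_sum_diff_closed[OF X X], of m n]
      by (auto intro: power2_le_imp_le)
    then have "\<And>\<epsilon>. \<epsilon> > 0 \<Longrightarrow> \<exists>N. \<forall>m\<ge>N. \<forall>n\<ge>N. hnorm (V i) (X m i - X n i) < \<epsilon>"
      using Cau by (meson le_less_trans)
    then show ?thesis
      using X i by (intro complete) (auto simp: direct_sum_simps)
  qed
  then obtain z where z: "\<And>i. i \<in> I \<Longrightarrow> z i \<in> hcarrier (V i)"
    "\<And>i. i \<in> I \<Longrightarrow> (\<lambda>n. hnorm (V i) (X n i - z i)) \<longlonglongrightarrow> 0"
    by metis
  define x where "x i = (if i \<in> I then z i else 0)" for i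
  have x: "x i \<in> hcarrier (V i)" "(\<lambda>n. hnorm (V i) (X n i - x i)) \<longlonglongrightarrow> 0" if "i \<in> I" for i
    using z that by (auto simp: x_def)
  have Xi: "X n i \<in> hcarrier (V i)" if "i \<in> I" for n i
    using X that by (auto simp: direct_sum_simps)
  have key: "\<exists>N. \<forall>n\<ge>N. \<forall>F. finite F \<longrightarrow> F \<subseteq> I \<longrightarrow> (\<Sum>i\<in>F. (hnorm (V i) (X n i - x i))\<^sup>2) \<le> \<epsilon>\<^sup>2"
    if "\<epsilon> > 0" for \<epsilon>
  proof -
    obtain N where N: "\<forall>m\<ge>N. \<forall>n\<ge>N. hnorm (direct_sum I V) (X m - X n) < \<epsilon>"
      using Cau \<open>\<epsilon> > 0\<close> by blast
    show ?thesis
    proof (intro exI[of _ N] allI impI)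
      fix n F assume n: "N \<le> n" and F: "finite F" "F \<subseteq> I"
      have "(\<lambda>m. hnorm (V i) (X n i - X m i)) \<longlonglongrightarrow> hnorm (V i) (X n i - x i)" if "i \<in> F" for i
      proof -
        interpret hilbert_space "V i" using F that by (intro hilbert_space_summand) auto
        have i: "i \<in> I" using F that by auto
        have "\<bar>hnorm (V i) (X n i - X m i) - hnorm (V i) (X n i - x i)\<bar> \<le> hnorm (V i) (X m i - x i)" for m
          using hnorm_triangle[of "X n i - X m i" "X m i - x i"]
            hnorm_triangle[of "X n i - x i" "x i - X m i"] hnorm_minus_commute[of "x i" "X m i"]
            x(1)[OF i] Xi[OF i] diff_closed by (simp add: abs_le_iff)
        then show ?thesis
          by (intro LIM_zero_cancel[OF Lim_null_comparison[OF _ x(2)[OF i]]]) simp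
      qed
      then have "(\<lambda>m. \<Sum>i\<in>F. (hnorm (V i) (X n i - X m i))\<^sup>2)
          \<longlonglongrightarrow> (\<Sum>i\<in>F. (hnorm (V i) (X n i - x i))\<^sup>2)"
        by (intro tendsto_intros)
      moreover have "(\<Sum>i\<in>F. (hnorm (V i) (X n i - X m i))\<^sup>2) \<le> \<epsilon>\<^sup>2" if "m \<ge> N" for m
      proof -
        have "(\<Sum>i\<in>F. (hnorm (V i) (X n i - X m i))\<^sup>2) \<le> (hnorm (direct_sum I V) (X n - X m))\<^sup>2"
          using direct_sum_le[OF direct_sum_diff_closed[OF X X] F, of n m] by simp
        also have "\<dots> \<le> \<epsilon>\<^sup>2"
          using N n that direct_sum_hnorm(2)[OF direct_sum_diff_closed[OF X X], of n m]
          by (intro power_mono) (auto intro: less_imp_le)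
        finally show ?thesis .
      qed
      ultimately show "(\<Sum>i\<in>F. (hnorm (V i) (X n i - x i))\<^sup>2) \<le> \<epsilon>\<^sup>2"
        by (intro LIMSEQ_le_const2) auto
    qed
  qed
  have mem: "X n - x \<in> hcarrier (direct_sum I V)"
    if "\<forall>F. finite F \<longrightarrow> F \<subseteq> I \<longrightarrow> (\<Sum>i\<in>F. (hnorm (V i) (X n i - x i))\<^sup>2) \<le> B" for n B
  proof -
    have "(\<lambda>i. (hnorm (V i) (X n i - x i))\<^sup>2) summable_on I"
      using that by (intro nonneg_bdd_above_summable_on) (auto simp: bdd_above_def)
    then show ?thesis
      using X[of n] x Xi hilbert_space.diff_closed[OF hilbert_space_summand]
      by (auto simp: direct_sum_simps x_def)
  qed
  obtain N where "\<forall>F. finite F \<longrightarrow> F \<subseteq> I \<longrightarrow> (\<Sum>i\<in>F. (hnorm (V i) (X N i - x i))\<^sup>2) \<le> 1\<^sup>2"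
    using key[OF zero_less_one] by (meson order_refl)
  then have "X N - (X N - x) \<in> hcarrier (direct_sum I V)"
    by (intro direct_sum_diff_closed X mem)
  then have xD: "x \<in> hcarrier (direct_sum I V)" by simp
  moreover have "(\<lambda>n. hnorm (direct_sum I V) (X n - x)) \<longlonglongrightarrow> 0"
  proof (rule LIMSEQ_I)
    fix r :: real assume r: "r > 0"
    obtain N where N: "\<forall>n\<ge>N. \<forall>F. finite F \<longrightarrow> F \<subseteq> I \<longrightarrow> (\<Sum>i\<in>F. (hnorm (V i) (X n i - x i))\<^sup>2) \<le> (r/2)\<^sup>2"
      using key[of "r/2"] r by auto
    have "norm (hnorm (direct_sum I V) (X n - x) - 0) < r" if "n \<ge> N" for n
    proof -
      have d: "X n - x \<in> hcarrier (direct_sum I V)" using X xD direct_sum_diff_closed by blast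
      have "(hnorm (direct_sum I V) (X n - x))\<^sup>2 \<le> (r/2)\<^sup>2"
        unfolding direct_sum_hnorm(1)[OF d]
      proof (rule infsum_le_finite_sums)
        show "(\<lambda>i. (hnorm (V i) ((X n - x) i))\<^sup>2) summable_on I"
          using d unfolding direct_sum_simps by blast
        show "(\<Sum>i\<in>F. (hnorm (V i) ((X n - x) i))\<^sup>2) \<le> (r/2)\<^sup>2" if "finite F" "F \<subseteq> I" for F
          using N \<open>n \<ge> N\<close> that by simp
      qed
      then have "hnorm (direct_sum I V) (X n - x) \<le> r/2"
        by (rule power2_le_imp_le) (use r in simp)
      then show ?thesis using r direct_sum_hnorm(2)[OF d] by simp
    qed
    then show "\<exists>N. \<forall>n\<ge>N. norm (hnorm (direct_sum I V) (X n - x) - 0) < r" by blast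
  qed
  ultimately show ?thesis by blast
qed

lemma hilbert_space_direct_sum: "hilbert_space (direct_sum I V)"
proof
  show "is_subspace (hcarrier (direct_sum I V))" by (rule direct_sum_subspace)
next
  fix x y z
  assume x: "x \<in> hcarrier (direct_sum I V)" and y: "y \<in> hcarrier (direct_sum I V)"
    and z: "z \<in> hcarrier (direct_sum I V)"
  have "hinner (direct_sum I V) (x + y) z
      = (\<Sum>\<^sub>\<infinity>i\<in>I. hinner (V i) (x i) (z i) + hinner (V i) (y i) (z i))"
    using x y z hilbert_space.inner_add_left[OF hilbert_space_summand]
    unfolding direct_sum_simps by (intro infsum_cong) auto
  then show "hinner (direct_sum I V) (x + y) z
      = hinner (direct_sum I V) x z + hinner (direct_sum I V) y z"
    using direct_sum_inner_summable x y z by (simp add: infsum_add direct_sum_simps)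
next
  fix x z c
  assume x: "x \<in> hcarrier (direct_sum I V)" and z: "z \<in> hcarrier (direct_sum I V)"
  have "hinner (direct_sum I V) (c *\<^sub>C x) z = (\<Sum>\<^sub>\<infinity>i\<in>I. c * hinner (V i) (x i) (z i))"
    using x z hilbert_space.inner_scaleC_left[OF hilbert_space_summand]
    unfolding direct_sum_simps by (intro infsum_cong) (auto simp: scaleC_fun_def)
  then show "hinner (direct_sum I V) (c *\<^sub>C x) z = c * hinner (direct_sum I V) x z"
    by (simp add: infsum_cmult_right' direct_sum_simps)
next
  fix x y
  assume x: "x \<in> hcarrier (direct_sum I V)" and y: "y \<in> hcarrier (direct_sum I V)"
  have "hinner (direct_sum I V) y x = (\<Sum>\<^sub>\<infinity>i\<in>I. cnj (hinner (V i) (x i) (y i)))"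
    using x y unfolding direct_sum_simps
    by (intro infsum_cong hilbert_space.inner_cnj[OF hilbert_space_summand]) auto
  then show "hinner (direct_sum I V) y x = cnj (hinner (direct_sum I V) x y)"
    by (simp add: direct_sum_simps)
next
  fix x assume x: "x \<in> hcarrier (direct_sum I V)" and "x \<noteq> 0"
  then obtain i where i: "x i \<noteq> 0" "i \<in> I" by (auto simp: direct_sum_simps fun_eq_iff)
  interpret hilbert_space "V i" using i by (intro hilbert_space_summand)
  have "x i \<in> hcarrier (V i)" using x i by (auto simp: direct_sum_simps)
  then have "hnorm (V i) (x i) \<noteq> 0" using i hnorm_eq_0_iff by auto
  then have "0 < (\<Sum>i\<in>{i}. (hnorm (V i) (x i))\<^sup>2)" by simp
  also have "\<dots> \<le> (hnorm (direct_sum I V) x)\<^sup>2" using x i by (intro direct_sum_le) auto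
  also have "\<dots> = Re (hinner (direct_sum I V) x x)"
    using direct_sum_hnorm(1)[OF x] direct_sum_inner_self[OF x] by simp
  finally show "0 < Re (hinner (direct_sum I V) x x)" .
next
  fix X :: "nat \<Rightarrow> 'i \<Rightarrow> 'v"
  assume "\<And>n. X n \<in> hcarrier (direct_sum I V)"
    and "\<And>\<epsilon>. \<epsilon> > 0 \<Longrightarrow> \<exists>N. \<forall>m\<ge>N. \<forall>n\<ge>N. hnorm (direct_sum I V) (X m - X n) < \<epsilon>"
  then show "\<exists>x\<in>hcarrier (direct_sum I V). (\<lambda>n. hnorm (direct_sum I V) (X n - x)) \<longlonglongrightarrow> 0"
    by (rule direct_sum_complete)
qed

end

lemma unitary_rep_direct_sum_iff:
  fixes I :: "'i set"
    and V :: "'i \<Rightarrow> ('a::idempotented_star_algebra, 'v::complex_vector) representation"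
  assumes V: "\<And>i. i \<in> I \<Longrightarrow> unitary_rep (V i)"
  shows "unitary_rep (direct_sum I V) \<longleftrightarrow>
    (\<forall>a. \<exists>C. \<forall>i\<in>I. \<forall>v\<in>hcarrier (V i). hnorm (V i) (action (V i) a v) \<le> C * hnorm (V i) v)"
proof
  assume "unitary_rep (direct_sum I V)"
  then interpret D: unitary_rep "direct_sum I V" .
  show "\<forall>a. \<exists>C. \<forall>i\<in>I. \<forall>v\<in>hcarrier (V i). hnorm (V i) (action (V i) a v) \<le> C * hnorm (V i) v"
  proof
    fix a
    obtain C where C: "\<forall>v\<in>hcarrier (direct_sum I V).
        hnorm (direct_sum I V) (action (direct_sum I V) a v) \<le> C * hnorm (direct_sum I V) v"
      using D.action_bounded by blast
    show "\<exists>C. \<forall>i\<in>I. \<forall>v\<in>hcarrier (V i). hnorm (V i) (action (V i) a v) \<le> C * hnorm (V i) v"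
    proof (intro exI[of _ C] ballI)
      fix i v assume i: "i \<in> I" and v: "v \<in> hcarrier (V i)"
      define emb where "emb w = (\<lambda>j. if j = i then w else (0::'v))" for w
      have emb: "emb w \<in> hcarrier (direct_sum I V) \<and> hnorm (direct_sum I V) (emb w) = hnorm (V i) w"
        if w: "w \<in> hcarrier (V i)" for w
      proof -
        have z: "hnorm (V j) 0 = 0" "0 \<in> hcarrier (V j)" if "j \<in> I" for j
          using hilbert_space.zero_closed hilbert_space.hnorm_zero
            hilbert_space_summand[of I V, OF V that] by auto
        have "((\<lambda>j. (hnorm (V j) (emb w j))\<^sup>2) has_sum (\<Sum>j\<in>{i}. (hnorm (V j) (emb w j))\<^sup>2)) I"
          using i z by (intro has_sum_finite_neutralI[where B = "{i}"]) (auto simp: emb_def)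
        then have hs: "((\<lambda>j. (hnorm (V j) (emb w j))\<^sup>2) has_sum (hnorm (V i) w)\<^sup>2) I"
          by (simp add: emb_def)
        then have m: "emb w \<in> hcarrier (direct_sum I V)"
          using w i z by (auto simp: direct_sum_simps emb_def summable_on_def)
        have "(hnorm (direct_sum I V) (emb w))\<^sup>2 = (hnorm (V i) w)\<^sup>2"
          using direct_sum_hnorm(1)[of I V, OF V m] hs by (simp add: infsumI)
        then show ?thesis
          using m direct_sum_hnorm(2)[of I V, OF V m]
            hilbert_space.hnorm_nonneg[OF hilbert_space_summand[of I V, OF V i] w] by simp
      qed
      have a0: "action (V j) a 0 = 0" if "j \<in> I" for j
      proof -
        interpret unitary_rep "V j" using V that .
        show ?thesis using action_add_right[of 0 0 a] zero_closed by simp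
      qed
      have "action (direct_sum I V) a (emb v) = emb (action (V i) a v)"
        using i a0 by (auto simp: direct_sum_simps emb_def fun_eq_iff)
      moreover have "action (V i) a v \<in> hcarrier (V i)"
        using unitary_rep.action_closed[OF V[OF i] v] .
      ultimately show "hnorm (V i) (action (V i) a v) \<le> C * hnorm (V i) v"
        using C emb v by metis
    qed
  qed
next
  assume bdd: "\<forall>a. \<exists>C. \<forall>i\<in>I. \<forall>v\<in>hcarrier (V i).
    hnorm (V i) (action (V i) a v) \<le> C * hnorm (V i) v"
  interpret D: hilbert_space "direct_sum I V" using V by (rule hilbert_space_direct_sum)
  have bdd': "\<exists>C\<ge>0. \<forall>i\<in>I. \<forall>v\<in>hcarrier (V i).
    (hnorm (V i) (action (V i) a v))\<^sup>2 \<le> C\<^sup>2 * (hnorm (V i) v)\<^sup>2" for a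
  proof -
    obtain C where C: "\<forall>i\<in>I. \<forall>v\<in>hcarrier (V i). hnorm (V i) (action (V i) a v) \<le> C * hnorm (V i) v"
      using bdd by blast
    show ?thesis
    proof (intro exI[of _ "max C 0"] conjI ballI)
      fix i v assume i: "i \<in> I" and v: "v \<in> hcarrier (V i)"
      interpret unitary_rep "V i" using V i .
      have "hnorm (V i) (action (V i) a v) \<le> C * hnorm (V i) v" using C i v by blast
      also have "\<dots> \<le> max C 0 * hnorm (V i) v" using v hnorm_nonneg by (intro mult_right_mono) auto
      finally have "(hnorm (V i) (action (V i) a v))\<^sup>2 \<le> (max C 0 * hnorm (V i) v)\<^sup>2"
        using v hnorm_nonneg action_closed by (intro power_mono) auto
      then show "(hnorm (V i) (action (V i) a v))\<^sup>2 \<le> (max C 0)\<^sup>2 * (hnorm (V i) v)\<^sup>2"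
        by (simp add: power_mult_distrib)
    qed simp
  qed
  note U = unitary_rep.action_closed[OF V] unitary_rep.action_add_right[OF V]
    unitary_rep.action_scaleC_right[OF V] unitary_rep.action_add_left[OF V]
    unitary_rep.action_scaleC_left[OF V] unitary_rep.action_mult[OF V]
  have z: "c *\<^sub>C (0 :: 'v) = 0" for c using scaleC_add_right[of c "0::'v" 0] by simp
  have cl: "action (direct_sum I V) a v \<in> hcarrier (direct_sum I V)"
    if v: "v \<in> hcarrier (direct_sum I V)" for a v
  proof -
    obtain C where C: "\<forall>i\<in>I. \<forall>v\<in>hcarrier (V i).
        (hnorm (V i) (action (V i) a v))\<^sup>2 \<le> C\<^sup>2 * (hnorm (V i) v)\<^sup>2"
      using bdd' by blast
    have "(\<lambda>i. (hnorm (V i) (action (V i) a (v i)))\<^sup>2) summable_on I"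
      using v C
      by (intro summable_on_comparison_test[where g = "\<lambda>i. (hnorm (V i) (action (V i) a (v i)))\<^sup>2"
            and f = "\<lambda>i. C\<^sup>2 * (hnorm (V i) (v i))\<^sup>2"] summable_on_cmult_right)
        (auto simp: direct_sum_simps)
    then show ?thesis using v U(1) by (auto simp: direct_sum_simps cong: summable_on_cong)
  qed
  show "unitary_rep (direct_sum I V)"
  proof
    fix a v assume "v \<in> hcarrier (direct_sum I V)"
    then show "action (direct_sum I V) a v \<in> hcarrier (direct_sum I V)" by (rule cl)
  next
    fix a v w assume "v \<in> hcarrier (direct_sum I V)" "w \<in> hcarrier (direct_sum I V)"
    then show "action (direct_sum I V) a (v + w)
        = action (direct_sum I V) a v + action (direct_sum I V) a w"
      using U by (auto simp: direct_sum_simps fun_eq_iff)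
  next
    fix a v c assume "v \<in> hcarrier (direct_sum I V)"
    then show "action (direct_sum I V) a (c *\<^sub>C v) = c *\<^sub>C action (direct_sum I V) a v"
      using U z by (auto simp: direct_sum_simps fun_eq_iff scaleC_fun_def)
  next
    fix a b v assume "v \<in> hcarrier (direct_sum I V)"
    then show "action (direct_sum I V) (a + b) v
        = action (direct_sum I V) a v + action (direct_sum I V) b v"
      using U by (auto simp: direct_sum_simps fun_eq_iff)
  next
    fix a v c assume "v \<in> hcarrier (direct_sum I V)"
    then show "action (direct_sum I V) (c *\<^sub>C a) v = c *\<^sub>C action (direct_sum I V) a v"
      using U z by (auto simp: direct_sum_simps fun_eq_iff scaleC_fun_def)
  next
    fix a b v assume "v \<in> hcarrier (direct_sum I V)"
    then show "action (direct_sum I V) (a * b) v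
        = action (direct_sum I V) a (action (direct_sum I V) b v)"
      using U by (auto simp: direct_sum_simps fun_eq_iff)
  next
    fix a
    obtain C where C: "C \<ge> 0" "\<forall>i\<in>I. \<forall>v\<in>hcarrier (V i).
        (hnorm (V i) (action (V i) a v))\<^sup>2 \<le> C\<^sup>2 * (hnorm (V i) v)\<^sup>2"
      using bdd' by blast
    show "\<exists>C. \<forall>v\<in>hcarrier (direct_sum I V).
      hnorm (direct_sum I V) (action (direct_sum I V) a v) \<le> C * hnorm (direct_sum I V) v"
    proof (intro exI[of _ C] ballI)
      fix v assume v: "v \<in> hcarrier (direct_sum I V)"
      have "(hnorm (direct_sum I V) (action (direct_sum I V) a v))\<^sup>2
          \<le> (\<Sum>\<^sub>\<infinity>i\<in>I. C\<^sup>2 * (hnorm (V i) (v i))\<^sup>2)"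
        unfolding direct_sum_hnorm(1)[of I V, OF V cl[OF v, of a], simplified]
      proof (rule infsum_mono)
        show "(\<lambda>i. (hnorm (V i) (action (direct_sum I V) a v i))\<^sup>2) summable_on I"
          using cl[OF v, of a] unfolding direct_sum_simps(1) by blast
        show "(\<lambda>i. C\<^sup>2 * (hnorm (V i) (v i))\<^sup>2) summable_on I"
          using v by (intro summable_on_cmult_right) (auto simp: direct_sum_simps)
        show "(hnorm (V i) (action (direct_sum I V) a v i))\<^sup>2 \<le> C\<^sup>2 * (hnorm (V i) (v i))\<^sup>2"
          if "i \<in> I" for i
          using C v that by (auto simp: direct_sum_simps)
      qed
      also have "\<dots> = (C * hnorm (direct_sum I V) v)\<^sup>2"
        using direct_sum_hnorm(1)[of I V, OF V v]
        by (simp add: infsum_cmult_right' power_mult_distrib)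
      finally show "hnorm (direct_sum I V) (action (direct_sum I V) a v) \<le> C * hnorm (direct_sum I V) v"
        by (rule power2_le_imp_le) (use C direct_sum_hnorm(2)[of I V, OF V v] in simp)
    qed
  next
    fix a v w assume "v \<in> hcarrier (direct_sum I V)" "w \<in> hcarrier (direct_sum I V)"
    then show "hinner (direct_sum I V) (action (direct_sum I V) a v) w
        = hinner (direct_sum I V) v (action (direct_sum I V) (star a) w)"
      using unitary_rep.action_star[OF V] by (auto simp: direct_sum_simps intro!: infsum_cong)
  next
    fix v and \<epsilon> :: real assume v: "v \<in> hcarrier (direct_sum I V)" and \<epsilon>: "\<epsilon> > 0"
    define n where "n i = (hnorm (V i) (v i))\<^sup>2" for i
    have n: "n summable_on I" using v by (auto simp: direct_sum_simps n_def[abs_def])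
    have vi: "v i \<in> hcarrier (V i)" if "i \<in> I" for i using v that by (auto simp: direct_sum_simps)
    have \<epsilon>2: "\<epsilon>\<^sup>2 / 4 > 0" using \<epsilon> by simp
    obtain F where F: "finite F" "F \<subseteq> I" "dist (sum n F) (infsum n I) \<le> \<epsilon>\<^sup>2 / 4"
      using infsum_finite_approximation[OF n \<epsilon>2] by blast
    define \<delta> where "\<delta> = \<epsilon> / sqrt (2 * (card F + 1))"
    have \<delta>: "\<delta> > 0" using \<epsilon> by (simp add: \<delta>_def)
    have "\<exists>a w. w \<in> hcarrier (V i) \<and> hnorm (V i) (v i - action (V i) a w) < \<delta>" if "i \<in> F" for i
      using unitary_rep.action_dense[OF V vi \<delta>] that F by blast
    then obtain a w where aw: "\<And>i. i \<in> F \<Longrightarrow> w i \<in> hcarrier (V i)"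
      "\<And>i. i \<in> F \<Longrightarrow> hnorm (V i) (v i - action (V i) (a i) (w i)) < \<delta>"
      by metis
    obtain e where e: "e * e = e" "\<And>i. i \<in> F \<Longrightarrow> e * a i * e = a i"
      using idempotented[of "a ` F"] F by auto
    have ea: "e * a i = a i" if "i \<in> F" for i
      using e(1) e(2)[OF that] by (metis mult.assoc)
    define u where "u i = (if i \<in> F then action (V i) (a i) (w i) else 0)" for i
    have z': "hnorm (V j) 0 = 0" "0 \<in> hcarrier (V j)" if "j \<in> I" for j
      using hilbert_space.zero_closed hilbert_space.hnorm_zero
        hilbert_space_summand[of I V, OF V that] by auto
    have u: "u \<in> hcarrier (direct_sum I V)"
    proof -
      have "(\<lambda>i. (hnorm (V i) (u i))\<^sup>2) summable_on I"
        using F z' unfolding summable_on_def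
        by (intro exI has_sum_finite_neutralI[where B = F]) (auto simp: u_def)
      then show ?thesis using aw U(1) F z' by (auto simp: direct_sum_simps u_def)
    qed
    have "action (direct_sum I V) e u = u"
    proof
      fix i
      show "action (direct_sum I V) e u i = u i"
      proof (cases "i \<in> F")
        case True
        then have "i \<in> I" using F by auto
        then show ?thesis using True ea U(6)[of i "w i" e "a i"] aw by (simp add: direct_sum_simps u_def)
      next
        case False
        have "action (V i) e 0 = 0" if "i \<in> I"
          using U(2)[OF that z'(2)[OF that] z'(2)[OF that], of e] by simp
        then show ?thesis using False by (simp add: direct_sum_simps u_def)
      qed
    qed
    moreover have "hnorm (direct_sum I V) (v - u) < \<epsilon>"
    proof -
      have d: "v - u \<in> hcarrier (direct_sum I V)" using v u D.diff_closed by blast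
      have IF: "I = F \<union> (I - F)" using F by auto
      define m where "m i = (hnorm (V i) (v i - u i))\<^sup>2" for i
      have m: "m summable_on I" using d by (auto simp: direct_sum_simps m_def[abs_def])
      have "infsum m I = sum m F + infsum m (I - F)"
        using F m by (subst IF, subst infsum_Un_disjoint)
          (auto intro: summable_on_subset_banach)
      also have "infsum m (I - F) = infsum n (I - F)"
        by (intro infsum_cong) (simp add: m_def n_def u_def)
      also have "infsum n (I - F) = infsum n I - sum n F"
        using infsum_Un_disjoint[of n F "I - F"] IF F n summable_on_subset_banach[OF n, of "I - F"]
        by auto
      also have "\<dots> < \<epsilon>\<^sup>2 / 2" using F(3) \<epsilon>2 unfolding dist_real_def by linarith
      also have "sum m F \<le> (\<Sum>i\<in>F. \<delta>\<^sup>2)"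
      proof (rule sum_mono)
        fix i assume i: "i \<in> F"
        then have "i \<in> I" using F by auto
        interpret unitary_rep "V i" using V \<open>i \<in> I\<close> .
        show "m i \<le> \<delta>\<^sup>2"
          using aw(2)[OF i] aw(1)[OF i] vi[OF \<open>i \<in> I\<close>] i unfolding m_def u_def
          by (intro power_mono) (auto intro!: hnorm_nonneg diff_closed action_closed)
      qed
      also have "(\<Sum>i\<in>F. \<delta>\<^sup>2) \<le> \<epsilon>\<^sup>2 / 2"
        using \<epsilon> by (simp add: \<delta>_def power_divide field_simps)
      finally have "infsum m I < \<epsilon>\<^sup>2" by simp
      then have "(hnorm (direct_sum I V) (v - u))\<^sup>2 < \<epsilon>\<^sup>2"
        using direct_sum_hnorm(1)[of I V, OF V d] by (simp add: m_def[abs_def])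
      then show ?thesis by (rule power2_less_imp_less) (use \<epsilon> in simp)
    qed
    ultimately show "\<exists>a. \<exists>w\<in>hcarrier (direct_sum I V).
        hnorm (direct_sum I V) (v - action (direct_sum I V) a w) < \<epsilon>"
      using u by metis
  qed
qed

end

theory Submission
  imports Defs
begin

text \<open>
  Let \<open>C V\<close> be the cone of all \<open>b\<close> such that \<open>Re \<langle>by, y\<rangle> \<ge> 0\<close> for all \<open>y \<in> V\<close>. For irreducible \<open>V\<close>, weak
  containment \<open>V \<prec> V'\<close> is equivalent to \<open>C V' \<subseteq> C V\<close>, and the cone of a direct sum is the intersection of
  the cones of the summands. The functionals which are nonnegative on \<open>C V'\<close> and satisfy
  \<open>|\<psi> a|\<^sup>2 \<le> \<psi> (a\<^sup>* a)\<close> form a compact convex set \<open>Q V'\<close> for the topology of pointwise convergence.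
  If \<open>C V' \<subseteq> C V\<close> and \<open>v \<in> V\<close> is a unit vector, then \<open>\<phi> = \<langle>_ v, v\<rangle>\<close> is an extreme point of \<open>Q V'\<close>, hence has
  arbitrarily small neighbourhoods of the form \<open>Re \<psi> b > \<alpha>\<close> in \<open>Q V'\<close>. As idempotents \<open>e\<close> with \<open>\<phi> e\<close> close
  to 1 and \<open>ebe = b\<close> exist, \<open>\<alpha>e - b \<notin> C V\<close> for some \<open>e\<close>, so such a neighbourhood contains \<open>\<langle>_ y, y\<rangle>\<close> for
  some unit vector \<open>y \<in> V'\<close>. If \<open>V'\<close> is the direct sum of the \<open>V\<^sub>i\<close>, then \<open>y\<close> may even be taken in some
  \<open>V\<^sub>i\<close>; an extreme point of \<open>Q V\<^sub>i\<close> that maximizes \<open>Re \<psi> b\<close> lies in the same neighbourhood, and its GNS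
  representation is irreducible and weakly contained in \<open>V\<^sub>i\<close>. This shows that the class of \<open>V\<close> lies in
  the closure. The converse holds because \<open>C V' \<subseteq> C V\<close> is a closed condition on the class of \<open>V\<close>.
\<close>

section \<open>Convexity in the space of complex functions\<close>

text \<open>Weak containment asks for a single vector functional of \<open>V'\<close> near the given
  one, whereas a separation argument against a cone by itself only yields limits of convex
  combinations of such functionals. Extremality closes this gap: at an extreme point of a compact
  convex set the slices form a basis of neighbourhoods, and a slice that meets the convex hull of a
  set meets the set itself. This also makes direct sums tractable: a vector of the sum has
  components in many summands at once, but an element outside the cone of the sum is already outside
  the cone of one summand. Neither a norm nor a unit is available on the algebra. Compactness
  therefore comes from memberships in the cone, which carry the operator bounds of \<open>V'\<close>
  over to every functional that is nonnegative on it, and the constant 1 is replaced by idempotents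
  \<open>e\<close> with \<open>e * b * e = b\<close>. Quasi-states may lose mass, even all of it, in
  a limit; a fixed idempotent at which \<phi> exceeds 1/2 keeps the functionals of a small
  neighbourhood away from 0.\<close>

definition mix :: "real \<Rightarrow> ('a \<Rightarrow> complex) \<Rightarrow> ('a \<Rightarrow> complex) \<Rightarrow> 'a \<Rightarrow> complex" where
  "mix t x y = (\<lambda>a. of_real t * x a + of_real (1 - t) * y a)"

definition mix_convex :: "('a \<Rightarrow> complex) set \<Rightarrow> bool" where
  "mix_convex K \<longleftrightarrow> (\<forall>x\<in>K. \<forall>y\<in>K. \<forall>t\<in>{0..1}. mix t x y \<in> K)"

definition mix_face :: "('a \<Rightarrow> complex) set \<Rightarrow> ('a \<Rightarrow> complex) set \<Rightarrow> bool" where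
  "mix_face F K \<longleftrightarrow> F \<subseteq> K \<and>
     (\<forall>x\<in>K. \<forall>y\<in>K. \<forall>t\<in>{0<..<1}. mix t x y \<in> F \<longrightarrow> x \<in> F \<and> y \<in> F)"

abbreviation mix_extreme :: "('a \<Rightarrow> complex) \<Rightarrow> ('a \<Rightarrow> complex) set \<Rightarrow> bool" where
  "mix_extreme x K \<equiv> mix_face {x} K"

text \<open>With \<open>T\<close> finite, these are all the continuous real-linear functionals for
  pointwise convergence. On a complex-linear \<open>x\<close> the value is \<open>Re (x b)\<close>
  for one element \<open>b\<close>, the sum of all \<open>c a *\<^sub>C a\<close>, so slices become
  conditions at a single element of the algebra.\<close>

definition coord_functional :: "'a set \<Rightarrow> ('a \<Rightarrow> complex) \<Rightarrow> ('a \<Rightarrow> complex) \<Rightarrow> real" where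
  "coord_functional T c x = Re (\<Sum>a\<in>T. c a * x a)"

lemma mix_0: "mix 0 x y = y" and mix_1: "mix 1 x y = x"
  by (simp_all add: mix_def)

lemma coord_functional_mix:
  "coord_functional T c (mix t x y) = t * coord_functional T c x + (1 - t) * coord_functional T c y"
proof -
  have "(\<Sum>a\<in>T. c a * mix t x y a)
      = of_real t * (\<Sum>a\<in>T. c a * x a) + of_real (1 - t) * (\<Sum>a\<in>T. c a * y a)"
    by (simp add: mix_def sum_distrib_left sum.distrib[symmetric] algebra_simps
        del: of_real_diff)
  then show ?thesis unfolding coord_functional_def by (simp del: of_real_diff)
qed

lemma continuous_on_coord: "continuous_on S (\<lambda>x::'a \<Rightarrow> complex. x a)"
  using continuous_on_subset[OF continuous_on_product_coordinates subset_UNIV] .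

lemma continuous_on_coord_functional: "continuous_on S (coord_functional T c)"
  unfolding coord_functional_def[abs_def] by (intro continuous_intros continuous_on_coord)

text \<open>Joint continuity in the weight and both points is what makes the join of two compact
  sets compact.\<close>

lemma continuous_on_mix:
  "continuous_on S (\<lambda>(t, x, y). mix t x y)"
  unfolding mix_def case_prod_unfold
proof (rule continuous_on_coordinatewise_then_product)
  fix a
  have "continuous_on S (\<lambda>p. fst (snd p) a)" "continuous_on S (\<lambda>p. snd (snd p) a)"
    by (rule continuous_on_product_then_coordinatewise, intro continuous_intros)+
  then show "continuous_on S (\<lambda>p. of_real (fst p) * fst (snd p) a + of_real (1 - fst p) * snd (snd p) a)"
    by (intro continuous_on_add continuous_on_mult continuous_on_of_real continuous_on_diff
        continuous_on_fst continuous_on_id continuous_on_const)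
qed

section \<open>Faces, extreme points and the Krein-Milman theorem\<close>

lemma mix_faceD:
  "mix_face F K \<Longrightarrow> F \<subseteq> K"
  "mix_face F K \<Longrightarrow> x \<in> K \<Longrightarrow> y \<in> K \<Longrightarrow> 0 < t \<Longrightarrow> t < 1 \<Longrightarrow> mix t x y \<in> F \<Longrightarrow> x \<in> F \<and> y \<in> F"
  by (simp add: mix_face_def) (metis greaterThanLessThan_iff mix_face_def)

lemma mix_face_trans: "mix_face F G \<Longrightarrow> mix_face G K \<Longrightarrow> mix_face F K"
  unfolding mix_face_def by (meson subset_iff)

lemma mix_face_Inter:
  assumes "\<And>F. F \<in> \<F> \<Longrightarrow> mix_face F K" and "\<F> \<noteq> {}"
  shows "mix_face (\<Inter>\<F>) K"
  unfolding mix_face_def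
proof (intro conjI ballI impI InterI)
  show "\<Inter>\<F> \<subseteq> K" using assms mix_faceD(1) by blast
  fix x y t F assume "x \<in> K" "y \<in> K" "t \<in> {0<..<1::real}" "mix t x y \<in> \<Inter>\<F>" "F \<in> \<F>"
  then show "x \<in> F" "y \<in> F" using mix_faceD(2)[OF assms(1), of F x y t] by auto
qed

text \<open>A mean with weights strictly between 0 and 1 reaches an upper bound of its two terms
  only if both terms do.\<close>

lemma mix_face_argmax:
  assumes F: "\<And>x. x \<in> F \<Longrightarrow> coord_functional T c x \<le> M"
  shows "mix_face {x \<in> F. coord_functional T c x = M} F"
  unfolding mix_face_def
proof (intro conjI ballI impI)
  fix x y t assume x: "x \<in> F" and y: "y \<in> F" and t: "t \<in> {0<..<1::real}"
    and m: "mix t x y \<in> {x \<in> F. coord_functional T c x = M}"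
  have eq: "t * (M - coord_functional T c x) + (1 - t) * (M - coord_functional T c y) = 0"
    using m by (simp add: coord_functional_mix algebra_simps)
  have "t * (M - coord_functional T c x) \<ge> 0" "(1 - t) * (M - coord_functional T c y) \<ge> 0"
    using F[OF x] F[OF y] t by (auto intro!: mult_nonneg_nonneg)
  then have "t * (M - coord_functional T c x) = 0" "(1 - t) * (M - coord_functional T c y) = 0"
    using eq by linarith+
  then show "x \<in> {x \<in> F. coord_functional T c x = M}" "y \<in> {x \<in> F. coord_functional T c x = M}"
    using x y t by auto
qed auto

lemma closed_level_set:
  assumes "closed F" shows "closed {x \<in> F. coord_functional T c x = M}"
proof -
  have "closed (F \<inter> coord_functional T c -` {M})"
    using assms by (intro continuous_closed_preimage continuous_on_coord_functional) auto
  then show ?thesis by (simp add: vimage_def Int_def)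
qed

text \<open>Zorn's lemma gives a minimal nonempty closed face inside the set of maximizers. Every
  coordinate functional is constant on it, since otherwise its maximizers would form a smaller face;
  hence the minimal face is a single point.\<close>

lemma exists_mix_extreme_argmax:
  assumes K: "compact K" "closed K" "K \<noteq> {}"
  shows "\<exists>x. mix_extreme x K \<and> (\<forall>y\<in>K. coord_functional T c y \<le> coord_functional T c x)"
proof -
  obtain x0 where x0: "x0 \<in> K" "\<And>y. y \<in> K \<Longrightarrow> coord_functional T c y \<le> coord_functional T c x0"
    using continuous_attains_sup[OF K(1,3) continuous_on_coord_functional] by blast
  define F0 where "F0 = {x \<in> K. coord_functional T c x = coord_functional T c x0}"
  have F0: "mix_face F0 K" "closed F0" "x0 \<in> F0"
    using mix_face_argmax[of K] x0 closed_level_set[OF K(2)] by (auto simp: F0_def)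
  define \<F> where "\<F> = {F. mix_face F K \<and> closed F \<and> F \<noteq> {} \<and> F \<subseteq> F0}"
  have "\<exists>m\<in>\<F>. \<forall>a\<in>\<F>. m \<supseteq> a \<longrightarrow> a = m"
  proof (rule predicate_Zorn)
    show "partial_order_on \<F> (relation_of (\<supseteq>) \<F>)"
      by (rule partial_order_on_relation_ofI) auto
    fix C assume "C \<in> Chains (relation_of (\<supseteq>) \<F>)"
    then have C: "C \<subseteq> \<F>" "\<And>A B. A \<in> C \<Longrightarrow> B \<in> C \<Longrightarrow> A \<subseteq> B \<or> B \<subseteq> A"
      by (auto simp: Chains_def relation_of_def)
    show "\<exists>u\<in>\<F>. \<forall>a\<in>C. a \<supseteq> u"
    proof (cases "C = {}")
      case True
      then show ?thesis using F0 by (auto simp: \<F>_def)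
    next
      case False
      have "K \<inter> \<Inter>C \<noteq> {}"
      proof (rule compact_imp_fip[OF K(1)])
        show "closed T" if "T \<in> C" for T using that C by (auto simp: \<F>_def)
        fix C' assume C': "finite C'" "C' \<subseteq> C"
        show "K \<inter> \<Inter>C' \<noteq> {}"
        proof (cases "C' = {}")
          case True
          then show ?thesis using K by simp
        next
          case False
          \<comment> \<open>A finite nonempty subfamily of a chain is closed under binary
            intersections, so its intersection is one of its members and therefore nonempty.\<close>
          have "A \<inter> B \<in> C'" if "A \<in> C'" "B \<in> C'" for A B
          proof -
            have "A \<inter> B = A \<or> A \<inter> B = B" using C(2)[of A B] C' that by auto
            then show ?thesis using that by auto
          qed
          then have "\<Inter>C' \<in> C'" using finite_Inf_in[OF C'(1) False] by blast
          then have "\<Inter>C' \<in> \<F>" using C(1) C'(2) by blast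
          then have "mix_face (\<Inter>C') K" "\<Inter>C' \<noteq> {}" by (simp_all add: \<F>_def)
          then show ?thesis using mix_faceD(1) by blast
        qed
      qed
      moreover have "mix_face (\<Inter>C) K"
        using C(1) by (intro mix_face_Inter False) (auto simp: \<F>_def)
      moreover have "closed (\<Inter>C)" using C(1) by (intro closed_Inter) (auto simp: \<F>_def)
      moreover have "\<Inter>C \<subseteq> F0" using C(1) False unfolding \<F>_def by blast
      ultimately have "\<Inter>C \<in> \<F>" unfolding \<F>_def by blast
      then show ?thesis by blast
    qed
  qed
  then obtain F where "F \<in> \<F>" and min: "\<forall>G\<in>\<F>. F \<supseteq> G \<longrightarrow> G = F" by (elim bexE) (rule that)
  then have F: "mix_face F K" "closed F" "F \<noteq> {}" "F \<subseteq> F0" by (simp_all add: \<F>_def)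
  have minF: "G = F" if "mix_face G K" "closed G" "G \<noteq> {}" "G \<subseteq> F" for G
    using min that F(4) by (simp add: \<F>_def)
  have cF: "compact F" using K F mix_faceD(1) by (metis compact_Int_closed inf.absorb2)
  have const: "coord_functional S d x = coord_functional S d y" if "x \<in> F" "y \<in> F" for S d x y
  proof -
    obtain z where z: "z \<in> F" "\<And>y. y \<in> F \<Longrightarrow> coord_functional S d y \<le> coord_functional S d z"
      using continuous_attains_sup[OF cF F(3) continuous_on_coord_functional] by blast
    have *: "{x \<in> F. coord_functional S d x = coord_functional S d z} = F"
      by (rule minF[OF mix_face_trans[OF mix_face_argmax[OF z(2)] F(1)] closed_level_set[OF F(2)]])
        (use z in auto)
    have "w \<in> F \<Longrightarrow> coord_functional S d w = coord_functional S d z" for w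
      by (subst (asm) *[symmetric]) simp
    then show ?thesis using that by simp
  qed
  obtain x where x: "x \<in> F" using F by auto
  have "y = x" if "y \<in> F" for y
  proof
    fix a
    show "y a = x a"
      \<comment> \<open>The coefficient -\<i> extracts the imaginary part of a coordinate.\<close>
      using const[OF that x, of "{a}" "\<lambda>_. 1"] const[OF that x, of "{a}" "\<lambda>_. - \<i>"]
      by (simp add: coord_functional_def complex_eq_iff)
  qed
  then have "F = {x}" using x by blast
  then have "mix_extreme x K" "coord_functional T c x = coord_functional T c x0"
    using F(1,4) by (simp_all add: F0_def)
  then show ?thesis using x0(2) by (intro exI[of _ x]) simp
qed

text \<open>Compactness leaves finitely many coordinates such that every point of \<open>K\<close>
  differs from \<phi> in one of them. In these coordinates the nearest point \<open>z\<close> of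
  \<open>K\<close> yields the functional, as in Euclidean space: pairing with \<phi> - z.\<close>

lemma separating_coord_functional:
  assumes K: "compact K" "mix_convex K" and \<phi>: "\<phi> \<notin> K"
  shows "\<exists>T c \<alpha>. finite T \<and> (\<forall>x\<in>K. coord_functional T c x \<le> \<alpha>) \<and> \<alpha> < coord_functional T c \<phi>"
proof (cases "K = {}")
  case True
  \<comment> \<open>The empty set of coordinates gives the functional 0, which exceeds -1.\<close>
  then show ?thesis by (intro exI[of _ "{}"] exI[of _ "-1"]) (auto simp: coord_functional_def)
next
  case False
  have op: "open {x::'a \<Rightarrow> complex. x a \<noteq> \<phi> a}" for a
  proof -
    have "open ((\<lambda>x::'a \<Rightarrow> complex. x a) -` (- {\<phi> a}))"
      by (intro open_vimage continuous_on_coord) auto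
    then show ?thesis by (simp add: vimage_def)
  qed
  have cover: "K \<subseteq> (\<Union>a\<in>UNIV. {x. x a \<noteq> \<phi> a})"
  proof
    fix x assume "x \<in> K"
    then obtain a where "x a \<noteq> \<phi> a" using \<phi> by (metis ext)
    then show "x \<in> (\<Union>a\<in>UNIV. {x. x a \<noteq> \<phi> a})" by blast
  qed
  obtain T where T: "finite T" "K \<subseteq> (\<Union>a\<in>T. {x. x a \<noteq> \<phi> a})"
    by (rule compactE_image[OF K(1) op cover])
  define d where "d x = (\<Sum>a\<in>T. (cmod (x a - \<phi> a))\<^sup>2)" for x
  have "continuous_on K d" unfolding d_def[abs_def] by (intro continuous_intros continuous_on_coord)
  then obtain z where z: "z \<in> K" "\<And>x. x \<in> K \<Longrightarrow> d z \<le> d x"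
    using continuous_attains_inf[OF K(1) False] by blast
  have dz: "d z > 0"
  proof -
    obtain a where a: "a \<in> T" "z a \<noteq> \<phi> a" using T z by auto
    have "0 < (cmod (z a - \<phi> a))\<^sup>2" using a by simp
    also have "\<dots> \<le> d z" unfolding d_def using T a by (intro member_le_sum) auto
    finally show ?thesis .
  qed
  \<comment> \<open>With this conjugate, the functional is the real inner product with \<phi> - z
    over \<open>T\<close>.\<close>
  define c where "c a = cnj (\<phi> a - z a)" for a
  have le: "coord_functional T c x \<le> coord_functional T c z" if x: "x \<in> K" for x
  proof (rule ccontr)
    define p where "p = coord_functional T c x - coord_functional T c z"
    assume "\<not> ?thesis"
    then have p: "p > 0" by (simp add: p_def)
    define q where "q = (\<Sum>a\<in>T. (cmod (x a - z a))\<^sup>2)"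
    have q: "q \<ge> 0" unfolding q_def by (intro sum_nonneg) auto
    have exp: "d (mix t x z) = d z - 2 * t * p + t\<^sup>2 * q" for t
    proof -
      have "(cmod (mix t x z a - \<phi> a))\<^sup>2
          = (cmod (z a - \<phi> a))\<^sup>2 - 2 * t * (Re (c a * x a) - Re (c a * z a)) + t\<^sup>2 * (cmod (x a - z a))\<^sup>2"
        for a
        unfolding cmod_power2 by (simp add: mix_def c_def power2_eq_square algebra_simps)
      then show ?thesis
        unfolding d_def p_def q_def coord_functional_def Re_sum
        by (simp only: sum.distrib sum_subtractf sum_distrib_left right_diff_distrib)
    qed
    \<comment> \<open>Moving from \<open>z\<close> towards \<open>x\<close> by \<open>t\<close>
      changes the squared distance by - 2 t p + t^2 q, which is negative because t q \<le> p. The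
      summand 1 in the denominator covers q = 0.\<close>
    define t where "t = min 1 (p / (q + 1))"
    have t: "0 < t" "t \<le> 1" using p q by (auto simp: t_def)
    have "t * q \<le> p / (q + 1) * q" using q by (intro mult_right_mono) (auto simp: t_def)
    also have "\<dots> \<le> p" using p q by (simp add: field_simps)
    finally have "t * (t * q) \<le> t * p" using t by (intro mult_left_mono) auto
    moreover have "0 < t * p" using t p by simp
    ultimately have "d (mix t x z) < d z" unfolding exp power2_eq_square by (simp add: algebra_simps)
    moreover have "mix t x z \<in> K" using K(2) x z t by (auto simp: mix_convex_def)
    ultimately show False using z by force
  qed
  have "coord_functional T c \<phi> - coord_functional T c z = d z"
  proof -
    have "Re (c a * \<phi> a) - Re (c a * z a) = (cmod (z a - \<phi> a))\<^sup>2" for a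
      unfolding cmod_power2 by (simp add: c_def power2_eq_square algebra_simps)
    then show ?thesis by (simp add: coord_functional_def d_def sum_subtractf[symmetric])
  qed
  then show ?thesis using T le dz
    by (intro exI[of _ T] exI[of _ c] exI[of _ "coord_functional T c z"]) auto
qed

text \<open>A functional separating a point of \<open>K\<close> from \<open>C\<close> would attain
  its maximum over \<open>K\<close> at an extreme point outside \<open>C\<close>.\<close>

lemma subset_if_mix_extreme_subset:
  assumes K: "compact K" "closed K" and C: "compact C" "mix_convex C"
    and ext: "\<And>x. mix_extreme x K \<Longrightarrow> x \<in> C"
  shows "K \<subseteq> C"
proof
  fix x assume x: "x \<in> K"
  show "x \<in> C"
  proof (rule ccontr)
    assume "x \<notin> C"
    then obtain T c \<alpha> where *: "\<forall>y\<in>C. coord_functional T c y \<le> \<alpha>" "\<alpha> < coord_functional T c x"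
      using separating_coord_functional[OF C] by blast
    obtain y where "mix_extreme y K" "coord_functional T c x \<le> coord_functional T c y"
      using exists_mix_extreme_argmax[OF K, of T c] x by blast
    then show False using ext * by force
  qed
qed

text \<open>A mixture of two mixtures has four weights. Collecting them by the set, \<open>H\<close>
  or \<open>L\<close>, to which their points belong, and normalizing each pair by its sum, regroups
  it as one mixture of a point of \<open>H\<close> and a point of \<open>L\<close>.\<close>

lemma mix_convex_join:
  assumes H: "mix_convex H" and L: "mix_convex L"
  shows "mix_convex ((\<lambda>(t, x, y). mix t x y) ` ({0..1} \<times> H \<times> L))"
  unfolding mix_convex_def
proof (intro ballI)
  fix z z' s
  assume "z \<in> (\<lambda>(t, x, y). mix t x y) ` ({0..1} \<times> H \<times> L)"
    and "z' \<in> (\<lambda>(t, x, y). mix t x y) ` ({0..1} \<times> H \<times> L)" and s: "s \<in> {0..1::real}"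
  then obtain t x y t' x' y' where z: "z = mix t x y" "z' = mix t' x' y'"
    and t: "t \<in> {0..1}" "t' \<in> {0..1}" and x: "x \<in> H" "x' \<in> H" and y: "y \<in> L" "y' \<in> L"
    by (elim imageE) (auto split: prod.splits)
  define u where "u = s * t + (1 - s) * t'"
  have split: "\<exists>p\<in>{0..1}. (b + c) * p = b \<and> (b + c) * (1 - p) = c" if "0 \<le> b" "0 \<le> c" for b c :: real
  proof (cases "b + c = 0")
    case False
    then show ?thesis
      by (intro bexI[of _ "b / (b + c)"]) (use that in \<open>auto simp: right_diff_distrib divide_le_eq_1\<close>)
  qed (use that in auto)
  have nn: "0 \<le> s * t" "0 \<le> (1 - s) * t'" "0 \<le> s * (1 - t)" "0 \<le> (1 - s) * (1 - t')"
    using s t by auto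
  have u1: "1 - u = s * (1 - t) + (1 - s) * (1 - t')" by (simp add: u_def algebra_simps)
  have u: "u \<in> {0..1}" using nn u1 by (simp add: u_def)
  obtain p where p: "p \<in> {0..1}" "u * p = s * t" "u * (1 - p) = (1 - s) * t'"
    using split[OF nn(1,2)] unfolding u_def by blast
  obtain q where q: "q \<in> {0..1}" "(1 - u) * q = s * (1 - t)" "(1 - u) * (1 - q) = (1 - s) * (1 - t')"
    using split[OF nn(3,4)] unfolding u1 by blast
  have "mix s z z' a = mix u (mix p x x') (mix q y y') a" for a
  proof -
    have "mix u (mix p x x') (mix q y y') a = of_real (u * p) * x a + of_real (u * (1 - p)) * x' a
        + of_real ((1 - u) * q) * y a + of_real ((1 - u) * (1 - q)) * y' a"
      unfolding mix_def of_real_mult by (simp add: algebra_simps)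
    then show ?thesis unfolding p q z mix_def of_real_mult by (simp add: algebra_simps)
  qed
  then have "mix s z z' = mix u (mix p x x') (mix q y y')" by blast
  moreover have "mix p x x' \<in> H" "mix q y y' \<in> L"
    using H L p q x y unfolding mix_convex_def by blast+
  ultimately show "mix s z z' \<in> (\<lambda>(t, x, y). mix t x y) ` ({0..1} \<times> H \<times> L)"
    using u by (intro image_eqI[of _ _ "(u, mix p x x', mix q y y')"]) auto
qed

text \<open>The convex hull of the union of two nonempty compact convex sets is a continuous image
  of the compact set of triples (t, x, y), hence compact. An extreme point of \<open>K\<close> on a
  segment between the two sets would be one of its ends.\<close>

lemma mix_extreme_avoids_finite_hull:
  assumes ext: "mix_extreme \<phi> K" and K: "mix_convex K" and fin: "finite \<H>"
    and \<H>: "\<And>H. H \<in> \<H> \<Longrightarrow> compact H \<and> mix_convex H \<and> H \<subseteq> K \<and> \<phi> \<notin> H"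
  shows "\<exists>L. compact L \<and> mix_convex L \<and> L \<subseteq> K \<and> \<phi> \<notin> L \<and> \<Union>\<H> \<subseteq> L"
  using fin \<H>
proof (induction \<H>)
  case empty
  then show ?case by (intro exI[of _ "{}"]) (auto simp: mix_convex_def)
next
  case (insert H \<H>)
  have "\<exists>L. compact L \<and> mix_convex L \<and> L \<subseteq> K \<and> \<phi> \<notin> L \<and> \<Union>\<H> \<subseteq> L"
    by (rule insert.IH) (simp add: insert.prems)
  then obtain L where L: "compact L" "mix_convex L" "L \<subseteq> K" "\<phi> \<notin> L" "\<Union>\<H> \<subseteq> L"
    by (elim exE conjE) (rule that)
  have H: "compact H" "mix_convex H" "H \<subseteq> K" "\<phi> \<notin> H" using insert.prems[of H] by simp_all
  define J where "J = (\<lambda>(t, x, y). mix t x y) ` ({0..1} \<times> H \<times> L)"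
  show ?case
  \<comment> \<open>The join with an empty set is empty, so it would not contain the other
    set.\<close>
  proof (cases "H = {} \<or> L = {}")
    case True
    then consider "\<Union>(insert H \<H>) \<subseteq> L" | "\<Union>(insert H \<H>) \<subseteq> H" using L(5) by auto
    then show ?thesis
    proof cases
      case 1
      then show ?thesis using L(1-4) by (intro exI[of _ L]) simp
    next
      case 2
      then show ?thesis using H by (intro exI[of _ H]) simp
    qed
  next
    case False
    have "compact J" unfolding J_def
      using H L by (intro compact_continuous_image continuous_on_mix compact_Times) auto
    moreover have "mix_convex J" unfolding J_def by (rule mix_convex_join[OF H(2) L(2)])
    moreover have "J \<subseteq> K"
      using H(3) L(3) K unfolding J_def mix_convex_def by (auto dest!: subsetD)
    moreover have "\<phi> \<notin> J"
    proof
      assume "\<phi> \<in> J"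
      then obtain t x y where *: "t \<in> {0..1}" "x \<in> H" "y \<in> L" "mix t x y = \<phi>" by (auto simp: J_def)
      then have "t \<noteq> 0" "t \<noteq> 1" using H L by (auto simp: mix_0 mix_1)
      moreover have "x \<in> K" "y \<in> K" using * H(3) L(3) by blast+
      ultimately have "x = \<phi>" using mix_faceD(2)[OF ext, of x y t] * by simp
      then show False using * H(4) by simp
    qed
    moreover have "H \<subseteq> J"
    proof
      fix x assume "x \<in> H"
      moreover obtain y where "y \<in> L" using False by auto
      ultimately show "x \<in> J" unfolding J_def by (intro image_eqI[of _ _ "(1, x, y)"]) (auto simp: mix_1)
    qed
    moreover have "L \<subseteq> J"
    proof
      fix y assume "y \<in> L"
      moreover obtain x where "x \<in> H" using False by auto
      ultimately show "y \<in> J" unfolding J_def by (intro image_eqI[of _ _ "(0, x, y)"]) (auto simp: mix_0)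
    qed
    ultimately show ?thesis using L(5) by blast
  qed
qed

text \<open>Choquet's lemma. The complement of a basic neighbourhood is covered by finitely many closed
  half spaces, and an extreme point is not in the convex hull of their intersections with \<open>K\<close>.\<close>

lemma mix_extreme_slice:
  assumes K: "compact K" "mix_convex K" and ext: "mix_extreme \<phi> K" and T: "finite T" and \<epsilon>: "\<epsilon> > 0"
  shows "\<exists>S c \<alpha>. finite S \<and> \<alpha> < coord_functional S c \<phi> \<and>
    (\<forall>x\<in>K. \<alpha> < coord_functional S c x \<longrightarrow> (\<forall>a\<in>T. cmod (x a - \<phi> a) < \<epsilon>))"
proof -
  \<comment> \<open>As \<open>d\<close> runs through 1, -1, \<i>, -\<i>, the value
    \<open>Re (d * z)\<close> runs through \<plusminus>Re z and \<plusminus>Im z, and one of these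
    is at least \<epsilon>/2 when |z| \<ge> \<epsilon>.\<close>
  define H where "H = (\<lambda>(a, d). {x \<in> K. \<epsilon> / 2 \<le> Re (d * (x a - \<phi> a))})"
  define \<H> where "\<H> = H ` (T \<times> {1, -1, \<i>, -\<i>})"
  have "\<exists>L. compact L \<and> mix_convex L \<and> L \<subseteq> K \<and> \<phi> \<notin> L \<and> \<Union>\<H> \<subseteq> L"
  proof (rule mix_extreme_avoids_finite_hull[OF ext K(2)])
    show "finite \<H>" using T by (simp add: \<H>_def)
    fix G assume "G \<in> \<H>"
    then obtain a d where G: "G = {x \<in> K. \<epsilon> / 2 \<le> Re (d * (x a - \<phi> a))}"
      by (auto simp: \<H>_def H_def)
    have "closed ((\<lambda>x. Re (d * (x a - \<phi> a))) -` {\<epsilon>/2..})"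
      by (intro closed_vimage continuous_intros continuous_on_coord)
    moreover have "G = K \<inter> ((\<lambda>x. Re (d * (x a - \<phi> a))) -` {\<epsilon>/2..})" by (auto simp: G)
    ultimately have "compact G" using K by (simp add: compact_Int_closed)
    moreover have "mix_convex G"
      unfolding mix_convex_def
    proof (intro ballI)
      fix x y t assume x: "x \<in> G" and y: "y \<in> G" and t: "t \<in> {0..1::real}"
      have "mix t x y a - \<phi> a = of_real t * (x a - \<phi> a) + of_real (1 - t) * (y a - \<phi> a)"
        by (simp add: mix_def algebra_simps)
      then have "d * (mix t x y a - \<phi> a)
          = of_real t * (d * (x a - \<phi> a)) + of_real (1 - t) * (d * (y a - \<phi> a))"
        by (simp only:) (simp add: algebra_simps)
      then have re: "Re (d * (mix t x y a - \<phi> a))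
          = t * Re (d * (x a - \<phi> a)) + (1 - t) * Re (d * (y a - \<phi> a))"
        by (simp del: of_real_diff)
      have "\<epsilon> / 2 = t * (\<epsilon> / 2) + (1 - t) * (\<epsilon> / 2)" by (simp add: field_simps)
      also have "\<dots> \<le> Re (d * (mix t x y a - \<phi> a))"
        unfolding re using x y t by (intro add_mono mult_left_mono) (auto simp: G)
      finally have "\<epsilon> / 2 \<le> Re (d * (mix t x y a - \<phi> a))" .
      then show "mix t x y \<in> G" using x y t K(2) by (auto simp: G mix_convex_def)
    qed
    ultimately show "compact G \<and> mix_convex G \<and> G \<subseteq> K \<and> \<phi> \<notin> G" using \<epsilon> by (auto simp: G)
  qed
  then obtain L where L: "compact L" "mix_convex L" "L \<subseteq> K" "\<phi> \<notin> L" "\<Union>\<H> \<subseteq> L"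
    by (elim exE conjE) (rule that)
  obtain S c \<alpha> where S: "finite S" "\<forall>x\<in>L. coord_functional S c x \<le> \<alpha>" "\<alpha> < coord_functional S c \<phi>"
    using separating_coord_functional[OF L(1,2,4)] by blast
  have "cmod (x a - \<phi> a) < \<epsilon>" if x: "x \<in> K" "\<alpha> < coord_functional S c x" and a: "a \<in> T" for x a
  proof (rule ccontr)
    define z where "z = x a - \<phi> a"
    assume "\<not> cmod (x a - \<phi> a) < \<epsilon>"
    then have "\<epsilon> \<le> \<bar>Re z\<bar> + \<bar>Im z\<bar>" using cmod_le[of z] by (simp add: z_def)
    then have "\<exists>d\<in>{1, -1, \<i>, -\<i>}. \<epsilon> / 2 \<le> Re (d * z)" by auto
    then have "\<exists>d\<in>{1, -1, \<i>, -\<i>}. x \<in> H (a, d)" using x by (simp add: H_def z_def)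
    then have "x \<in> \<Union>\<H>" using a unfolding \<H>_def by blast
    then have "coord_functional S c x \<le> \<alpha>" using subsetD[OF L(5)] S(2) by blast
    then show False using x(2) by simp
  qed
  then show ?thesis
    by (intro exI[of _ S] exI[of _ c] exI[of _ \<alpha>] conjI S(1,3) ballI impI)
qed

text \<open>Tychonoff's theorem: \<open>K\<close> is a closed subset of a product of discs.\<close>

lemma compact_coordwise_bounded:
  fixes K :: "('a \<Rightarrow> complex) set"
  assumes "closed K" and "\<And>x a. x \<in> K \<Longrightarrow> cmod (x a) \<le> C a"
  shows "compact K"
proof -
  have "compactin (product_topology (\<lambda>_. euclidean) UNIV) (PiE UNIV (\<lambda>a. cball (0::complex) (C a)))"
    by (auto simp: compactin_PiE)
  then have "compact (PiE UNIV (\<lambda>a. cball (0::complex) (C a)))"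
    by (simp add: euclidean_product_topology)
  moreover have "K \<subseteq> PiE UNIV (\<lambda>a. cball (0::complex) (C a))" using assms by auto
  ultimately show ?thesis using assms(1) by (metis compact_Int_closed inf.absorb2)
qed

section \<open>Riesz representation\<close>

text \<open>A polynomial that vanishes at 0 and is nonnegative has no linear term. At the chosen
  \<open>t\<close> it equals - t^2 (q + 2).\<close>

lemma linear_term_zero_if_quadratic_nonneg:
  fixes r q :: real
  assumes "\<And>t. 0 \<le> 2 * t * r + t\<^sup>2 * q" and q: "q \<ge> 0"
  shows "r = 0"
proof (rule ccontr)
  assume r: "r \<noteq> 0"
  define t where "t = - r / (q + 1)"
  have tq: "t * (q + 1) = - r" using q by (simp add: t_def)
  have "t * r = - (t\<^sup>2 * (q + 1))" using tq by (simp add: power2_eq_square algebra_simps)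
  moreover have "t \<noteq> 0" using r q by (simp add: t_def)
  then have "t\<^sup>2 * (q + 2) > 0" using q by (intro mult_pos_pos) auto
  ultimately have "2 * t * r + t\<^sup>2 * q < 0" by (simp add: algebra_simps)
  then show False using assms(1)[of t] by simp
qed

context hilbert_space
begin

lemma hnorm_power2: "x \<in> hcarrier V \<Longrightarrow> (hnorm V x)\<^sup>2 = Re (hinner V x x)"
  by (simp add: hnorm_def inner_nonneg)

lemma Re_inner_commute: "x \<in> hcarrier V \<Longrightarrow> y \<in> hcarrier V \<Longrightarrow> Re (hinner V x y) = Re (hinner V y x)"
  using inner_cnj[of x y] by simp

lemma tendsto_inner_left:
  assumes "x \<in> hcarrier V" "z \<in> hcarrier V" "\<And>n::nat. X n \<in> hcarrier V"
    and "(\<lambda>n. hnorm V (X n - x)) \<longlonglongrightarrow> 0"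
  shows "(\<lambda>n. hinner V (X n) z) \<longlonglongrightarrow> hinner V x z"
proof (rule LIM_zero_cancel, rule Lim_null_comparison)
  show "\<forall>\<^sub>F n in sequentially. norm (hinner V (X n) z - hinner V x z) \<le> hnorm V (X n - x) * hnorm V z"
    using Cauchy_Schwarz[OF diff_closed[OF assms(3,1)] assms(2)] assms
    by (simp add: inner_diff_left)
  show "(\<lambda>n. hnorm V (X n - x) * hnorm V z) \<longlonglongrightarrow> 0"
    using tendsto_mult_left_zero[OF assms(4)] .
qed

lemma hnorm_power2_diff:
  assumes "x \<in> hcarrier V" "y \<in> hcarrier V"
  shows "(hnorm V (x - y))\<^sup>2 = (hnorm V x)\<^sup>2 + (hnorm V y)\<^sup>2 - 2 * Re (hinner V x y)"
  using assms Re_inner_commute[OF assms]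
  by (simp add: hnorm_power2 diff_closed inner_diff_left inner_diff_right)

lemma hnorm_power2_add_scaleC:
  assumes "x \<in> hcarrier V" "y \<in> hcarrier V"
  shows "(hnorm V (y + of_real t *\<^sub>C x))\<^sup>2
    = (hnorm V y)\<^sup>2 + 2 * t * Re (hinner V x y) + t\<^sup>2 * (hnorm V x)\<^sup>2"
  using assms Re_inner_commute[OF assms]
  by (simp add: hnorm_power2 add_closed scaleC_closed inner_add_left inner_add_right
      inner_scaleC_left inner_scaleC_right power2_eq_square[of t] algebra_simps)

text \<open>The subspace \<open>E\<close> need not be closed, so the representing vector is only
  found in its closure; the sequence \<open>X\<close> in the conclusion records this. For a closed
  \<open>E\<close> and \<open>f\<close> the pairing with a vector, \<eta> is the orthogonal
  projection of that vector.\<close>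

lemma Riesz_on_subspace:
  assumes E: "E \<subseteq> hcarrier V" "is_subspace E"
    and f_add: "\<And>x y. x \<in> E \<Longrightarrow> y \<in> E \<Longrightarrow> f (x + y) = f x + f y"
    and f_scaleC: "\<And>c x. x \<in> E \<Longrightarrow> f (c *\<^sub>C x) = c * f x"
    and f_bdd: "\<And>x. x \<in> E \<Longrightarrow> cmod (f x) \<le> C * hnorm V x"
  obtains \<eta> X where "\<eta> \<in> hcarrier V" "\<And>n::nat. X n \<in> E" "(\<lambda>n. hnorm V (X n - \<eta>)) \<longlonglongrightarrow> 0"
    "\<And>x. x \<in> E \<Longrightarrow> f x = hinner V x \<eta>"
proof -
  have E0: "0 \<in> E" and E_add: "\<And>x y. x \<in> E \<Longrightarrow> y \<in> E \<Longrightarrow> x + y \<in> E"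
    and E_scaleC: "\<And>c x. x \<in> E \<Longrightarrow> c *\<^sub>C x \<in> E"
    using E(2) by (auto simp: is_subspace_def)
  have EV: "x \<in> hcarrier V" if "x \<in> E" for x using that E(1) by auto
  \<comment> \<open>If \<open>f\<close> is pairing with \<eta>, then J x = |x - \<eta>|^2 -
    |\<eta>|^2, so a minimizing sequence of \<open>J\<close> should converge to \<eta>.\<close>
  define J where "J x = (hnorm V x)\<^sup>2 - 2 * Re (f x)" for x
  have J_lower: "- C\<^sup>2 \<le> J x" if "x \<in> E" for x
  proof -
    have "Re (f x) \<le> C * hnorm V x" using f_bdd[OF that] complex_Re_le_cmod order_trans by blast
    moreover have "2 * C * hnorm V x \<le> C\<^sup>2 + (hnorm V x)\<^sup>2" by (rule sum_squares_bound)
    ultimately show ?thesis by (simp add: J_def)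
  qed
  define m where "m = Inf (J ` E)"
  have bdd: "bdd_below (J ` E)" using J_lower by (auto simp: bdd_below_def)
  have m_le: "m \<le> J x" if "x \<in> E" for x unfolding m_def using bdd that by (intro cInf_lower) auto
  have "\<exists>x\<in>E. J x < m + 1 / real (Suc n)" for n
    using cInf_lessD[of "J ` E" "m + 1 / real (Suc n)"] E0 unfolding m_def by auto
  then obtain X where X: "\<And>n. X n \<in> E" "\<And>n. J (X n) < m + 1 / real (Suc n)" by metis
  have XV: "X n \<in> hcarrier V" for n using X EV by auto
  have parallelogram: "(hnorm V (x - y))\<^sup>2 \<le> 2 * (J x - m) + 2 * (J y - m)" if x: "x \<in> E" and y: "y \<in> E" for x y
  proof -
    \<comment> \<open>The midpoint also satisfies \<open>m \<le> J w\<close>; by the parallelogram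
      law this bounds the distance of \<open>x\<close> and \<open>y\<close> by the excess of
      \<open>J\<close> over its infimum.\<close>
    define w where "w = (1/2) *\<^sub>C (x + y)"
    have w: "w \<in> E" using x y by (simp add: w_def E_add E_scaleC)
    have "4 * J w = (hnorm V (x + y))\<^sup>2 - 4 * Re (f x + f y)"
      using x y E_add[OF x y]
      by (simp add: J_def w_def f_scaleC f_add hnorm_power2 EV E_scaleC inner_scaleC_left
          inner_scaleC_right scaleC_closed algebra_simps)
    moreover have "(hnorm V (x + y))\<^sup>2 + (hnorm V (x - y))\<^sup>2 = 2 * (hnorm V x)\<^sup>2 + 2 * (hnorm V y)\<^sup>2"
      using EV[OF x] EV[OF y]
      by (simp add: hnorm_power2 add_closed diff_closed inner_add_left inner_add_right
          inner_diff_left inner_diff_right)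
    ultimately show ?thesis using m_le[OF w] by (simp add: J_def)
  qed
  have "\<exists>N. \<forall>j\<ge>N. \<forall>k\<ge>N. hnorm V (X j - X k) < \<epsilon>" if \<epsilon>: "\<epsilon> > 0" for \<epsilon>
  proof -
    obtain N where N: "1 / real (Suc N) < \<epsilon>\<^sup>2 / 4"
      using \<epsilon> nat_approx_posE[of "\<epsilon>\<^sup>2 / 4"] by auto
    have small: "J (X j) - m < \<epsilon>\<^sup>2 / 4" if "j \<ge> N" for j
    proof -
      have "1 / real (Suc j) \<le> 1 / real (Suc N)" using that by (intro divide_left_mono) auto
      then show ?thesis using X(2)[of j] N by linarith
    qed
    have "hnorm V (X j - X k) < \<epsilon>" if "j \<ge> N" "k \<ge> N" for j k
    proof (rule power2_less_imp_less)
      show "(hnorm V (X j - X k))\<^sup>2 < \<epsilon>\<^sup>2"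
        using parallelogram[OF X(1)[of j] X(1)[of k]] small[OF that(1)] small[OF that(2)]
        by (simp add: field_simps)
    qed (use \<epsilon> in simp)
    then show ?thesis by blast
  qed
  then obtain \<eta> where \<eta>: "\<eta> \<in> hcarrier V" "(\<lambda>n. hnorm V (X n - \<eta>)) \<longlonglongrightarrow> 0"
    using complete[of X] XV by blast
  have limJ: "(\<lambda>n. J (X n)) \<longlonglongrightarrow> m"
  proof (rule tendsto_sandwich)
    show "\<forall>\<^sub>F n in sequentially. m \<le> J (X n)" using m_le X by simp
    show "\<forall>\<^sub>F n in sequentially. J (X n) \<le> m + 1 / real (Suc n)" using X(2) by (simp add: less_imp_le)
    show "(\<lambda>n. m + 1 / real (Suc n)) \<longlonglongrightarrow> m"
      using tendsto_add[OF tendsto_const LIMSEQ_Suc[OF lim_1_over_n], of m] by simp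
    show "(\<lambda>n. m) \<longlonglongrightarrow> m" by simp
  qed
  have Re_eq: "Re (f x) = Re (hinner V x \<eta>)" if x: "x \<in> E" for x
  proof -
    \<comment> \<open>Up to a factor 2, the derivative of \<open>J\<close> at \<eta> in the
      direction \<open>x\<close>. As \<eta> may lie outside \<open>E\<close>, the inequality for
      \<open>J\<close> is taken at \<open>X n\<close> and passed to the limit.\<close>
    define r where "r = Re (hinner V \<eta> x) - Re (f x)"
    have "0 \<le> 2 * t * r + t\<^sup>2 * (hnorm V x)\<^sup>2" for t
    proof -
      have eq: "J (X n + of_real t *\<^sub>C x)
          = J (X n) + 2 * t * (Re (hinner V (X n) x) - Re (f x)) + t\<^sup>2 * (hnorm V x)\<^sup>2" for n
        using x X(1)[of n] EV hnorm_power2_add_scaleC[of x "X n" t] Re_inner_commute[of x "X n"]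
        by (simp add: J_def f_add f_scaleC E_scaleC algebra_simps)
      have "(\<lambda>n. J (X n) + 2 * t * (Re (hinner V (X n) x) - Re (f x)) + t\<^sup>2 * (hnorm V x)\<^sup>2)
          \<longlonglongrightarrow> m + 2 * t * r + t\<^sup>2 * (hnorm V x)\<^sup>2"
        unfolding r_def
        by (intro tendsto_add tendsto_mult tendsto_diff tendsto_const tendsto_Re limJ
            tendsto_inner_left \<eta> XV EV x)
      moreover have "m \<le> J (X n) + 2 * t * (Re (hinner V (X n) x) - Re (f x)) + t\<^sup>2 * (hnorm V x)\<^sup>2" for n
        using m_le[OF E_add[OF X(1)[of n] E_scaleC[OF x]], of "of_real t"] eq by simp
      ultimately have "m \<le> m + 2 * t * r + t\<^sup>2 * (hnorm V x)\<^sup>2"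
        using LIMSEQ_le_const by blast
      then show ?thesis by simp
    qed
    then have "r = 0" by (rule linear_term_zero_if_quadratic_nonneg) simp
    then show ?thesis using Re_inner_commute[OF EV[OF x] \<eta>(1)] by (simp add: r_def)
  qed
  have "f x = hinner V x \<eta>" if x: "x \<in> E" for x
  proof (rule complex_eqI)
    show "Re (f x) = Re (hinner V x \<eta>)" using Re_eq x .
    have "Re (f (- \<i> *\<^sub>C x)) = Re (hinner V (- \<i> *\<^sub>C x) \<eta>)" using Re_eq E_scaleC x by blast
    then show "Im (f x) = Im (hinner V x \<eta>)"
      using x EV \<eta> by (simp add: f_scaleC inner_scaleC_left)
  qed
  then show ?thesis using that \<eta> X(1) by blast
qed

end

section \<open>Completion of a positive semidefinite form\<close>

locale semidefinite_form =
  fixes B :: "'b::complex_vector \<Rightarrow> 'b \<Rightarrow> complex"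
  assumes form_add_left: "B (x + y) z = B x z + B y z"
    and form_scaleC_left: "B (c *\<^sub>C x) z = c * B x z"
    and form_cnj: "B y x = cnj (B x y)"
    and form_nonneg: "0 \<le> Re (B x x)"
begin

definition seminorm :: "'b \<Rightarrow> real" where "seminorm x = sqrt (Re (B x x))"

lemma form_add_right: "B z (x + y) = B z x + B z y"
  using form_add_left[of x y z] form_cnj by (metis complex_cnj_add)

lemma form_scaleC_right: "B z (c *\<^sub>C x) = cnj c * B z x"
  using form_scaleC_left[of c x z] form_cnj by (metis complex_cnj_mult)

lemma form_diff_left: "B (x - y) z = B x z - B y z"
  using form_add_left[of "x - y" y z] by simp

lemma form_diff_right: "B z (x - y) = B z x - B z y"
  using form_add_right[of z "x - y" y] by simp

lemma form_zero_left: "B 0 z = 0"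
  using form_add_left[of 0 0 z] by simp

lemma form_self: "B x x = of_real ((seminorm x)\<^sup>2)"
  using form_cnj[of x x] form_nonneg[of x] by (auto simp: seminorm_def complex_eq_iff)

lemma seminorm_nonneg: "0 \<le> seminorm x"
  by (simp add: seminorm_def form_nonneg)

lemma seminorm_power2: "(seminorm x)\<^sup>2 = Re (B x x)"
  by (simp add: seminorm_def form_nonneg)

text \<open>Null vectors are allowed. Positivity at \<open>x\<close> plus a real multiple
  \<open>s * B x y\<close> of \<open>y\<close> gives a quadratic inequality valid for all
  \<open>s\<close>; a null vector \<open>y\<close> removes its quadratic term, which forces
  \<open>B x y = 0\<close>.\<close>

lemma form_Cauchy_Schwarz: "cmod (B x y) \<le> seminorm x * seminorm y"
proof -
  define b where "b = (cmod (B x y))\<^sup>2"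
  have expand: "0 \<le> (seminorm x)\<^sup>2 + 2 * s * b + s\<^sup>2 * b * (seminorm y)\<^sup>2" for s
  proof -
    define c where "c = of_real s * B x y"
    have "Re (B (x + c *\<^sub>C y) (x + c *\<^sub>C y))
        = Re (B x x) + 2 * Re (cnj c * B x y) + Re (c * cnj c * B y y)"
      using form_cnj[of x y]
      by (simp add: form_add_left form_add_right form_scaleC_left form_scaleC_right algebra_simps)
    also have "cnj c * B x y = of_real (s * b)"
      by (simp add: c_def b_def complex_norm_square mult.commute del: of_real_power)
    also have "c * cnj c * B y y = of_real (s\<^sup>2 * b * (seminorm y)\<^sup>2)"
      unfolding form_self complex_norm_square[symmetric]
      by (simp add: c_def b_def norm_mult power_mult_distrib)
    finally show ?thesis
      using form_nonneg[of "x + c *\<^sub>C y"]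
      by (simp add: seminorm_power2 del: of_real_mult of_real_power)
  qed
  have "b \<le> (seminorm x * seminorm y)\<^sup>2"
  proof (cases "seminorm y = 0")
    case True
    have "b = 0"
    proof (rule ccontr)
      assume "b \<noteq> 0"
      then show False
        \<comment> \<open>For this \<open>s\<close> the right-hand side of \<open>expand\<close> is
          -1.\<close>
        using expand[of "- ((seminorm x)\<^sup>2 + 1) / (2 * b)"] True by (simp add: field_simps)
    qed
    then show ?thesis by simp
  next
    case False
    then have "2 * (- 1 / (seminorm y)\<^sup>2) * b + (- 1 / (seminorm y)\<^sup>2)\<^sup>2 * b * (seminorm y)\<^sup>2
        = - b / (seminorm y)\<^sup>2"
      by (simp add: field_simps power2_eq_square)
    then have "b / (seminorm y)\<^sup>2 \<le> (seminorm x)\<^sup>2"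
      using expand[of "- 1 / (seminorm y)\<^sup>2"] by linarith
    then show ?thesis using False by (simp add: divide_le_eq power_mult_distrib)
  qed
  then show ?thesis
    unfolding b_def by (rule power2_le_imp_le) (simp add: seminorm_nonneg)
qed

lemma seminorm_triangle: "seminorm (x + y) \<le> seminorm x + seminorm y"
proof (rule power2_le_imp_le)
  have "(seminorm (x + y))\<^sup>2 = (seminorm x)\<^sup>2 + (seminorm y)\<^sup>2 + 2 * Re (B x y)"
    using form_cnj[of x y] by (simp add: seminorm_power2 form_add_left form_add_right)
  then show "(seminorm (x + y))\<^sup>2 \<le> (seminorm x + seminorm y)\<^sup>2"
    using form_Cauchy_Schwarz[of x y] complex_Re_le_cmod[of "B x y"] by (simp add: power2_sum)
qed (simp add: seminorm_nonneg)

lemma seminorm_scaleC: "seminorm (c *\<^sub>C x) = cmod c * seminorm x"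
proof -
  have "B (c *\<^sub>C x) (c *\<^sub>C x) = (c * cnj c) * B x x"
    by (simp add: form_scaleC_left form_scaleC_right)
  also have "\<dots> = of_real ((cmod c)\<^sup>2) * B x x"
    by (simp only: complex_norm_square)
  finally have "(seminorm (c *\<^sub>C x))\<^sup>2 = (cmod c * seminorm x)\<^sup>2"
    by (simp add: seminorm_power2 power_mult_distrib del: of_real_power)
  then show ?thesis using seminorm_nonneg by (simp add: power2_eq_iff_nonneg)
qed

lemma seminorm_minus_commute: "seminorm (x - y) = seminorm (y - x)"
  by (simp add: seminorm_def form_diff_left form_diff_right)

lemma seminorm_zero: "seminorm 0 = 0"
  by (simp add: seminorm_def form_zero_left)

section \<open>Cauchy sequences and the space of their limits\<close>

definition seminorm_Cauchy :: "(nat \<Rightarrow> 'b) \<Rightarrow> bool" where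
  "seminorm_Cauchy s \<longleftrightarrow> (\<forall>\<epsilon>>0. \<exists>N. \<forall>m\<ge>N. \<forall>n\<ge>N. seminorm (s m - s n) < \<epsilon>)"

lemma seminorm_Cauchy_add:
  assumes "seminorm_Cauchy s" "seminorm_Cauchy t"
  shows "seminorm_Cauchy (\<lambda>n. s n + t n)"
  unfolding seminorm_Cauchy_def
proof (intro allI impI)
  fix \<epsilon> :: real assume "\<epsilon> > 0"
  then obtain N M where N: "\<forall>m\<ge>N. \<forall>n\<ge>N. seminorm (s m - s n) < \<epsilon> / 2"
    "\<forall>m\<ge>M. \<forall>n\<ge>M. seminorm (t m - t n) < \<epsilon> / 2"
    using assms unfolding seminorm_Cauchy_def by (meson half_gt_zero)
  have "seminorm (s m + t m - (s n + t n)) < \<epsilon>" if "m \<ge> max N M" "n \<ge> max N M" for m n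
  proof -
    have eq: "s m + t m - (s n + t n) = (s m - s n) + (t m - t n)" by simp
    have "seminorm (s m - s n) < \<epsilon> / 2" "seminorm (t m - t n) < \<epsilon> / 2" using N that by auto
    then show ?thesis unfolding eq using seminorm_triangle[of "s m - s n" "t m - t n"] by linarith
  qed
  then show "\<exists>N. \<forall>m\<ge>N. \<forall>n\<ge>N. seminorm (s m + t m - (s n + t n)) < \<epsilon>" by blast
qed

lemma seminorm_Cauchy_map:
  assumes "seminorm_Cauchy s"
    and g: "\<And>m n. seminorm (g (s m) - g (s n)) \<le> C * seminorm (s m - s n)"
  shows "seminorm_Cauchy (\<lambda>n. g (s n))"
  unfolding seminorm_Cauchy_def
proof (intro allI impI)
  fix \<epsilon> :: real assume "\<epsilon> > 0"
  \<comment> \<open>Nothing is known about the sign of \<open>C\<close>, so |C| + 1 serves as a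
    positive constant.\<close>
  then have "\<epsilon> / (\<bar>C\<bar> + 1) > 0" by simp
  then obtain N where N: "\<forall>m\<ge>N. \<forall>n\<ge>N. seminorm (s m - s n) < \<epsilon> / (\<bar>C\<bar> + 1)"
    using assms unfolding seminorm_Cauchy_def by meson
  have "seminorm (g (s m) - g (s n)) < \<epsilon>" if "m \<ge> N" "n \<ge> N" for m n
  proof -
    have "C * seminorm (s m - s n) \<le> (\<bar>C\<bar> + 1) * seminorm (s m - s n)"
      using seminorm_nonneg by (intro mult_right_mono) auto
    also have "\<dots> < \<epsilon>" using N that by (simp add: field_simps)
    finally show ?thesis using g[of m n] by simp
  qed
  then show "\<exists>N. \<forall>m\<ge>N. \<forall>n\<ge>N. seminorm (g (s m) - g (s n)) < \<epsilon>" by blast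
qed

lemma seminorm_Cauchy_scaleC:
  assumes "seminorm_Cauchy s" shows "seminorm_Cauchy (\<lambda>n. c *\<^sub>C s n)"
proof (rule seminorm_Cauchy_map[OF assms])
  fix m n
  have "c *\<^sub>C s m - c *\<^sub>C s n = c *\<^sub>C (s m - s n)"
    using scaleC_add_right[of c "s m - s n" "s n"] by simp
  then show "seminorm (c *\<^sub>C s m - c *\<^sub>C s n) \<le> cmod c * seminorm (s m - s n)"
    by (simp add: seminorm_scaleC)
qed

lemma seminorm_Cauchy_bounded:
  assumes "seminorm_Cauchy s" obtains M where "M > 0" "\<And>n. seminorm (s n) \<le> M"
proof -
  have "\<bar>seminorm (s m) - seminorm (s n)\<bar> \<le> seminorm (s m - s n)" for m n
    using seminorm_triangle[of "s m - s n" "s n"] seminorm_triangle[of "s n - s m" "s m"]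
      seminorm_minus_commute[of "s m" "s n"] by simp
  then have "Cauchy (\<lambda>n. seminorm (s n))"
    using assms unfolding seminorm_Cauchy_def Cauchy_def dist_real_def by (meson le_less_trans)
  then have "Bseq (\<lambda>n. seminorm (s n))" by (rule Cauchy_Bseq)
  then obtain M where "M > 0" "\<And>n. norm (seminorm (s n)) \<le> M" unfolding Bseq_def by blast
  then show ?thesis using that[of M] by (simp add: abs_le_iff)
qed

lemma form_Cauchy:
  assumes s: "seminorm_Cauchy s" and t: "seminorm_Cauchy t"
  shows "convergent (\<lambda>n. B (s n) (t n))"
proof -
  obtain M where M: "M > 0" "\<And>n. seminorm (s n) \<le> M" by (rule seminorm_Cauchy_bounded[OF s]) (rule that)
  obtain L where L: "L > 0" "\<And>n. seminorm (t n) \<le> L" by (rule seminorm_Cauchy_bounded[OF t]) (rule that)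
  have "Cauchy (\<lambda>n. B (s n) (t n))"
    unfolding Cauchy_def dist_norm
  proof (intro allI impI)
    fix \<epsilon> :: real assume \<epsilon>: "\<epsilon> > 0"
    have "\<epsilon> / (2 * L) > 0" "\<epsilon> / (2 * M) > 0" using \<epsilon> L M by auto
    then obtain N K where N: "\<forall>m\<ge>N. \<forall>n\<ge>N. seminorm (s m - s n) < \<epsilon> / (2 * L)"
      "\<forall>m\<ge>K. \<forall>n\<ge>K. seminorm (t m - t n) < \<epsilon> / (2 * M)"
      using s t unfolding seminorm_Cauchy_def by meson
    have "norm (B (s m) (t m) - B (s n) (t n)) < \<epsilon>" if "m \<ge> max N K" "n \<ge> max N K" for m n
    proof -
      have "B (s m) (t m) - B (s n) (t n) = B (s m - s n) (t m) + B (s n) (t m - t n)"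
        by (simp add: form_diff_left form_diff_right)
      then have "norm (B (s m) (t m) - B (s n) (t n))
          \<le> seminorm (s m - s n) * seminorm (t m) + seminorm (s n) * seminorm (t m - t n)"
        using norm_triangle_ineq[of "B (s m - s n) (t m)" "B (s n) (t m - t n)"]
          form_Cauchy_Schwarz[of "s m - s n" "t m"] form_Cauchy_Schwarz[of "s n" "t m - t n"]
        by simp
      also have "\<dots> \<le> seminorm (s m - s n) * L + M * seminorm (t m - t n)"
        using M L seminorm_nonneg by (intro add_mono mult_left_mono mult_right_mono) auto
      also have "seminorm (s m - s n) * L < \<epsilon> / (2 * L) * L"
        using N that L by (intro mult_strict_right_mono) auto
      also have "M * seminorm (t m - t n) < M * (\<epsilon> / (2 * M))"
        using N that M by (intro mult_strict_left_mono) auto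
      finally show ?thesis using L M by simp
    qed
    then show "\<exists>M. \<forall>m\<ge>M. \<forall>n\<ge>M. norm (B (s m) (t m) - B (s n) (t n)) < \<epsilon>" by blast
  qed
  then show ?thesis by (rule Cauchy_convergent)
qed

text \<open>Weak convergence to 0 becomes norm convergence for Cauchy sequences: the square of the
  seminorm of \<open>d n\<close> is \<open>B (d n) (d N) + B (d n) (d n - d N)\<close>, where the
  second term is small by the Cauchy property and the first tends to 0 for fixed \<open>N\<close>.
  Hence a vector is determined by its inner products.\<close>

lemma seminorm_Cauchy_null:
  assumes d: "seminorm_Cauchy d" and lim: "\<And>b. (\<lambda>n. B (d n) b) \<longlonglongrightarrow> 0"
  shows "(\<lambda>n. seminorm (d n)) \<longlonglongrightarrow> 0"
proof (rule LIMSEQ_I)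
  fix \<epsilon> :: real assume \<epsilon>: "\<epsilon> > 0"
  obtain M where M: "M > 0" "\<And>n. seminorm (d n) \<le> M" by (rule seminorm_Cauchy_bounded[OF d]) (rule that)
  have "\<epsilon>\<^sup>2 / (2 * M) > 0" using \<epsilon> M by simp
  then obtain N where N: "\<And>m n. m \<ge> N \<Longrightarrow> n \<ge> N \<Longrightarrow> seminorm (d m - d n) < \<epsilon>\<^sup>2 / (2 * M)"
    using d unfolding seminorm_Cauchy_def by meson
  obtain K where K: "\<And>n. n \<ge> K \<Longrightarrow> norm (B (d n) (d N) - 0) < \<epsilon>\<^sup>2 / 2"
    using LIMSEQ_D[OF lim, of "\<epsilon>\<^sup>2 / 2" "d N"] \<epsilon> by auto
  have "seminorm (d n) < \<epsilon>" if n: "n \<ge> max N K" for n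
  proof (rule power2_less_imp_less)
    have "(seminorm (d n))\<^sup>2 = norm (B (d n) (d N) + B (d n) (d n - d N))"
      by (simp add: form_diff_right form_self norm_power)
    also have "\<dots> \<le> norm (B (d n) (d N)) + seminorm (d n) * seminorm (d n - d N)"
      using norm_triangle_ineq[of "B (d n) (d N)"] form_Cauchy_Schwarz[of "d n" "d n - d N"]
      by (meson add_left_mono order_trans)
    also have "seminorm (d n) * seminorm (d n - d N) \<le> M * (\<epsilon>\<^sup>2 / (2 * M))"
      using M N[of n N] n seminorm_nonneg by (intro mult_mono) (auto intro: less_imp_le)
    also have "norm (B (d n) (d N)) < \<epsilon>\<^sup>2 / 2" using K n by simp
    finally show "(seminorm (d n))\<^sup>2 < \<epsilon>\<^sup>2" using M by simp
  qed (use \<epsilon> in simp)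
  then have "\<forall>n\<ge>max N K. norm (seminorm (d n) - 0) < \<epsilon>" using seminorm_nonneg by simp
  then show "\<exists>N. \<forall>n\<ge>N. norm (seminorm (d n) - 0) < \<epsilon>" by blast
qed

text \<open>A vector of the completion is encoded by its inner products with all \<open>b :: 'b\<close>.\<close>

definition approximates :: "(nat \<Rightarrow> 'b) \<Rightarrow> ('b \<Rightarrow> complex) \<Rightarrow> bool" where
  "approximates s f \<longleftrightarrow> seminorm_Cauchy s \<and> (\<forall>b. (\<lambda>n. B (s n) b) \<longlonglongrightarrow> f b)"

text \<open>The approximating sequences are chosen arbitrarily; \<open>approximates_inner\<close>
  shows that any other choice gives the same inner product.\<close>

definition completion :: "('b \<Rightarrow> complex) inner_space" where
  "completion = \<lparr>hcarrier = {f. \<exists>s. approximates s f},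
     hinner = (\<lambda>f g. lim (\<lambda>n. B ((SOME s. approximates s f) n) ((SOME t. approximates t g) n)))\<rparr>"

lemma approximates_closed: "approximates s f \<Longrightarrow> f \<in> hcarrier completion"
  by (auto simp: completion_def)

lemma approximatesE: "f \<in> hcarrier completion \<Longrightarrow> (\<And>s. approximates s f \<Longrightarrow> thesis) \<Longrightarrow> thesis"
  by (auto simp: completion_def)

lemma approximates_add:
  "approximates s f \<Longrightarrow> approximates t g \<Longrightarrow> approximates (\<lambda>n. s n + t n) (f + g)"
  by (auto simp: approximates_def seminorm_Cauchy_add form_add_left intro!: tendsto_add)

lemma approximates_scaleC:
  "approximates s f \<Longrightarrow> approximates (\<lambda>n. c *\<^sub>C s n) (c *\<^sub>C f)"
  by (auto simp: approximates_def seminorm_Cauchy_scaleC form_scaleC_left scaleC_fun_def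
      scaleC_complex_def intro!: tendsto_mult)

lemma approximates_diff:
  assumes "approximates s f" "approximates t g" shows "approximates (\<lambda>n. s n - t n) (f - g)"
  using approximates_add[OF assms(1) approximates_scaleC[OF assms(2), of "-1"]]
  by (simp add: scaleC_minus1)

text \<open>The canonical map into the completion is \<open>B\<close> itself. It sends null vectors
  to 0 by the Cauchy-Schwarz inequality, so no separate quotient is formed.\<close>

lemma approximates_const: "approximates (\<lambda>_. a) (B a)"
  by (auto simp: approximates_def seminorm_Cauchy_def seminorm_zero)

lemma approximates_unique:
  assumes "approximates s f" "approximates t f" shows "(\<lambda>n. seminorm (s n - t n)) \<longlonglongrightarrow> 0"
  using approximates_diff[OF assms] by (intro seminorm_Cauchy_null) (auto simp: approximates_def)

text \<open>Sequences with the same limit vector differ by a seminorm-null sequence, and Cauchy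
  sequences are bounded, so replacing the chosen sequences by \<open>s\<close> and \<open>t\<close>
  does not change the limit.\<close>

lemma approximates_inner:
  assumes s: "approximates s f" and t: "approximates t g"
  shows "(\<lambda>n. B (s n) (t n)) \<longlonglongrightarrow> hinner completion f g"
proof -
  define s' where "s' = (SOME s. approximates s f)"
  define t' where "t' = (SOME t. approximates t g)"
  have s': "approximates s' f" unfolding s'_def by (rule someI[where P = "\<lambda>s. approximates s f", OF s])
  have t': "approximates t' g" unfolding t'_def by (rule someI[where P = "\<lambda>t. approximates t g", OF t])
  have lim': "(\<lambda>n. B (s' n) (t' n)) \<longlonglongrightarrow> hinner completion f g"
  proof -
    have "hinner completion f g = lim (\<lambda>n. B (s' n) (t' n))"
      by (simp add: completion_def s'_def t'_def)
    moreover have "convergent (\<lambda>n. B (s' n) (t' n))"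
      using s' t' by (intro form_Cauchy) (simp_all add: approximates_def)
    ultimately show ?thesis by (simp add: convergent_LIMSEQ_iff)
  qed
  obtain M where M: "M > 0" "\<And>n. seminorm (s' n) \<le> M"
    using seminorm_Cauchy_bounded s' by (auto simp: approximates_def)
  obtain L where L: "L > 0" "\<And>n. seminorm (t n) \<le> L"
    using seminorm_Cauchy_bounded t by (auto simp: approximates_def)
  have "(\<lambda>n. B (s n) (t n) - B (s' n) (t' n)) \<longlonglongrightarrow> 0"
  proof (rule Lim_null_comparison)
    have "norm (B (s n) (t n) - B (s' n) (t' n)) \<le> seminorm (s n - s' n) * L + M * seminorm (t n - t' n)"
      for n
    proof -
      have "B (s n) (t n) - B (s' n) (t' n) = B (s n - s' n) (t n) + B (s' n) (t n - t' n)"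
        by (simp add: form_diff_left form_diff_right)
      then have "norm (B (s n) (t n) - B (s' n) (t' n))
          \<le> seminorm (s n - s' n) * seminorm (t n) + seminorm (s' n) * seminorm (t n - t' n)"
        using norm_triangle_ineq[of "B (s n - s' n) (t n)" "B (s' n) (t n - t' n)"]
          form_Cauchy_Schwarz[of "s n - s' n" "t n"] form_Cauchy_Schwarz[of "s' n" "t n - t' n"]
        by simp
      also have "\<dots> \<le> seminorm (s n - s' n) * L + M * seminorm (t n - t' n)"
        using M L seminorm_nonneg by (intro add_mono mult_left_mono mult_right_mono) auto
      finally show ?thesis .
    qed
    then show "\<forall>\<^sub>F n in sequentially. norm (B (s n) (t n) - B (s' n) (t' n))
        \<le> seminorm (s n - s' n) * L + M * seminorm (t n - t' n)" by simp
    show "(\<lambda>n. seminorm (s n - s' n) * L + M * seminorm (t n - t' n)) \<longlonglongrightarrow> 0"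
      by (intro tendsto_add_zero tendsto_mult_left_zero tendsto_mult_right_zero
          approximates_unique[OF s s'] approximates_unique[OF t t'])
  qed
  from tendsto_add[OF this lim'] show ?thesis by simp
qed

lemma approximates_hnorm:
  assumes "approximates s f" shows "(\<lambda>n. seminorm (s n)) \<longlonglongrightarrow> hnorm completion f"
  unfolding seminorm_def hnorm_def
  by (intro tendsto_real_sqrt tendsto_Re approximates_inner assms)

lemma completion_hnorm_triangle:
  assumes f: "f \<in> hcarrier completion" and g: "g \<in> hcarrier completion"
  shows "hnorm completion (f + g) \<le> hnorm completion f + hnorm completion g"
proof -
  obtain s t where st: "approximates s f" "approximates t g"
    using f g by (meson approximatesE)
  show ?thesis
    by (rule LIMSEQ_le[OF approximates_hnorm[OF approximates_add[OF st]]
          tendsto_add[OF approximates_hnorm[OF st(1)] approximates_hnorm[OF st(2)]]])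
      (simp add: seminorm_triangle)
qed

lemma completion_diff_closed:
  "f \<in> hcarrier completion \<Longrightarrow> g \<in> hcarrier completion \<Longrightarrow> f - g \<in> hcarrier completion"
  by (meson approximatesE approximates_closed approximates_diff)

lemma completion_hnorm_form: "hnorm completion (B a) = seminorm a"
  using LIMSEQ_unique[OF approximates_hnorm[OF approximates_const] tendsto_const] by simp

text \<open>The reproducing property: evaluation at \<open>a\<close> is pairing with the image of
  \<open>a\<close>.\<close>

lemma completion_inner_form:
  assumes "f \<in> hcarrier completion" shows "hinner completion f (B a) = f a"
proof -
  obtain s where s: "approximates s f" using assms by (rule approximatesE)
  have "(\<lambda>n. B (s n) a) \<longlonglongrightarrow> f a" using s by (simp add: approximates_def)
  then show ?thesis
    using LIMSEQ_unique[OF approximates_inner[OF s approximates_const[of a]]] by simp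
qed

lemma form_closed: "B a \<in> hcarrier completion"
  using approximates_closed[OF approximates_const] .

lemma form_diff: "B a - B b = B (a - b)"
  by (simp add: fun_eq_iff form_diff_left)

lemma completion_tendsto:
  assumes s: "approximates s f"
  shows "(\<lambda>n. hnorm completion (f - B (s n))) \<longlonglongrightarrow> 0"
proof (rule LIMSEQ_I)
  fix \<epsilon> :: real assume \<epsilon>: "\<epsilon> > 0"
  obtain N where N: "\<And>m n. m \<ge> N \<Longrightarrow> n \<ge> N \<Longrightarrow> seminorm (s m - s n) < \<epsilon> / 2"
    using s \<epsilon> unfolding approximates_def seminorm_Cauchy_def by (meson half_gt_zero)
  have "norm (hnorm completion (f - B (s n)) - 0) < \<epsilon>" if n: "n \<ge> N" for n
  proof -
    have lim: "(\<lambda>k. seminorm (s k - s n)) \<longlonglongrightarrow> hnorm completion (f - B (s n))"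
      by (rule approximates_hnorm[OF approximates_diff[OF s approximates_const]])
    have "hnorm completion (f - B (s n)) \<le> \<epsilon> / 2"
      by (rule LIMSEQ_le_const2[OF lim]) (use N n less_imp_le in blast)
    moreover have "0 \<le> hnorm completion (f - B (s n))"
      by (rule LIMSEQ_le_const[OF lim]) (use seminorm_nonneg in blast)
    ultimately show ?thesis using \<epsilon> by simp
  qed
  then show "\<exists>N. \<forall>n\<ge>N. norm (hnorm completion (f - B (s n)) - 0) < \<epsilon>" by blast
qed

lemma completion_dense:
  assumes "f \<in> hcarrier completion" and \<epsilon>: "\<epsilon> > 0"
  shows "\<exists>a. hnorm completion (f - B a) < \<epsilon>"
proof -
  obtain s where s: "approximates s f" using assms(1) by (rule approximatesE)
  show ?thesis using LIMSEQ_D[OF completion_tendsto[OF s] \<epsilon>] by (auto simp: abs_less_iff)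
qed

lemma completion_minus_commute:
  assumes "f \<in> hcarrier completion" "g \<in> hcarrier completion"
  shows "hnorm completion (f - g) = hnorm completion (g - f)"
proof -
  obtain s t where st: "approximates s f" "approximates t g"
    using assms by (meson approximatesE)
  show ?thesis
    using LIMSEQ_unique[OF approximates_hnorm[OF approximates_diff[OF st]]]
      approximates_hnorm[OF approximates_diff[OF st(2,1)]] by (simp add: seminorm_minus_commute)
qed

text \<open>Replacing \<open>X n\<close> by the image of some \<open>a n\<close> at distance less
  than 1/(n+1) gives a Cauchy sequence \<open>a\<close>, and the vector that it approximates is the
  limit of \<open>X\<close>.\<close>

lemma completion_complete:
  assumes X: "\<And>n::nat. X n \<in> hcarrier completion"
    and Cau: "\<And>\<epsilon>. \<epsilon> > 0 \<Longrightarrow> \<exists>N. \<forall>m\<ge>N. \<forall>n\<ge>N. hnorm completion (X m - X n) < \<epsilon>"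
  shows "\<exists>f\<in>hcarrier completion. (\<lambda>n. hnorm completion (X n - f)) \<longlonglongrightarrow> 0"
proof -
  let ?n = "hnorm completion"
  have "\<exists>a. ?n (X n - B a) < 1 / real (Suc n)" for n using completion_dense[OF X] by simp
  then obtain a where a: "\<And>n. ?n (X n - B (a n)) < 1 / real (Suc n)" by metis
  note cl = completion_diff_closed X form_closed
  have tri: "?n (f - h) \<le> ?n (f - g) + ?n (g - h)"
    if "f \<in> hcarrier completion" "g \<in> hcarrier completion" "h \<in> hcarrier completion" for f g h
    using completion_hnorm_triangle[of "f - g" "g - h"] that completion_diff_closed by simp
  have Ca: "seminorm_Cauchy a"
    unfolding seminorm_Cauchy_def
  proof (intro allI impI)
    fix \<epsilon> :: real assume \<epsilon>: "\<epsilon> > 0"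
    obtain N where N: "\<And>m n. m \<ge> N \<Longrightarrow> n \<ge> N \<Longrightarrow> ?n (X m - X n) < \<epsilon> / 3" using Cau[of "\<epsilon> / 3"] \<epsilon> by auto
    obtain K where K: "1 / real (Suc K) < \<epsilon> / 3" using nat_approx_posE[of "\<epsilon> / 3"] \<epsilon> by auto
    have small: "?n (X n - B (a n)) < \<epsilon> / 3" if "n \<ge> K" for n
    proof -
      have "1 / real (Suc n) \<le> 1 / real (Suc K)" using that by (intro divide_left_mono) auto
      then show ?thesis using a[of n] K by linarith
    qed
    have "seminorm (a m - a n) < \<epsilon>" if "m \<ge> max N K" "n \<ge> max N K" for m n
    proof -
      have "seminorm (a m - a n) = ?n (B (a m) - B (a n))"
        by (simp add: form_diff completion_hnorm_form)
      also have "\<dots> \<le> ?n (B (a m) - X m) + ?n (X m - B (a n))" using cl by (intro tri)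
      also have "?n (X m - B (a n)) \<le> ?n (X m - X n) + ?n (X n - B (a n))" using cl by (intro tri)
      also have "?n (B (a m) - X m) = ?n (X m - B (a m))" using cl by (intro completion_minus_commute)
      finally have "seminorm (a m - a n)
          \<le> ?n (X m - B (a m)) + (?n (X m - X n) + ?n (X n - B (a n)))" by (simp only: add_left_mono)
      moreover have "?n (X m - B (a m)) < \<epsilon> / 3" "?n (X m - X n) < \<epsilon> / 3" "?n (X n - B (a n)) < \<epsilon> / 3"
        by (rule small N; use that in simp)+
      ultimately show ?thesis by linarith
    qed
    then show "\<exists>N. \<forall>m\<ge>N. \<forall>n\<ge>N. seminorm (a m - a n) < \<epsilon>" by blast
  qed
  have "convergent (\<lambda>n. B (a n) b)" for b
    using form_Cauchy[OF Ca, of "\<lambda>_. b"] by (simp add: seminorm_Cauchy_def seminorm_zero)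
  then have "approximates a (\<lambda>b. lim (\<lambda>n. B (a n) b))"
    using Ca by (simp add: approximates_def convergent_LIMSEQ_iff)
  then obtain f where f: "approximates a f" by blast
  have fc: "f \<in> hcarrier completion" using approximates_closed[OF f] .
  have "(\<lambda>n. ?n (X n - f)) \<longlonglongrightarrow> 0"
  proof (rule tendsto_sandwich)
    have "0 \<le> ?n g" if g: "g \<in> hcarrier completion" for g
    proof -
      obtain s where s: "approximates s g" using g by (rule approximatesE)
      show ?thesis by (rule LIMSEQ_le_const[OF approximates_hnorm[OF s]]) (use seminorm_nonneg in blast)
    qed
    then show "\<forall>\<^sub>F n in sequentially. 0 \<le> ?n (X n - f)" using cl fc by simp
    have "?n (X n - f) \<le> 1 / real (Suc n) + ?n (f - B (a n))" for n
      using tri[OF X form_closed fc, of n "a n"] a[of n]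
        completion_minus_commute[OF form_closed fc, of "a n"] by linarith
    then show "\<forall>\<^sub>F n in sequentially. ?n (X n - f) \<le> 1 / real (Suc n) + ?n (f - B (a n))" by simp
    show "(\<lambda>n. 1 / real (Suc n) + ?n (f - B (a n))) \<longlonglongrightarrow> 0"
      using tendsto_add[OF LIMSEQ_Suc[OF lim_1_over_n] completion_tendsto[OF f]] by simp
  qed simp
  then show ?thesis using fc by blast
qed

lemma hilbert_space_completion: "hilbert_space completion"
proof
  show "is_subspace (hcarrier completion)"
    unfolding is_subspace_def
  proof (intro conjI ballI allI)
    have "B 0 = 0" by (simp add: fun_eq_iff form_zero_left)
    then show "0 \<in> hcarrier completion" using form_closed[of 0] by simp
  qed (meson approximatesE approximates_closed approximates_add approximates_scaleC)+
next
  fix f g h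
  assume "f \<in> hcarrier completion" "g \<in> hcarrier completion" "h \<in> hcarrier completion"
  then obtain s t u where *: "approximates s f" "approximates t g" "approximates u h"
    by (meson approximatesE)
  have "(\<lambda>n. B (s n + t n) (u n)) \<longlonglongrightarrow> hinner completion f h + hinner completion g h"
    unfolding form_add_left by (intro tendsto_add approximates_inner *)
  then show "hinner completion (f + g) h = hinner completion f h + hinner completion g h"
    using approximates_inner[OF approximates_add[OF *(1,2)] *(3)] LIMSEQ_unique by blast
next
  fix f h c
  assume "f \<in> hcarrier completion" "h \<in> hcarrier completion"
  then obtain s u where *: "approximates s f" "approximates u h"
    by (meson approximatesE)
  have "(\<lambda>n. B (c *\<^sub>C s n) (u n)) \<longlonglongrightarrow> c * hinner completion f h"
    unfolding form_scaleC_left by (intro tendsto_mult tendsto_const approximates_inner *)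
  then show "hinner completion (c *\<^sub>C f) h = c * hinner completion f h"
    using approximates_inner[OF approximates_scaleC[OF *(1)] *(2)] LIMSEQ_unique by blast
next
  fix f h
  assume "f \<in> hcarrier completion" "h \<in> hcarrier completion"
  then obtain s u where *: "approximates s f" "approximates u h"
    by (meson approximatesE)
  have "(\<lambda>n. B (u n) (s n)) \<longlonglongrightarrow> cnj (hinner completion f h)"
    unfolding form_cnj[of "s _" "u _", symmetric]
    by (subst form_cnj) (intro tendsto_cnj approximates_inner *)
  then show "hinner completion h f = cnj (hinner completion f h)"
    using approximates_inner[OF *(2,1)] LIMSEQ_unique by blast
next
  fix f assume f: "f \<in> hcarrier completion" "f \<noteq> 0"
  obtain s where s: "approximates s f" using f(1) by (rule approximatesE)
  have lim: "(\<lambda>n. (seminorm (s n))\<^sup>2) \<longlonglongrightarrow> Re (hinner completion f f)"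
    unfolding seminorm_power2 by (intro tendsto_Re approximates_inner s)
  have "Re (hinner completion f f) \<ge> 0" by (rule LIMSEQ_le_const[OF lim]) simp
  moreover have "Re (hinner completion f f) \<noteq> 0"
  proof
    assume "Re (hinner completion f f) = 0"
    then have "(\<lambda>n. seminorm (s n)) \<longlonglongrightarrow> 0"
      using lim tendsto_real_sqrt[of "\<lambda>n. (seminorm (s n))\<^sup>2" 0] seminorm_nonneg by simp
    then have null: "(\<lambda>n. seminorm (s n) * seminorm b) \<longlonglongrightarrow> 0" for b by (rule tendsto_mult_left_zero)
    have "(\<lambda>n. B (s n) b) \<longlonglongrightarrow> 0" for b
      by (rule Lim_null_comparison[OF _ null[of b]]) (simp add: form_Cauchy_Schwarz)
    then have "f b = 0" for b using s LIMSEQ_unique unfolding approximates_def by blast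
    then show False using f(2) by (simp add: fun_eq_iff)
  qed
  ultimately show "0 < Re (hinner completion f f)" by simp
next
  fix X :: "nat \<Rightarrow> 'b \<Rightarrow> complex"
  assume "\<And>n. X n \<in> hcarrier completion"
    and "\<And>\<epsilon>. \<epsilon> > 0 \<Longrightarrow> \<exists>N. \<forall>m\<ge>N. \<forall>n\<ge>N. hnorm completion (X m - X n) < \<epsilon>"
  then show "\<exists>f\<in>hcarrier completion. (\<lambda>n. hnorm completion (X n - f)) \<longlonglongrightarrow> 0"
    by (rule completion_complete)
qed

end

section \<open>Quasi-states\<close>

context hilbert_space
begin

lemma hnorm_scaleC: "x \<in> hcarrier V \<Longrightarrow> hnorm V (c *\<^sub>C x) = cmod c * hnorm V x"
proof -
  assume x: "x \<in> hcarrier V"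
  have "hinner V (c *\<^sub>C x) (c *\<^sub>C x) = (c * cnj c) * hinner V x x"
    using x by (simp add: inner_scaleC_left inner_scaleC_right scaleC_closed)
  also have "\<dots> = of_real ((cmod c)\<^sup>2) * hinner V x x" by (simp only: complex_norm_square)
  finally have "(hnorm V (c *\<^sub>C x))\<^sup>2 = (cmod c * hnorm V x)\<^sup>2"
    using x by (simp add: hnorm_power2 scaleC_closed power_mult_distrib del: of_real_power)
  then show ?thesis using x hnorm_nonneg scaleC_closed by (simp add: power2_eq_iff_nonneg)
qed

lemma hnorm_triangle_diff:
  assumes "x \<in> hcarrier V" "y \<in> hcarrier V"
  shows "hnorm V (x - y) \<le> hnorm V x + hnorm V y"
  using hnorm_triangle[OF assms(1) scaleC_closed[OF assms(2), of "-1"]]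
    hnorm_scaleC[OF assms(2), of "-1"] by (simp add: scaleC_minus1)

lemma tendsto_inner:
  assumes "x \<in> hcarrier V" "y \<in> hcarrier V" "\<And>n::nat. X n \<in> hcarrier V" "\<And>n. Y n \<in> hcarrier V"
    and X: "(\<lambda>n. hnorm V (X n - x)) \<longlonglongrightarrow> 0" and Y: "(\<lambda>n. hnorm V (Y n - y)) \<longlonglongrightarrow> 0"
  shows "(\<lambda>n. hinner V (X n) (Y n)) \<longlonglongrightarrow> hinner V x y"
proof -
  have "(\<lambda>n. hinner V (X n) (Y n) - hinner V (X n) y) \<longlonglongrightarrow> 0"
  proof (rule Lim_null_comparison)
    have "norm (hinner V (X n) (Y n) - hinner V (X n) y)
        \<le> (hnorm V (X n - x) + hnorm V x) * hnorm V (Y n - y)" for n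
    proof -
      have "hnorm V (X n) \<le> hnorm V (X n - x) + hnorm V x"
        using hnorm_triangle[of "X n - x" x] assms diff_closed by simp
      then show ?thesis
        using Cauchy_Schwarz[of "X n" "Y n - y"] assms diff_closed
          mult_right_mono[of "hnorm V (X n)" "hnorm V (X n - x) + hnorm V x" "hnorm V (Y n - y)"]
          hnorm_nonneg[of "Y n - y"]
        by (simp add: inner_diff_right)
    qed
    then show "\<forall>\<^sub>F n in sequentially. norm (hinner V (X n) (Y n) - hinner V (X n) y)
        \<le> (hnorm V (X n - x) + hnorm V x) * hnorm V (Y n - y)" by simp
    show "(\<lambda>n. (hnorm V (X n - x) + hnorm V x) * hnorm V (Y n - y)) \<longlonglongrightarrow> 0"
      using tendsto_mult[OF tendsto_add[OF X tendsto_const] Y] by simp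
  qed
  from tendsto_add[OF this tendsto_inner_left[OF assms(1,2,3) X]] show ?thesis by simp
qed

lemma limit_sequence:
  assumes "\<And>\<epsilon>. \<epsilon> > 0 \<Longrightarrow> \<exists>a. hnorm V (x - g a) < \<epsilon>" and "x \<in> hcarrier V" "\<And>a. g a \<in> hcarrier V"
  obtains s :: "nat \<Rightarrow> 'z" where "(\<lambda>n. hnorm V (g (s n) - x)) \<longlonglongrightarrow> 0"
proof -
  have "\<exists>a. hnorm V (x - g a) < 1 / real (Suc n)" for n using assms(1) by simp
  then obtain s where s: "\<And>n. hnorm V (x - g (s n)) < 1 / real (Suc n)" by metis
  have "(\<lambda>n. hnorm V (g (s n) - x)) \<longlonglongrightarrow> 0"
  proof (rule tendsto_sandwich)
    show "\<forall>\<^sub>F n in sequentially. 0 \<le> hnorm V (g (s n) - x)"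
      using assms by (simp add: hnorm_nonneg diff_closed)
    show "\<forall>\<^sub>F n in sequentially. hnorm V (g (s n) - x) \<le> 1 / real (Suc n)"
      using s assms hnorm_minus_commute[of x "g (s _)"] by (simp add: less_imp_le)
    show "(\<lambda>n. 1 / real (Suc n)) \<longlonglongrightarrow> 0" by (rule LIMSEQ_Suc[OF lim_1_over_n])
  qed simp
  then show ?thesis using that by blast
qed

end

section \<open>Vector functionals, the nonnegative cone and quasi-states\<close>

definition vector_functional :: "('a, 'v) representation \<Rightarrow> 'v \<Rightarrow> 'a \<Rightarrow> complex" where
  "vector_functional V v = (\<lambda>a. hinner V (action V a v) v)"

text \<open>For a unitary representation this says that the self-adjoint part of \<open>b\<close>
  acts as a positive operator. All vectors are used, not only unit vectors, so the cone is also
  sensitive to vectors of arbitrary length, as occur in the neighbourhoods of the unitary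
  dual.\<close>

definition nonneg_cone :: "('a, 'v) representation \<Rightarrow> 'a set" where
  "nonneg_cone V = {b. \<forall>y\<in>hcarrier V. 0 \<le> Re (vector_functional V y b)}"

definition positive_functional :: "('a::star_algebra \<Rightarrow> complex) \<Rightarrow> bool" where
  "positive_functional \<psi> \<longleftrightarrow> (\<forall>a b. \<psi> (a + b) = \<psi> a + \<psi> b) \<and> (\<forall>c a. \<psi> (c *\<^sub>C a) = c * \<psi> a)
     \<and> (\<forall>a. \<psi> (star a) = cnj (\<psi> a)) \<and> (\<forall>a. 0 \<le> Re (\<psi> (star a * a)))"

text \<open>The inequality \<open>|\<psi> a|\<^sup>2 \<le> \<psi> (a\<^sup>* a)\<close> replaces \<open>\<psi> 1 \<le> 1\<close>, as there need not be a unit.\<close>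

definition quasi_states :: "('a::star_algebra, 'v) representation \<Rightarrow> ('a \<Rightarrow> complex) set" where
  "quasi_states V = {\<psi>. positive_functional \<psi> \<and> (\<forall>a. (cmod (\<psi> a))\<^sup>2 \<le> Re (\<psi> (star a * a)))
     \<and> (\<forall>b\<in>nonneg_cone V. 0 \<le> Re (\<psi> b))}"

lemma positive_functionalD:
  assumes "positive_functional \<psi>"
  shows "\<psi> (a + b) = \<psi> a + \<psi> b" "\<psi> (c *\<^sub>C a) = c * \<psi> a" "\<psi> (star a) = cnj (\<psi> a)"
    "0 \<le> Re (\<psi> (star a * a))" "\<psi> (a - b) = \<psi> a - \<psi> b" "\<psi> 0 = 0"
proof -
  show *: "\<psi> (a + b) = \<psi> a + \<psi> b" for a b using assms by (simp add: positive_functional_def)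
  show "\<psi> (c *\<^sub>C a) = c * \<psi> a" "\<psi> (star a) = cnj (\<psi> a)" "0 \<le> Re (\<psi> (star a * a))"
    using assms by (simp_all add: positive_functional_def)
  show "\<psi> (a - b) = \<psi> a - \<psi> b" using *[of "a - b" b] by simp
  show "\<psi> 0 = 0" using *[of 0 0] by simp
qed

text \<open>Turns a coordinate functional on positive functionals into evaluation at one
  element.\<close>

lemma positive_functional_sum:
  assumes "positive_functional \<psi>"
  shows "(\<Sum>a\<in>T. c a * \<psi> a) = \<psi> (\<Sum>a\<in>T. c a *\<^sub>C a)"
proof (induction T rule: infinite_finite_induct)
  case (insert a T)
  then show ?case by (simp add: positive_functionalD[OF assms])
qed (simp_all add: positive_functionalD[OF assms])

lemma positive_functional_semidefinite_form:
  assumes "positive_functional \<psi>"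
  shows "semidefinite_form (\<lambda>x y. \<psi> (star y * x))"
proof
  fix x y z :: 'a and c
  show "\<psi> (star z * (x + y)) = \<psi> (star z * x) + \<psi> (star z * y)"
    "\<psi> (star z * (c *\<^sub>C x)) = c * \<psi> (star z * x)" "0 \<le> Re (\<psi> (star x * x))"
    by (simp_all add: distrib_left mult_scaleC_right positive_functionalD[OF assms])
  show "\<psi> (star x * y) = cnj (\<psi> (star y * x))"
    by (simp add: positive_functionalD(3)[OF assms, symmetric] star_mult star_star)
qed

context unitary_rep
begin

lemma action_bounded_pos:
  obtains C where "C > 0" "\<And>v. v \<in> hcarrier V \<Longrightarrow> hnorm V (action V a v) \<le> C * hnorm V v"
proof -
  obtain C where C: "\<And>v. v \<in> hcarrier V \<Longrightarrow> hnorm V (action V a v) \<le> C * hnorm V v"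
    using action_bounded by blast
  have "hnorm V (action V a v) \<le> (\<bar>C\<bar> + 1) * hnorm V v" if "v \<in> hcarrier V" for v
    using C[OF that] mult_right_mono[of C "\<bar>C\<bar> + 1" "hnorm V v"] hnorm_nonneg[OF that] by linarith
  then show ?thesis using that[of "\<bar>C\<bar> + 1"] by simp
qed

lemma action_diff_right:
  "v \<in> hcarrier V \<Longrightarrow> w \<in> hcarrier V \<Longrightarrow> action V a (v - w) = action V a v - action V a w"
  using action_add_right[of "v - w" w a] diff_closed by simp

lemma action_diff_left:
  "v \<in> hcarrier V \<Longrightarrow> action V (a - b) v = action V a v - action V b v"
  using action_add_left[of v "a - b" b] by simp

lemma inner_action_left:
  "v \<in> hcarrier V \<Longrightarrow> w \<in> hcarrier V \<Longrightarrow> hinner V v (action V a w) = hinner V (action V (star a) v) w"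
  using action_star[of v w "star a"] by (simp add: star_star)

lemma tendsto_vector_functional:
  assumes "x \<in> hcarrier V" "\<And>n::nat. X n \<in> hcarrier V" "(\<lambda>n. hnorm V (X n - x)) \<longlonglongrightarrow> 0"
  shows "(\<lambda>n. vector_functional V (X n) a) \<longlonglongrightarrow> vector_functional V x a"
  unfolding vector_functional_def
proof (rule tendsto_inner)
  obtain C where C: "C > 0" "\<And>v. v \<in> hcarrier V \<Longrightarrow> hnorm V (action V a v) \<le> C * hnorm V v"
    by (rule action_bounded_pos[where a = a]) (rule that)
  show "(\<lambda>n. hnorm V (action V a (X n) - action V a x)) \<longlonglongrightarrow> 0"
  proof (rule Lim_null_comparison)
    show "\<forall>\<^sub>F n in sequentially.
        norm (hnorm V (action V a (X n) - action V a x)) \<le> C * hnorm V (X n - x)"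
      using C(2)[OF diff_closed[OF assms(2,1)]] assms
      by (simp add: action_diff_right[symmetric] hnorm_nonneg action_closed diff_closed)
    show "(\<lambda>n. C * hnorm V (X n - x)) \<longlonglongrightarrow> 0" using tendsto_mult_right_zero[OF assms(3)] .
  qed
qed (use assms action_closed in auto)

lemma vector_functional_scaleC:
  "v \<in> hcarrier V \<Longrightarrow> vector_functional V (c *\<^sub>C v) a = of_real ((cmod c)\<^sup>2) * vector_functional V v a"
  unfolding complex_norm_square vector_functional_def
  by (simp add: action_scaleC_right inner_scaleC_left inner_scaleC_right action_closed scaleC_closed)

lemma vector_functional_action:
  "v \<in> hcarrier V \<Longrightarrow> vector_functional V (action V b v) a = vector_functional V v (star b * a * b)"
  by (simp add: vector_functional_def action_mult action_closed inner_action_left)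

lemma vector_functional_star_mult:
  "v \<in> hcarrier V \<Longrightarrow> vector_functional V v (star b * a) = hinner V (action V a v) (action V b v)"
  by (simp add: vector_functional_def action_mult action_closed inner_action_left)

lemma vector_functional_square:
  "v \<in> hcarrier V \<Longrightarrow> vector_functional V v (star a * a) = of_real ((hnorm V (action V a v))\<^sup>2)"
  by (simp add: vector_functional_star_mult inner_self action_closed)

lemma vector_functional_linear:
  assumes "v \<in> hcarrier V"
  shows "vector_functional V v (a + b) = vector_functional V v a + vector_functional V v b"
    "vector_functional V v (a - b) = vector_functional V v a - vector_functional V v b"
    "vector_functional V v (c *\<^sub>C a) = c * vector_functional V v a"
  using assms
  by (simp_all add: vector_functional_def action_add_left action_diff_left action_scaleC_left
      inner_add_left inner_diff_left inner_scaleC_left action_closed)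

lemma vector_functional_positive:
  assumes v: "v \<in> hcarrier V"
  shows "positive_functional (vector_functional V v)"
  unfolding positive_functional_def
proof (intro conjI allI)
  fix a
  show "vector_functional V v (star a) = cnj (vector_functional V v a)"
    using v inner_cnj[of "action V a v" v] inner_action_left[of v v a]
    by (simp add: vector_functional_def action_closed)
qed (use v in \<open>simp_all add: vector_functional_linear vector_functional_square\<close>)

lemma vector_functional_quasi_state:
  assumes v: "v \<in> hcarrier V" "hnorm V v \<le> 1" and cone: "nonneg_cone U \<subseteq> nonneg_cone V"
  shows "vector_functional V v \<in> quasi_states U"
  unfolding quasi_states_def
proof (intro CollectI conjI allI ballI)
  show "positive_functional (vector_functional V v)" using v by (intro vector_functional_positive)
  fix a
  have "cmod (vector_functional V v a) \<le> hnorm V (action V a v) * hnorm V v"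
    unfolding vector_functional_def using v by (intro Cauchy_Schwarz action_closed)
  also have "\<dots> \<le> hnorm V (action V a v) * 1"
    using v by (intro mult_left_mono hnorm_nonneg action_closed)
  finally show "(cmod (vector_functional V v a))\<^sup>2 \<le> Re (vector_functional V v (star a * a))"
    using v by (simp add: vector_functional_square power_mono del: of_real_power)
next
  fix b assume "b \<in> nonneg_cone U"
  then show "0 \<le> Re (vector_functional V v b)" using cone v by (auto simp: nonneg_cone_def)
qed

text \<open>Conjugation by \<open>c\<close> replaces \<open>y\<close> by \<open>cy\<close>. It will
  extend nonnegativity from a cyclic vector to its whole orbit.\<close>

lemma nonneg_cone_conjugate:
  assumes "b \<in> nonneg_cone V" shows "star c * b * c \<in> nonneg_cone V"
  using assms action_closed by (auto simp: nonneg_cone_def vector_functional_action[symmetric])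

text \<open>The operator bound of \<open>a\<close>, squared, restated as membership in the cone.
  Every functional that is nonnegative on the cone inherits it; this gives both the compactness of
  the quasi-states and the boundedness of their GNS operators.\<close>

lemma nonneg_cone_bounded:
  "\<exists>C\<ge>0. \<forall>c. of_real C *\<^sub>C (star c * c) - star (a * c) * (a * c) \<in> nonneg_cone V"
proof -
  obtain C where C: "C > 0" "\<And>v. v \<in> hcarrier V \<Longrightarrow> hnorm V (action V a v) \<le> C * hnorm V v"
    by (rule action_bounded_pos[where a = a]) (rule that)
  have "0 \<le> Re (vector_functional V y (of_real (C\<^sup>2) *\<^sub>C (star c * c) - star (a * c) * (a * c)))"
    if y: "y \<in> hcarrier V" for y c
  proof -
    have "(hnorm V (action V (a * c) y))\<^sup>2 \<le> (C * hnorm V (action V c y))\<^sup>2"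
      using C y by (intro power_mono) (simp_all add: action_mult action_closed hnorm_nonneg)
    then show ?thesis
      using y by (simp only: vector_functional_linear vector_functional_square)
        (simp add: power_mult_distrib del: of_real_power)
  qed
  then show ?thesis by (intro exI[of _ "C\<^sup>2"]) (simp add: nonneg_cone_def del: of_real_power)
qed

lemma vector_functional_idempotent:
  assumes "v \<in> hcarrier V" "e * e = e" "star e = e"
  shows "vector_functional V v e = of_real ((hnorm V (action V e v))\<^sup>2)"
  using vector_functional_square[of v e] assms by simp

lemma hnorm_idempotent_le:
  assumes v: "v \<in> hcarrier V" and e: "e * e = e" "star e = e"
  shows "hnorm V (action V e v) \<le> hnorm V v"
proof -
  have "(hnorm V (action V e v))\<^sup>2 = Re (hinner V (action V e v) v)"
    using vector_functional_idempotent[OF v e] by (simp add: vector_functional_def)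
  also have "\<dots> \<le> hnorm V (action V e v) * hnorm V v"
    using Cauchy_Schwarz[OF action_closed[OF v] v] complex_Re_le_cmod order_trans by blast
  finally have sq: "(hnorm V (action V e v))\<^sup>2 \<le> hnorm V (action V e v) * hnorm V v" .
  show ?thesis
  proof (cases "hnorm V (action V e v) = 0")
    case True
    then show ?thesis using hnorm_nonneg[OF v] by simp
  next
    case False
    then have "0 < hnorm V (action V e v)" using hnorm_nonneg[OF action_closed[OF v], of e] by simp
    then show ?thesis using sq by (simp add: power2_eq_square)
  qed
qed

text \<open>Such a \<open>z\<close> is orthogonal to all \<open>aw\<close>, which are dense.\<close>

lemma eq_0_if_action_eq_0:
  assumes z: "z \<in> hcarrier V" "\<And>a. action V a z = 0" shows "z = 0"
proof (rule eq_0_if_inner_small[OF z(1)])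
  fix \<epsilon> :: real assume "\<epsilon> > 0"
  then obtain a w where w: "w \<in> hcarrier V" "hnorm V (z - action V a w) < \<epsilon>"
    using action_dense z by blast
  moreover have "hinner V (action V a w) z = 0" using z w by (simp add: action_star inner_zero_right)
  ultimately show "\<exists>y\<in>hcarrier V. hnorm V (z - y) < \<epsilon> \<and> hinner V y z = 0"
    using action_closed by blast
qed

end

section \<open>Self-adjoint idempotents as an approximate unit\<close>

lemma idempotent_absorb:
  fixes e a :: "'a::star_algebra"
  assumes "e * e = e" "e * a * e = a" shows "e * a = a" "a * e = a"
  using assms by (metis mult.assoc)+

text \<open>An idempotent that fixes \<open>a\<close> from the left fixes \<open>aw\<close>, which
  is near \<open>v\<close>. As idempotents act as contractions, \<open>ev\<close> is then near
  \<open>v\<close> too; the error is counted twice, whence \<epsilon>/2.\<close>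

lemma approximating_idempotent:
  fixes V :: "('a::idempotented_star_algebra, 'v::complex_vector) representation"
  assumes "unitary_rep V" and v: "v \<in> hcarrier V" and T: "finite T" and \<epsilon>: "\<epsilon> > 0"
  shows "\<exists>e. e * e = e \<and> star e = e \<and> (\<forall>a\<in>T. e * a * e = a) \<and> hnorm V (v - action V e v) < \<epsilon>"
proof -
  interpret unitary_rep V by fact
  obtain a w where w: "w \<in> hcarrier V" "hnorm V (v - action V a w) < \<epsilon> / 2"
    using action_dense[OF v, of "\<epsilon> / 2"] \<epsilon> by auto
  obtain e where e: "e * e = e" "star e = e" "\<forall>a\<in>insert a T. e * a * e = a"
    using idempotented[of "insert a T"] T by auto
  have ea: "e * a = a" using e idempotent_absorb(1)[OF e(1)] by blast
  define u where "u = v - action V a w"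
  have u: "u \<in> hcarrier V" using v w by (simp add: u_def diff_closed action_closed)
  have "action V e u = action V e v - action V a w"
    using v w ea by (simp add: u_def action_diff_right action_closed action_mult[symmetric])
  then have eq: "v - action V e v = u - action V e u" by (simp add: u_def)
  have "hnorm V (u - action V e u) \<le> hnorm V u + hnorm V (action V e u)"
    using u action_closed by (intro hnorm_triangle_diff)
  then have "hnorm V (v - action V e v) < \<epsilon>"
    unfolding eq using hnorm_idempotent_le[OF u e(1,2)] w(2)[folded u_def] by linarith
  then show ?thesis using e by blast
qed

lemma quasi_statesD:
  assumes "\<psi> \<in> quasi_states V"
  shows "positive_functional \<psi>" "(cmod (\<psi> a))\<^sup>2 \<le> Re (\<psi> (star a * a))"
    "b \<in> nonneg_cone V \<Longrightarrow> 0 \<le> Re (\<psi> b)"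
  using assms by (auto simp: quasi_states_def)

text \<open>The defining inequality at \<open>e\<close> reads (\<psi> e)^2 \<le> \<psi> e. The
  resulting bound by 1 does the work of normalization at a unit.\<close>

lemma quasi_state_idempotent:
  assumes \<psi>: "\<psi> \<in> quasi_states V" and e: "e * e = e" "star e = e"
  shows "\<psi> e = of_real (Re (\<psi> e))" "0 \<le> Re (\<psi> e)" "Re (\<psi> e) \<le> 1"
proof -
  note pos = quasi_statesD(1)[OF \<psi>]
  show 1: "\<psi> e = of_real (Re (\<psi> e))"
    using positive_functionalD(3)[OF pos, of e] e by (auto simp: complex_eq_iff)
  show 2: "0 \<le> Re (\<psi> e)" using positive_functionalD(4)[OF pos, of e] e by simp
  have "(Re (\<psi> e))\<^sup>2 \<le> Re (\<psi> e)"
    using quasi_statesD(2)[OF \<psi>, of e] e 2 by (subst (asm) 1) simp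
  then show "Re (\<psi> e) \<le> 1"
    using 2 by (cases "Re (\<psi> e) = 0") (auto simp: power2_eq_square)
qed

text \<open>With \<open>c = e\<close> in \<open>nonneg_cone_bounded\<close> and
  \<open>a * e = a\<close>, the value of \<psi> at \<open>star a * a\<close> is at most
  \<open>C\<close> times its value at \<open>e\<close>, hence at most \<open>C\<close>, uniformly in
  \<psi>.\<close>

lemma quasi_states_bounded:
  fixes V :: "('a::idempotented_star_algebra, 'v::complex_vector) representation"
  assumes "unitary_rep V"
  shows "\<exists>C. \<forall>\<psi>\<in>quasi_states V. cmod (\<psi> a) \<le> C"
proof -
  interpret unitary_rep V by fact
  obtain e where e: "e * e = e" "star e = e" "e * a * e = a" using idempotented[of "{a}"] by auto
  obtain C where C: "C \<ge> 0" "\<And>c. of_real C *\<^sub>C (star c * c) - star (a * c) * (a * c) \<in> nonneg_cone V"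
    using nonneg_cone_bounded[of a] by blast
  have "cmod (\<psi> a) \<le> sqrt C" if \<psi>: "\<psi> \<in> quasi_states V" for \<psi>
  proof (rule real_le_rsqrt)
    note pos = quasi_statesD(1)[OF \<psi>]
    have "of_real C *\<^sub>C e - star a * a \<in> nonneg_cone V"
      using C(2)[of e] e idempotent_absorb(2)[OF e(1,3)] by simp
    then have "Re (\<psi> (star a * a)) \<le> C * Re (\<psi> e)"
      using quasi_statesD(3)[OF \<psi>] by (fastforce simp: positive_functionalD[OF pos])
    also have "\<dots> \<le> C * 1" using C quasi_state_idempotent[OF \<psi> e(1,2)] by (intro mult_left_mono)
    finally show "(cmod (\<psi> a))\<^sup>2 \<le> C" using quasi_statesD(2)[OF \<psi>, of a] by simp
  qed
  then show ?thesis by blast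
qed

section \<open>Compactness and convexity of the set of quasi-states\<close>

lemma closed_positive_functionals: "closed {\<psi>. positive_functional \<psi>}"
  unfolding positive_functional_def
  by (intro closed_Collect_conj closed_Collect_all closed_Collect_eq closed_Collect_le
      continuous_on_add continuous_on_mult continuous_on_cnj continuous_on_Re continuous_on_const
      continuous_on_coord)

lemma closed_quasi_states: "closed (quasi_states V)"
proof -
  have "quasi_states V = {\<psi>. positive_functional \<psi>}
      \<inter> {\<psi>. \<forall>a. (cmod (\<psi> a))\<^sup>2 \<le> Re (\<psi> (star a * a))} \<inter> (\<Inter>b\<in>nonneg_cone V. {\<psi>. 0 \<le> Re (\<psi> b)})"
    by (auto simp: quasi_states_def)
  also have "closed \<dots>"
    by (intro closed_Int closed_positive_functionals closed_INT ballI closed_Collect_all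
        closed_Collect_le continuous_on_power continuous_on_norm continuous_on_Re
        continuous_on_const continuous_on_coord)
  finally show ?thesis .
qed

lemma compact_quasi_states:
  fixes V :: "('a::idempotented_star_algebra, 'v::complex_vector) representation"
  assumes "unitary_rep V"
  shows "compact (quasi_states V)"
proof -
  obtain C where "\<And>a \<psi>. \<psi> \<in> quasi_states V \<Longrightarrow> cmod (\<psi> a) \<le> C a"
    using quasi_states_bounded[OF assms] by metis
  then show ?thesis by (intro compact_coordwise_bounded[OF closed_quasi_states])
qed

lemma positive_functional_mix:
  assumes "positive_functional \<psi>" "positive_functional \<rho>" "t \<in> {0..1}"
  shows "positive_functional (mix t \<psi> \<rho>)"
  unfolding positive_functional_def
proof (intro conjI allI)
  note D = positive_functionalD[OF assms(1)] positive_functionalD[OF assms(2)]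
  fix a b c
  show "mix t \<psi> \<rho> (a + b) = mix t \<psi> \<rho> a + mix t \<psi> \<rho> b"
    "mix t \<psi> \<rho> (c *\<^sub>C a) = c * mix t \<psi> \<rho> a" "mix t \<psi> \<rho> (star a) = cnj (mix t \<psi> \<rho> a)"
    unfolding mix_def by (simp_all add: D algebra_simps)
  show "0 \<le> Re (mix t \<psi> \<rho> (star a * a))"
    using D(4,10) assms(3) by (simp add: mix_def del: of_real_diff)
qed

lemma mix_convex_quasi_states: "mix_convex (quasi_states V)"
  unfolding mix_convex_def
proof (intro ballI)
  fix \<psi> \<rho> t assume \<psi>: "\<psi> \<in> quasi_states V" and \<rho>: "\<rho> \<in> quasi_states V" and t: "t \<in> {0..1::real}"
  have Re_mix: "Re (mix t \<psi> \<rho> a) = t * Re (\<psi> a) + (1 - t) * Re (\<rho> a)" for a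
    by (simp add: mix_def del: of_real_diff)
  show "mix t \<psi> \<rho> \<in> quasi_states V"
    unfolding quasi_states_def
  proof (intro CollectI conjI allI ballI)
    show "positive_functional (mix t \<psi> \<rho>)"
      using quasi_statesD(1)[OF \<psi>] quasi_statesD(1)[OF \<rho>] t by (rule positive_functional_mix)
  next
    fix a
    define x y where "x = cmod (\<psi> a)" and "y = cmod (\<rho> a)"
    have "cmod (mix t \<psi> \<rho> a) \<le> t * x + (1 - t) * y"
      using norm_triangle_ineq[of "of_real t * \<psi> a" "of_real (1 - t) * \<rho> a"] t
      by (simp add: mix_def x_def y_def norm_mult del: of_real_diff)
    then have "(cmod (mix t \<psi> \<rho> a))\<^sup>2 \<le> (t * x + (1 - t) * y)\<^sup>2" by (intro power_mono) auto
    \<comment> \<open>The square is convex, and its defect of linearity is the variance t (1 - t) (x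
      - y)^2.\<close>
    also have "\<dots> = t * x\<^sup>2 + (1 - t) * y\<^sup>2 - t * (1 - t) * (x - y)\<^sup>2"
      by (simp add: power2_eq_square algebra_simps)
    also have "\<dots> \<le> t * x\<^sup>2 + (1 - t) * y\<^sup>2" using t by simp
    also have "\<dots> \<le> t * Re (\<psi> (star a * a)) + (1 - t) * Re (\<rho> (star a * a))"
      using quasi_statesD(2)[OF \<psi>, of a] quasi_statesD(2)[OF \<rho>, of a] t
      by (intro add_mono mult_left_mono) (auto simp: x_def y_def)
    finally show "(cmod (mix t \<psi> \<rho> a))\<^sup>2 \<le> Re (mix t \<psi> \<rho> (star a * a))" by (simp only: Re_mix)
  next
    fix b assume "b \<in> nonneg_cone V"
    then show "0 \<le> Re (mix t \<psi> \<rho> b)"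
      using quasi_statesD(3)[OF \<psi>] quasi_statesD(3)[OF \<rho>] t by (simp add: Re_mix)
  qed
qed

lemma quasi_states_mono: "nonneg_cone U \<subseteq> nonneg_cone V \<Longrightarrow> quasi_states V \<subseteq> quasi_states U"
  by (auto simp: quasi_states_def)

section \<open>The GNS construction\<close>

text \<open>On a general star-algebra a positive functional need not make left multiplications
  bounded, so this is an assumption; for quasi-states \<open>nonneg_cone_bounded\<close> supplies
  it.\<close>

locale gns_functional =
  fixes \<psi> :: "'a::idempotented_star_algebra \<Rightarrow> complex"
  assumes positive: "positive_functional \<psi>"
    and square_le: "(cmod (\<psi> a))\<^sup>2 \<le> Re (\<psi> (star a * a))"
    and bounded: "\<exists>C\<ge>0. \<forall>b. Re (\<psi> (star (a * b) * (a * b))) \<le> C * Re (\<psi> (star b * b))"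
begin

sublocale semidefinite_form "\<lambda>x y. \<psi> (star y * x)"
  by (rule positive_functional_semidefinite_form[OF positive])

text \<open>A vector \<open>f\<close> is stored as its inner products with the classes of all
  \<open>b\<close>. The inner product of \<open>af\<close> with the class of \<open>b\<close> must
  be that of \<open>f\<close> with the class of \<open>star a * b\<close>, which dictates the
  action.\<close>

definition gns :: "'a small_rep" where
  "gns = \<lparr>hcarrier = hcarrier completion, hinner = hinner completion,
     action = (\<lambda>a f b. f (star a * b))\<rparr>"

abbreviation gns_vector :: "'a \<Rightarrow> 'a \<Rightarrow> complex" where
  "gns_vector c \<equiv> \<lambda>b. \<psi> (star b * c)"

lemma gns_simps: "hcarrier gns = hcarrier completion" "hinner gns = hinner completion"
  "hnorm gns = hnorm completion" "action gns a f = (\<lambda>b. f (star a * b))"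
  by (simp_all add: gns_def hnorm_def fun_eq_iff)

lemma action_gns_vector: "action gns a (gns_vector c) = gns_vector (a * c)"
  by (simp add: gns_simps star_mult star_star mult.assoc)

lemma seminorm_mult_bounded: "\<exists>C. \<forall>b. seminorm (a * b) \<le> C * seminorm b"
proof -
  obtain C where "C \<ge> 0" "\<And>b. Re (\<psi> (star (a * b) * (a * b))) \<le> C * Re (\<psi> (star b * b))"
    using bounded by blast
  then have "\<forall>b. seminorm (a * b) \<le> sqrt C * seminorm b"
    by (simp add: seminorm_def real_sqrt_mult[symmetric])
  then show ?thesis by blast
qed

lemma approximates_action:
  assumes "approximates s f" shows "approximates (\<lambda>n. a * s n) (action gns a f)"
  unfolding approximates_def
proof (intro conjI allI)
  obtain C where C: "\<And>b. seminorm (a * b) \<le> C * seminorm b" using seminorm_mult_bounded by blast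
  have "seminorm_Cauchy s" using assms by (simp add: approximates_def)
  then show "seminorm_Cauchy (\<lambda>n. a * s n)"
    by (rule seminorm_Cauchy_map[where g = "\<lambda>b. a * b" and C = C])
      (simp add: C right_diff_distrib[symmetric])
  fix b
  have "(\<lambda>n. \<psi> (star (star a * b) * s n)) \<longlonglongrightarrow> f (star a * b)"
    using assms by (simp add: approximates_def)
  then show "(\<lambda>n. \<psi> (star b * (a * s n))) \<longlonglongrightarrow> action gns a f b"
    by (simp add: gns_simps star_mult star_star mult.assoc)
qed

text \<open>The argument of \<open>f\<close> sits in the second slot of the inner product. Together
  with the \<open>star\<close> in the action, this makes the action linear in the algebra
  element.\<close>

lemma gns_antilinear:
  assumes "f \<in> hcarrier gns"
  shows "f (x + y) = f x + f y" "f (c *\<^sub>C x) = cnj c * f x"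
proof -
  obtain s where s: "\<And>b. (\<lambda>n. \<psi> (star b * s n)) \<longlonglongrightarrow> f b"
    using assms approximatesE unfolding gns_simps approximates_def by metis
  have "(\<lambda>n. \<psi> (star (x + y) * s n)) \<longlonglongrightarrow> f x + f y"
    using tendsto_add[OF s s] by (simp add: form_add_right)
  then show "f (x + y) = f x + f y" using s LIMSEQ_unique by blast
  have "(\<lambda>n. \<psi> (star (c *\<^sub>C x) * s n)) \<longlonglongrightarrow> cnj c * f x"
    unfolding form_scaleC_right by (intro tendsto_mult tendsto_const s)
  then show "f (c *\<^sub>C x) = cnj c * f x" using s LIMSEQ_unique by blast
qed

lemma unitary_rep_gns: "unitary_rep gns"
proof -
  have "hilbert_space gns"
    using hilbert_space_completion unfolding hilbert_space_def gns_simps .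
  then interpret G: hilbert_space gns .
  show ?thesis
  proof
    fix a f assume "f \<in> hcarrier gns"
    then obtain s where "approximates s f" using approximatesE unfolding gns_simps by metis
    then show "action gns a f \<in> hcarrier gns"
      unfolding gns_simps(1) by (rule approximates_closed[OF approximates_action])
  next
    fix a f g assume "f \<in> hcarrier gns" "g \<in> hcarrier gns"
    show "action gns a (f + g) = action gns a f + action gns a g"
      by (simp add: gns_simps fun_eq_iff)
  next
    fix a f c assume "f \<in> hcarrier gns"
    show "action gns a (c *\<^sub>C f) = c *\<^sub>C action gns a f"
      by (simp add: gns_simps fun_eq_iff scaleC_fun_def)
  next
    fix a b f assume "f \<in> hcarrier gns"
    then show "action gns (a + b) f = action gns a f + action gns b f"
      by (simp add: gns_simps(4) fun_eq_iff star_add distrib_right gns_antilinear)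
  next
    fix a f c assume "f \<in> hcarrier gns"
    then show "action gns (c *\<^sub>C a) f = c *\<^sub>C action gns a f"
      by (simp add: gns_simps(4) fun_eq_iff star_scaleC mult_scaleC_left gns_antilinear
          scaleC_fun_def scaleC_complex_def)
  next
    fix a b f assume "f \<in> hcarrier gns"
    show "action gns (a * b) f = action gns a (action gns b f)"
      by (simp add: gns_simps(4) fun_eq_iff star_mult mult.assoc)
  next
    fix a
    obtain C where C: "\<And>b. seminorm (a * b) \<le> C * seminorm b" using seminorm_mult_bounded by blast
    have "hnorm gns (action gns a f) \<le> C * hnorm gns f" if f: "f \<in> hcarrier gns" for f
    proof -
      obtain s where s: "approximates s f" using f approximatesE unfolding gns_simps by metis
      show ?thesis
        unfolding gns_simps(3)
        by (rule LIMSEQ_le[OF approximates_hnorm[OF approximates_action[OF s]]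
              tendsto_mult[OF tendsto_const approximates_hnorm[OF s]]]) (use C in simp)
    qed
    then show "\<exists>C. \<forall>f\<in>hcarrier gns. hnorm gns (action gns a f) \<le> C * hnorm gns f" by blast
  next
    fix a f g assume "f \<in> hcarrier gns" "g \<in> hcarrier gns"
    then obtain s t where st: "approximates s f" "approximates t g"
      using approximatesE unfolding gns_simps by metis
    have "(\<lambda>n. \<psi> (star (t n) * (a * s n))) \<longlonglongrightarrow> hinner completion f (action gns (star a) g)"
      using approximates_inner[OF st(1) approximates_action[OF st(2), of "star a"]]
      by (simp add: star_mult star_star mult.assoc)
    then show "hinner gns (action gns a f) g = hinner gns f (action gns (star a) g)"
      unfolding gns_simps(2)
      using approximates_inner[OF approximates_action[OF st(1), of a] st(2)] LIMSEQ_unique by blast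
  next
    fix f and \<epsilon> :: real assume f: "f \<in> hcarrier gns" and \<epsilon>: "\<epsilon> > 0"
    obtain c where c: "hnorm completion (f - gns_vector c) < \<epsilon>"
      using completion_dense f \<epsilon> unfolding gns_simps by blast
    obtain e where e: "e * e = e" "e * c * e = c" using idempotented[of "{c}"] by auto
    have "hnorm gns (f - action gns e (gns_vector c)) < \<epsilon>"
      unfolding action_gns_vector idempotent_absorb(1)[OF e] gns_simps(3) by (rule c)
    then show "\<exists>a. \<exists>w\<in>hcarrier gns. hnorm gns (f - action gns a w) < \<epsilon>"
      using form_closed[of c] unfolding gns_simps(1) by blast
  qed
qed

text \<open>Without a unit, \<xi> cannot be taken as the class of 1. Instead it represents the
  functional sending the class of \<open>a\<close> to \<open>\<psi> a\<close>, which is well defined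
  and of norm at most 1 because of \<open>square_le\<close>.\<close>

lemma gns_cyclic_vector:
  obtains \<xi> where "\<xi> \<in> hcarrier gns" "hnorm gns \<xi> \<le> 1" "\<And>a. action gns a \<xi> = gns_vector a"
    "vector_functional gns \<xi> = \<psi>"
proof -
  interpret G: unitary_rep gns by (rule unitary_rep_gns)
  define E where "E = range gns_vector"
  \<comment> \<open>The choice of a representative \<open>a\<close> is immaterial:
    \<open>\<psi>\<close> vanishes on null vectors, as it is bounded by the seminorm.\<close>
  define f where "f x = \<psi> (SOME a. gns_vector a = x)" for x
  note D = positive_functionalD[OF positive]
  have gv: "gns_vector a \<in> hcarrier gns" for a using form_closed[of a] by (simp only: gns_simps)
  have norm_gv: "hnorm gns (gns_vector a) = seminorm a" for a
    unfolding gns_simps(3) by (rule completion_hnorm_form)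
  have le: "cmod (\<psi> a) \<le> seminorm a" for a
    unfolding seminorm_def by (rule real_le_rsqrt[OF square_le])
  have f: "f (gns_vector a) = \<psi> a" for a
  proof -
    define a' where "a' = (SOME a'. gns_vector a' = gns_vector a)"
    have a': "gns_vector a' = gns_vector a" unfolding a'_def by (rule someI) (rule refl)
    have "gns_vector (a' - a) = 0" using form_diff[of a' a] a' by simp
    then have "seminorm (a' - a) = 0" using norm_gv[of "a' - a"] G.hnorm_zero by simp
    then have "\<psi> a' = \<psi> a" using le[of "a' - a"] by (simp add: D)
    then show ?thesis by (simp add: f_def a'_def)
  qed
  have gv_add: "gns_vector a + gns_vector b = gns_vector (a + b)"
    and gv_scaleC: "c *\<^sub>C gns_vector a = gns_vector (c *\<^sub>C a)"
    and gv_0: "gns_vector 0 = 0" for a b c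
    by (simp_all add: fun_eq_iff form_add_left form_scaleC_left scaleC_fun_def
        scaleC_complex_def D(6))
  have "E \<subseteq> hcarrier gns" using gv by (auto simp: E_def)
  moreover have "is_subspace E"
    unfolding is_subspace_def E_def using gv_0 by (auto simp: gv_add gv_scaleC intro: range_eqI[of _ _ 0])
  moreover have "f (x + y) = f x + f y" if xy: "x \<in> E" "y \<in> E" for x y
  proof -
    obtain a b where "x = gns_vector a" "y = gns_vector b" using xy by (auto simp: E_def)
    then show ?thesis by (simp only: gv_add f D)
  qed
  moreover have "f (c *\<^sub>C x) = c * f x" if x: "x \<in> E" for x c
  proof -
    obtain a where "x = gns_vector a" using x by (auto simp: E_def)
    then show ?thesis by (simp only: gv_scaleC f D)
  qed
  moreover have "cmod (f x) \<le> 1 * hnorm gns x" if x: "x \<in> E" for x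
  proof -
    obtain a where "x = gns_vector a" using x by (auto simp: E_def)
    then show ?thesis using le[of a] by (simp only: f norm_gv)
  qed
  ultimately obtain \<xi> X where \<xi>: "\<xi> \<in> hcarrier gns" and X: "\<And>n::nat. X n \<in> E"
    "(\<lambda>n. hnorm gns (X n - \<xi>)) \<longlonglongrightarrow> 0" and Riesz: "\<And>x. x \<in> E \<Longrightarrow> f x = hinner gns x \<xi>"
    by (rule G.Riesz_on_subspace) (blast intro: that)+
  have inner: "hinner gns (gns_vector a) \<xi> = \<psi> a" for a
    using Riesz[of "gns_vector a"] f by (simp add: E_def)
  have act: "action gns a \<xi> = gns_vector a" for a
  proof
    fix b
    have "action gns a \<xi> b = hinner gns \<xi> (gns_vector (star a * b))"
      using \<xi> unfolding gns_simps by (simp add: completion_inner_form)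
    also have "\<dots> = cnj (\<psi> (star a * b))" by (subst G.inner_cnj[OF gv \<xi>]) (simp only: inner)
    also have "\<dots> = \<psi> (star b * a)" by (simp add: D(3)[symmetric] star_mult star_star)
    finally show "action gns a \<xi> b = gns_vector a b" .
  qed
  have "hnorm gns \<xi> \<le> 1"
  proof -
    have XG: "X n \<in> hcarrier gns" for n using X(1)[of n] gv by (auto simp: E_def)
    have lim: "(\<lambda>n. cmod (hinner gns (X n) \<xi>)) \<longlonglongrightarrow> cmod (hinner gns \<xi> \<xi>)"
      by (intro tendsto_norm G.tendsto_inner_left \<xi> XG X)
    \<comment> \<open>Pairing with \<xi> has norm at most 1 on \<open>E\<close>, and \<xi> is a
      limit of points of \<open>E\<close>. Hence |\<xi>|^2 \<le> |\<xi>|.\<close>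
    have "cmod (hinner gns (X n) \<xi>) \<le> hnorm gns \<xi> + hnorm gns (X n - \<xi>)" for n
    proof -
      obtain a where "X n = gns_vector a" using X(1)[of n] by (auto simp: E_def)
      then have "cmod (hinner gns (X n) \<xi>) \<le> hnorm gns (X n)" using le[of a] by (simp only: inner norm_gv)
      then show ?thesis
        using G.hnorm_triangle[of \<xi> "X n - \<xi>"] \<xi> XG[of n] G.diff_closed by simp
    qed
    moreover have "(\<lambda>n. hnorm gns \<xi> + hnorm gns (X n - \<xi>)) \<longlonglongrightarrow> hnorm gns \<xi> + 0"
      by (intro tendsto_add tendsto_const X)
    ultimately have "cmod (hinner gns \<xi> \<xi>) \<le> hnorm gns \<xi> + 0"
      using LIMSEQ_le[OF lim] by blast
    then have "(hnorm gns \<xi>)\<^sup>2 \<le> hnorm gns \<xi>" by (simp add: G.inner_self[OF \<xi>] norm_power)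
    then show ?thesis
      using G.hnorm_nonneg[OF \<xi>] by (cases "hnorm gns \<xi> = 0") (auto simp: power2_eq_square)
  qed
  moreover have "vector_functional gns \<xi> = \<psi>"
    by (simp add: fun_eq_iff vector_functional_def act inner)
  ultimately show ?thesis using that \<xi> act by blast
qed

end

definition cyclic_vector :: "('a, 'v::complex_vector) representation \<Rightarrow> 'v \<Rightarrow> bool" where
  "cyclic_vector V v \<longleftrightarrow> v \<in> hcarrier V
     \<and> (\<forall>w\<in>hcarrier V. \<forall>\<epsilon>>0. \<exists>a. hnorm V (w - action V a v) < \<epsilon>)"

text \<open>The inclusion of cones is what later makes the new representation weakly contained in
  \<open>V\<close>. On the dense orbit of \<xi> it is nonnegativity of \<psi> at
  \<open>star c * b * c\<close>; continuity extends it to all vectors.\<close>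

lemma gns_exists:
  fixes V :: "('a::idempotented_star_algebra, 'v::complex_vector) representation"
  assumes "unitary_rep V" and \<psi>: "\<psi> \<in> quasi_states V"
  obtains U :: "'a small_rep" and \<xi> where "unitary_rep U" "cyclic_vector U \<xi>" "hnorm U \<xi> \<le> 1"
    "vector_functional U \<xi> = \<psi>" "nonneg_cone V \<subseteq> nonneg_cone U"
proof -
  interpret V: unitary_rep V by fact
  note pos = quasi_statesD(1)[OF \<psi>]
  interpret gns_functional \<psi>
  proof
    show "positive_functional \<psi>" by (rule pos)
    show "(cmod (\<psi> a))\<^sup>2 \<le> Re (\<psi> (star a * a))" for a by (rule quasi_statesD(2)[OF \<psi>])
    fix a
    obtain C where C: "C \<ge> 0" "\<And>c. of_real C *\<^sub>C (star c * c) - star (a * c) * (a * c) \<in> nonneg_cone V"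
      using V.nonneg_cone_bounded[of a] by blast
    have "Re (\<psi> (star (a * c) * (a * c))) \<le> C * Re (\<psi> (star c * c))" for c
      using quasi_statesD(3)[OF \<psi> C(2)[of c]] by (simp add: positive_functionalD[OF pos])
    then show "\<exists>C\<ge>0. \<forall>b. Re (\<psi> (star (a * b) * (a * b))) \<le> C * Re (\<psi> (star b * b))"
      using C(1) by blast
  qed
  obtain \<xi> where \<xi>: "\<xi> \<in> hcarrier gns" "hnorm gns \<xi> \<le> 1" "\<And>a. action gns a \<xi> = gns_vector a"
    "vector_functional gns \<xi> = \<psi>"
    by (rule gns_cyclic_vector) (rule that)
  interpret G: unitary_rep gns by (rule unitary_rep_gns)
  have dense: "\<exists>a. hnorm gns (w - action gns a \<xi>) < \<epsilon>" if "w \<in> hcarrier gns" "\<epsilon> > 0" for w \<epsilon>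
    using completion_dense that unfolding \<xi>(3) gns_simps(1,3) by blast
  have "b \<in> nonneg_cone gns" if b: "b \<in> nonneg_cone V" for b
    unfolding nonneg_cone_def
  proof (intro CollectI ballI)
    fix w assume w: "w \<in> hcarrier gns"
    obtain s where s: "(\<lambda>n. hnorm gns (action gns (s n) \<xi> - w)) \<longlonglongrightarrow> 0"
      using G.limit_sequence[of w "\<lambda>a. action gns a \<xi>"] dense w G.action_closed \<xi>(1) by blast
    have lim: "(\<lambda>n. Re (vector_functional gns (action gns (s n) \<xi>) b)) \<longlonglongrightarrow> Re (vector_functional gns w b)"
      by (intro tendsto_Re G.tendsto_vector_functional w G.action_closed \<xi> s)
    show "0 \<le> Re (vector_functional gns w b)"
    proof (rule LIMSEQ_le_const[OF lim], intro exI allI impI)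
      fix n
      show "0 \<le> Re (vector_functional gns (action gns (s n) \<xi>) b)"
        unfolding G.vector_functional_action[OF \<xi>(1)] \<xi>(4)
        by (intro quasi_statesD(3)[OF \<psi>] V.nonneg_cone_conjugate b)
    qed
  qed
  then show ?thesis
    using that[of gns \<xi>] unitary_rep_gns \<xi> dense unfolding cyclic_vector_def by blast
qed

section \<open>Pure functionals and irreducible representations\<close>

lemma (in unitary_rep) closed_submodule_cyclic:
  assumes W: "closed_submodule V W" and "cyclic_vector V \<xi>" "\<xi> \<in> W"
  shows "W = hcarrier V"
proof
  show "W \<subseteq> hcarrier V" using W by (simp add: closed_submodule_def)
  show "hcarrier V \<subseteq> W"
  proof
    fix w assume w: "w \<in> hcarrier V"
    obtain s where "(\<lambda>n. hnorm V (action V (s n) \<xi> - w)) \<longlonglongrightarrow> 0"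
      using limit_sequence[of w "\<lambda>a. action V a \<xi>"] assms(2) w action_closed
      unfolding cyclic_vector_def by blast
    then show "w \<in> W" using W assms(3) w unfolding closed_submodule_def by meson
  qed
qed

text \<open>If \<open>W\<close> is a closed submodule and \<open>\<eta>\<close> the projection of \<open>\<xi>\<close> to \<open>W\<close>, then the functional of \<open>\<xi>\<close>
  is the sum of those of \<open>\<eta>\<close> and \<open>\<xi> - \<eta>\<close>; by extremality these are proportional.\<close>

lemma irreducible_if_extreme:
  fixes U :: "('a::star_algebra, 'u::complex_vector) representation"
    and V :: "('a, 'v::complex_vector) representation"
  assumes "unitary_rep U" and cyc: "cyclic_vector U \<xi>" and norm: "hnorm U \<xi> \<le> 1"
    and cone: "nonneg_cone V \<subseteq> nonneg_cone U" and "\<xi> \<noteq> 0"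
    and ext: "mix_extreme (vector_functional U \<xi>) (quasi_states V)"
  shows "irreducible_unitary_rep U"
proof -
  interpret unitary_rep U by fact
  have \<xi>: "\<xi> \<in> hcarrier U" using cyc by (simp add: cyclic_vector_def)
  have "W = {0} \<or> W = hcarrier U" if W: "closed_submodule U W" for W
  proof -
    have WU: "W \<subseteq> hcarrier U" and Wsub: "is_subspace W" and Wact: "\<And>a w. w \<in> W \<Longrightarrow> action U a w \<in> W"
      and Wcl: "\<And>X x. x \<in> hcarrier U \<Longrightarrow> (\<And>n::nat. X n \<in> W) \<Longrightarrow> (\<lambda>n. hnorm U (X n - x)) \<longlonglongrightarrow> 0 \<Longrightarrow> x \<in> W"
      using W unfolding closed_submodule_def by blast+
    obtain \<eta> X where "\<eta> \<in> hcarrier U" "\<And>n::nat. X n \<in> W" "(\<lambda>n. hnorm U (X n - \<eta>)) \<longlonglongrightarrow> 0"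
      and proj: "\<And>w. w \<in> W \<Longrightarrow> hinner U w \<xi> = hinner U w \<eta>"
    proof (rule Riesz_on_subspace[OF WU Wsub, of "\<lambda>w. hinner U w \<xi>" "hnorm U \<xi>"])
      show "hinner U (x + y) \<xi> = hinner U x \<xi> + hinner U y \<xi>" if "x \<in> W" "y \<in> W" for x y
        using that WU \<xi> by (intro inner_add_left) auto
      show "hinner U (c *\<^sub>C x) \<xi> = c * hinner U x \<xi>" if "x \<in> W" for c x
        using that WU \<xi> by (intro inner_scaleC_left) auto
      show "cmod (hinner U x \<xi>) \<le> hnorm U \<xi> * hnorm U x" if "x \<in> W" for x
        using Cauchy_Schwarz[of x \<xi>] that WU \<xi> by (auto simp: mult.commute)
    qed blast
    then have \<eta>W: "\<eta> \<in> W" using Wcl by blast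
    then have \<eta>: "\<eta> \<in> hcarrier U" using WU by auto
    define \<zeta> where "\<zeta> = \<xi> - \<eta>"
    have \<zeta>: "\<zeta> \<in> hcarrier U" using \<xi> \<eta> by (simp add: \<zeta>_def diff_closed)
    have orth: "hinner U w \<zeta> = 0" if "w \<in> W" for w
      using proj[OF that] that WU \<xi> \<eta> by (auto simp: \<zeta>_def inner_diff_right)
    have orth': "hinner U (action U a \<zeta>) \<eta> = 0" for a
      using orth[OF Wact[OF \<eta>W, of "star a"]] inner_cnj[of "action U (star a) \<eta>" \<zeta>] \<zeta> \<eta>
      by (simp add: action_star action_closed)
    define m s where "m = (hnorm U \<xi>)\<^sup>2" and "s = (hnorm U \<eta>)\<^sup>2"
    have m: "m \<le> 1" using norm hnorm_nonneg[OF \<xi>] by (simp add: m_def power_le_one)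
    have ms: "(hnorm U \<zeta>)\<^sup>2 = m - s"
      using hnorm_power2_diff[OF \<xi> \<eta>] proj[OF \<eta>W] Re_inner_commute[OF \<xi> \<eta>] hnorm_power2[OF \<eta>]
      by (simp add: \<zeta>_def m_def s_def)
    have s0: "0 \<le> s" "s \<le> m" using ms by (simp_all add: s_def) (metis diff_ge_0_iff_ge zero_le_power2)
    have split1: "vector_functional U \<eta> a = hinner U (action U a \<eta>) \<xi>" for a
      using proj[OF Wact[OF \<eta>W]] by (simp add: vector_functional_def)
    have split: "vector_functional U \<xi> a = vector_functional U \<eta> a + vector_functional U \<zeta> a" for a
    proof -
      have "action U a \<xi> = action U a \<eta> + action U a \<zeta>"
        using \<eta> \<zeta> action_add_right[of \<eta> \<zeta> a] by (simp add: \<zeta>_def)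
      moreover have "hinner U (action U a \<zeta>) \<xi> = hinner U (action U a \<zeta>) \<zeta>"
        using orth'[of a] \<xi> \<eta> \<zeta> by (simp add: \<zeta>_def inner_diff_right action_closed)
      ultimately show ?thesis
        using split1[of a] \<xi> \<eta> \<zeta> by (simp add: vector_functional_def inner_add_left action_closed)
    qed
    \<comment> \<open>If \<eta> is 0 then \<xi> and its orbit are orthogonal to \<open>W\<close>, so
      \<open>W\<close> is 0; if \<zeta> is 0 then \<open>W\<close> contains the cyclic vector.
      Extremality excludes a proper splitting unless \<eta> is a multiple of \<xi>.\<close>
    consider "s = 0" | "s = m" | "0 < s" "s < m" using s0 by linarith
    then show ?thesis
    proof cases
      case 1
      then have "\<eta> = 0" using hnorm_eq_0_iff[OF \<eta>] by (simp add: s_def)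
      then have zero: "hinner U w \<xi> = 0" if "w \<in> W" for w
        using proj[OF that] inner_zero_right that WU by auto
      have "w = 0" if w: "w \<in> W" for w
      proof (rule eq_0_if_inner_small)
        show wU: "w \<in> hcarrier U" using w WU by auto
        fix \<epsilon> :: real assume "\<epsilon> > 0"
        then obtain a where a: "hnorm U (w - action U a \<xi>) < \<epsilon>"
          using cyc wU unfolding cyclic_vector_def by blast
        have "hinner U w (action U a \<xi>) = 0"
          using zero[OF Wact[OF w]] wU \<xi> by (simp add: inner_action_left)
        then have "hinner U (action U a \<xi>) w = 0"
          using inner_cnj[OF wU action_closed[OF \<xi>]] by simp
        then show "\<exists>y\<in>hcarrier U. hnorm U (w - y) < \<epsilon> \<and> hinner U y w = 0"
          using a action_closed[OF \<xi>] by blast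
      qed
      then show ?thesis using Wsub by (auto simp: is_subspace_def)
    next
      case 2
      then have "\<zeta> = 0" using ms hnorm_eq_0_iff[OF \<zeta>] by simp
      then have "\<xi> \<in> W" using \<eta>W by (simp add: \<zeta>_def)
      then show ?thesis using closed_submodule_cyclic[OF W cyc] by blast
    next
      case 3
      \<comment> \<open>Both parts are rescaled to the norm of \<xi>, which is at most 1, so that
        they give quasi-states. The weights s/m and 1 - s/m then recover the functional of
        \<xi>.\<close>
      define x y where "x = of_real (sqrt (m / s)) *\<^sub>C \<eta>" and "y = of_real (sqrt (m / (m - s))) *\<^sub>C \<zeta>"
      have xy: "x \<in> hcarrier U" "y \<in> hcarrier U" using \<eta> \<zeta> by (simp_all add: x_def y_def scaleC_closed)
      have "(hnorm U x)\<^sup>2 = m" "(hnorm U y)\<^sup>2 = m"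
        using 3 ms \<eta> \<zeta> by (simp_all add: x_def y_def hnorm_scaleC power_mult_distrib s_def[symmetric])
      then have "hnorm U x \<le> 1" "hnorm U y \<le> 1" using m by (auto intro: power2_le_imp_le[of _ 1])
      then have states: "vector_functional U x \<in> quasi_states V" "vector_functional U y \<in> quasi_states V"
        using xy cone by (auto intro!: vector_functional_quasi_state)
      have vx: "vector_functional U x a = of_real (m / s) * vector_functional U \<eta> a" for a
        using 3 \<eta> by (simp add: x_def vector_functional_scaleC)
      have vy: "vector_functional U y a = of_real (m / (m - s)) * vector_functional U \<zeta> a" for a
        using 3 \<zeta> by (simp add: y_def vector_functional_scaleC)
      have "mix (s / m) (vector_functional U x) (vector_functional U y) = vector_functional U \<xi>"
      proof
        fix a
        have "s / m * (m / s) = 1" "(1 - s / m) * (m / (m - s)) = 1" using 3 by (auto simp: field_simps)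
        then have "complex_of_real (s / m) * of_real (m / s) = 1"
          "complex_of_real (1 - s / m) * of_real (m / (m - s)) = 1"
          by (simp_all only: of_real_mult[symmetric] of_real_1)
        then show "mix (s / m) (vector_functional U x) (vector_functional U y) a = vector_functional U \<xi> a"
          unfolding mix_def vx vy split mult.assoc[symmetric] by (simp only: mult_1_left)
      qed
      then have vf_eq: "vector_functional U x = vector_functional U \<xi>"
        using mix_faceD(2)[OF ext states, of "s / m"] 3 by simp
      define t where "t = complex_of_real (s / m)"
      have t: "t \<noteq> 0" using 3 by (simp add: t_def)
      have scaled: "hinner U (action U a \<eta>) \<xi> = t * hinner U (action U a \<xi>) \<xi>" for a
        using fun_cong[OF vf_eq, of a] 3 unfolding vx split1
        by (simp add: t_def vector_functional_def field_simps)
      \<comment> \<open>Equality of the functionals makes the orbit of \<theta> orthogonal to \<xi>,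
        hence to the orbit of \<xi>. Cyclicity gives \<theta> = 0, so \<xi> is a multiple of \<eta>
        and lies in \<open>W\<close>.\<close>
      define \<theta> where "\<theta> = \<eta> - t *\<^sub>C \<xi>"
      have \<theta>: "\<theta> \<in> hcarrier U" using \<eta> \<xi> by (simp add: \<theta>_def diff_closed scaleC_closed)
      have zero: "hinner U (action U a \<theta>) \<xi> = 0" for a
        using scaled[of a] \<eta> \<xi>
        by (simp add: \<theta>_def action_diff_right action_scaleC_right scaleC_closed inner_diff_left
            action_closed inner_scaleC_left)
      have "action U a \<theta> = 0" for a
      proof (rule eq_0_if_inner_small)
        show a\<theta>: "action U a \<theta> \<in> hcarrier U" using \<theta> by (rule action_closed)
        fix \<epsilon> :: real assume "\<epsilon> > 0"
        then obtain b where b: "hnorm U (action U a \<theta> - action U b \<xi>) < \<epsilon>"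
          using cyc a\<theta> unfolding cyclic_vector_def by blast
        have "hinner U (action U b \<xi>) (action U a \<theta>) = cnj (hinner U (action U (star b * a) \<theta>) \<xi>)"
          using inner_cnj[of "action U a \<theta>" "action U b \<xi>"] \<theta> \<xi>
          by (simp add: action_closed inner_action_left action_mult)
        then show "\<exists>y\<in>hcarrier U. hnorm U (action U a \<theta> - y) < \<epsilon> \<and> hinner U y (action U a \<theta>) = 0"
          using b zero action_closed[OF \<xi>] by (metis complex_cnj_zero)
      qed
      then have "\<theta> = 0" using eq_0_if_action_eq_0[OF \<theta>] by blast
      then have "(1 / t) *\<^sub>C \<eta> = \<xi>" using t by (simp add: \<theta>_def scaleC_scaleC scaleC_one)
      moreover have "(1 / t) *\<^sub>C \<eta> \<in> W" using Wsub \<eta>W by (simp add: is_subspace_def)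
      ultimately show ?thesis using closed_submodule_cyclic[OF W cyc] by simp
    qed
  qed
  then show ?thesis
    using assms(1,5) \<xi> unfolding irreducible_unitary_rep_def by blast
qed

section \<open>Orbits in irreducible representations\<close>

context unitary_rep
begin

lemma orbit_subspace:
  assumes v: "v \<in> hcarrier V" shows "is_subspace (range (\<lambda>a. action V a v))"
proof -
  have "action V 0 v = 0" using action_add_left[OF v, of 0 0] by simp
  then show ?thesis
    unfolding is_subspace_def
    using action_add_left[OF v, symmetric] action_scaleC_left[OF v, symmetric]
    by (auto intro: range_eqI[of _ _ 0])
qed

lemma closed_submodule_orthogonal:
  assumes z: "z \<in> hcarrier V"
  shows "closed_submodule V {w \<in> hcarrier V. \<forall>a. hinner V w (action V a z) = 0}"
  unfolding closed_submodule_def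
proof (intro conjI allI ballI impI)
  show "is_subspace {w \<in> hcarrier V. \<forall>a. hinner V w (action V a z) = 0}"
    using z by (auto simp: is_subspace_def zero_closed add_closed scaleC_closed action_closed
        inner_zero_left inner_add_left inner_scaleC_left)
  show "action V b w \<in> {w \<in> hcarrier V. \<forall>a. hinner V w (action V a z) = 0}"
    if "w \<in> {w \<in> hcarrier V. \<forall>a. hinner V w (action V a z) = 0}" for b w
    using z that by (auto simp: action_closed action_star action_mult[symmetric])
next
  fix X x assume "x \<in> hcarrier V" "(\<lambda>n. hnorm V (X n - x)) \<longlonglongrightarrow> 0"
    "\<forall>n::nat. X n \<in> {w \<in> hcarrier V. \<forall>a. hinner V w (action V a z) = 0}"
  then show "x \<in> {w \<in> hcarrier V. \<forall>a. hinner V w (action V a z) = 0}"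
    using z inner_eq_0_limit[of x _ X] by (auto simp: action_closed)
qed auto

text \<open>The orthogonal complement of the orbit of \<open>z\<close> is a closed submodule. If it
  is everything, each \<open>az\<close> is orthogonal to itself, and then \<open>z\<close> is killed
  by the algebra.\<close>

lemma irreducible_orthogonal:
  assumes irr: "irreducible_unitary_rep V" and z: "z \<in> hcarrier V"
    and w: "w \<in> hcarrier V" "\<And>a. hinner V w (action V a z) = 0"
  shows "w = 0 \<or> z = 0"
proof -
  define W where "W = {w \<in> hcarrier V. \<forall>a. hinner V w (action V a z) = 0}"
  have "closed_submodule V W" unfolding W_def by (rule closed_submodule_orthogonal[OF z])
  then consider "W = {0}" | "W = hcarrier V" using irr by (auto simp: irreducible_unitary_rep_def)
  then show ?thesis
  proof cases
    case 1
    then show ?thesis using w by (auto simp: W_def)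
  next
    case 2
    have "action V a z = 0" for a
    proof -
      have az: "action V a z \<in> hcarrier V" using z by (rule action_closed)
      then have "hinner V (action V a z) (action V a z) = 0" using 2 by (auto simp: W_def)
      then show ?thesis using hnorm_eq_0_iff[OF az] by (simp add: hnorm_def)
    qed
    then show ?thesis using eq_0_if_action_eq_0[OF z] by blast
  qed
qed

text \<open>The difference of \<open>w\<close> and its projection to the closure of the orbit is
  orthogonal to the orbit, so it vanishes by irreducibility.\<close>

lemma irreducible_cyclic:
  assumes irr: "irreducible_unitary_rep V" and v: "v \<in> hcarrier V" "v \<noteq> 0"
  shows "cyclic_vector V v"
  unfolding cyclic_vector_def
proof (intro conjI ballI allI impI v(1))
  fix w and \<epsilon> :: real assume w: "w \<in> hcarrier V" and \<epsilon>: "\<epsilon> > 0"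
  have sub: "range (\<lambda>a. action V a v) \<subseteq> hcarrier V" using v(1) action_closed by auto
  obtain \<eta> X where \<eta>: "\<eta> \<in> hcarrier V" and X: "\<And>n::nat. X n \<in> range (\<lambda>a. action V a v)"
    "(\<lambda>n. hnorm V (X n - \<eta>)) \<longlonglongrightarrow> 0"
    and proj: "\<And>x. x \<in> range (\<lambda>a. action V a v) \<Longrightarrow> hinner V x w = hinner V x \<eta>"
  proof (rule Riesz_on_subspace[OF sub orbit_subspace[OF v(1)], of "\<lambda>x. hinner V x w" "hnorm V w"])
    show "hinner V (x + y) w = hinner V x w + hinner V y w"
      if "x \<in> range (\<lambda>a. action V a v)" "y \<in> range (\<lambda>a. action V a v)" for x y
      using that sub w by (intro inner_add_left) auto
    show "hinner V (c *\<^sub>C x) w = c * hinner V x w" if "x \<in> range (\<lambda>a. action V a v)" for c x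
      using that sub w by (intro inner_scaleC_left) auto
    show "cmod (hinner V x w) \<le> hnorm V w * hnorm V x" if "x \<in> range (\<lambda>a. action V a v)" for x
      using Cauchy_Schwarz[of x w] that sub w by (auto simp: mult.commute)
  qed blast
  have z: "w - \<eta> \<in> hcarrier V" using w \<eta> by (rule diff_closed)
  have "hinner V (w - \<eta>) (action V a v) = 0" for a
  proof -
    have "hinner V (action V a v) (w - \<eta>) = 0"
      using proj[of "action V a v"] v w \<eta> by (simp add: inner_diff_right action_closed)
    then show ?thesis using inner_cnj[OF action_closed[OF v(1)] z, of a] by simp
  qed
  then have "w = \<eta>" using irreducible_orthogonal[OF irr v(1) z] v(2) by simp
  obtain n where n: "hnorm V (X n - \<eta>) < \<epsilon>" using LIMSEQ_D[OF X(2) \<epsilon>] by (auto simp: abs_less_iff)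
  obtain a where a: "X n = action V a v" using X(1)[of n] by auto
  show "\<exists>a. hnorm V (w - action V a v) < \<epsilon>"
    using n hnorm_minus_commute[OF \<eta> action_closed[OF v(1)], of a] \<open>w = \<eta>\<close> a
    by (intro exI[of _ a]) simp
qed

lemma exists_unit_vector:
  assumes "irreducible_unitary_rep V" obtains v where "v \<in> hcarrier V" "hnorm V v = 1"
proof -
  obtain w where w: "w \<in> hcarrier V" "w \<noteq> 0"
    using assms zero_closed by (auto simp: irreducible_unitary_rep_def)
  then have pos: "hnorm V w > 0" using hnorm_nonneg[of w] hnorm_eq_0_iff[of w] by simp
  show ?thesis
    by (rule that[of "of_real (1 / hnorm V w) *\<^sub>C w"]) (use w pos in \<open>simp_all add: scaleC_closed hnorm_scaleC norm_divide\<close>)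
qed

lemma nonneg_coneI_unit:
  assumes "\<And>v. v \<in> hcarrier V \<Longrightarrow> hnorm V v = 1 \<Longrightarrow> 0 \<le> Re (vector_functional V v b)"
  shows "b \<in> nonneg_cone V"
  unfolding nonneg_cone_def
proof (intro CollectI ballI)
  fix w assume w: "w \<in> hcarrier V"
  show "0 \<le> Re (vector_functional V w b)"
  proof (cases "w = 0")
    case True
    then show ?thesis
      using zero_closed by (simp add: vector_functional_def inner_zero_right action_closed)
  next
    case False
    then have pos: "hnorm V w > 0" using w hnorm_nonneg[of w] hnorm_eq_0_iff[of w] by simp
    define v where "v = of_real (1 / hnorm V w) *\<^sub>C w"
    have v: "v \<in> hcarrier V" "hnorm V v = 1"
      using w pos by (simp_all add: v_def scaleC_closed hnorm_scaleC norm_divide)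
    have "w = of_real (hnorm V w) *\<^sub>C v" using pos by (simp add: v_def scaleC_scaleC scaleC_one)
    then have "vector_functional V w b = of_real ((hnorm V w)\<^sup>2) * vector_functional V v b"
      using vector_functional_scaleC[OF v(1), of "of_real (hnorm V w)" b] by simp
    then show ?thesis using assms[OF v] by (simp del: of_real_power)
  qed
qed

end

text \<open>The value at \<open>e\<close> is |ev|^2, and \<open>ev\<close> tends to the unit vector
  \<open>v\<close>. The distance \<delta>/2 suffices because 1 - s^2 \<le> 2 (1 - s).\<close>

lemma idempotent_near_one:
  fixes V :: "('a::idempotented_star_algebra, 'v::complex_vector) representation"
  assumes "unitary_rep V" and v: "v \<in> hcarrier V" "hnorm V v = 1" and T: "finite T" and \<delta>: "\<delta> > 0"
  obtains e where "e * e = e" "star e = e" "\<And>a. a \<in> T \<Longrightarrow> e * a * e = a"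
    "1 - \<delta> < Re (vector_functional V v e)" "Re (vector_functional V v e) \<le> 1"
proof -
  interpret unitary_rep V by fact
  obtain e where e: "e * e = e" "star e = e" "\<forall>a\<in>T. e * a * e = a"
    "hnorm V (v - action V e v) < \<delta> / 2"
    using approximating_idempotent[OF assms(1) v(1) T, of "\<delta> / 2"] \<delta> by auto
  define s where "s = hnorm V (action V e v)"
  have s: "s \<le> 1" "0 \<le> s"
    using hnorm_idempotent_le[OF v(1) e(1,2)] v(1) by (simp_all add: s_def v(2) hnorm_nonneg action_closed)
  have "1 \<le> hnorm V (v - action V e v) + s"
    using hnorm_triangle[of "v - action V e v" "action V e v"] v
    by (simp add: s_def diff_closed action_closed)
  then have "1 - s < \<delta> / 2" using e by simp
  moreover have "1 - s\<^sup>2 \<le> 2 * (1 - s)"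
    using zero_le_power2[of "1 - s"] by (simp add: power2_eq_square algebra_simps)
  ultimately have "1 - \<delta> < s\<^sup>2" by simp
  moreover have "s\<^sup>2 \<le> 1" using s by (simp add: power_le_one)
  ultimately show ?thesis
    using that[of e] e vector_functional_idempotent[OF v(1) e(1,2)] by (simp add: s_def)
qed

text \<open>The functionals dominated by a vector functional \<open>\<phi>\<close> of an irreducible representation form a
  compact convex set. An extreme one is of the form \<open>\<psi> a = \<langle>av, \<eta>\<rangle>\<close> and is the midpoint of
  \<open>\<langle>a\<eta>, \<eta>\<rangle>\<close> and \<open>2\<psi> a - \<langle>a\<eta>, \<eta>\<rangle>\<close>, hence equal to \<open>\<langle>a\<eta>, \<eta>\<rangle>\<close>. This forces \<open>\<psi>\<close> to be \<open>0\<close> or \<open>\<phi>\<close>.\<close>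

lemma irreducible_dominated:
  fixes V :: "('a::idempotented_star_algebra, 'v::complex_vector) representation"
  assumes irr: "irreducible_unitary_rep V" and v: "v \<in> hcarrier V"
    and \<psi>: "positive_functional \<psi>"
      "\<And>a. Re (\<psi> (star a * a)) \<le> Re (vector_functional V v (star a * a))"
  obtains t where "0 \<le> t" "t \<le> 1" "\<psi> = (\<lambda>a. of_real t * vector_functional V v a)"
proof -
  interpret unitary_rep V using irr by (simp add: irreducible_unitary_rep_def)
  define \<phi> where "\<phi> = vector_functional V v"
  define M where "M = {\<psi>. positive_functional \<psi> \<and> (\<forall>a. Re (\<psi> (star a * a)) \<le> Re (\<phi> (star a * a)))}"
  define C where "C = (\<lambda>t a. of_real t * \<phi> a) ` {0..1::real}"
  have \<phi>_sq: "Re (\<phi> (star a * a)) = (hnorm V (action V a v))\<^sup>2" for a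
    using vector_functional_square[OF v, of a] by (simp add: \<phi>_def del: of_real_power)
  have le: "cmod (\<rho> a) \<le> hnorm V v * hnorm V (action V a v)" if \<rho>: "\<rho> \<in> M" for \<rho> a
  proof -
    have pos: "positive_functional \<rho>" and dom: "\<And>b. Re (\<rho> (star b * b)) \<le> (hnorm V (action V b v))\<^sup>2"
      using \<rho> by (auto simp: M_def \<phi>_sq)
    interpret semidefinite_form "\<lambda>x y. \<rho> (star y * x)"
      by (rule positive_functional_semidefinite_form[OF pos])
    have sn: "seminorm b \<le> hnorm V (action V b v)" for b
      using dom[of b] hnorm_nonneg[OF action_closed[OF v]]
      unfolding seminorm_power2[symmetric] by (rule power2_le_imp_le)
    obtain e where e: "e * e = e" "star e = e" "e * a * e = a" using idempotented[of "{a}"] by auto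
    have "cmod (\<rho> a) \<le> seminorm a * seminorm e"
      \<comment> \<open>As \<open>a = star e * a\<close>, the value at \<open>a\<close> is an inner
        product of \<open>a\<close> and \<open>e\<close>, to which domination applies.\<close>
      using form_Cauchy_Schwarz[where x = a and y = e] e idempotent_absorb(1)[OF e(1,3)] by simp
    also have "\<dots> \<le> hnorm V (action V a v) * hnorm V (action V e v)"
      using sn seminorm_nonneg by (intro mult_mono) (simp_all add: hnorm_nonneg action_closed v)
    also have "\<dots> \<le> hnorm V (action V a v) * hnorm V v"
      using hnorm_idempotent_le[OF v e(1,2)]
      by (intro mult_left_mono) (simp_all add: hnorm_nonneg action_closed v)
    finally show ?thesis by (simp add: mult.commute)
  qed
  have closedM: "closed M"
  proof -
    have "closed {\<psi>. \<forall>a. Re (\<psi> (star a * a)) \<le> Re (\<phi> (star a * a))}"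
      by (intro closed_Collect_all closed_Collect_le continuous_on_Re continuous_on_coord
          continuous_on_const)
    then show ?thesis unfolding M_def by (intro closed_Collect_conj closed_positive_functionals)
  qed
  have compactM: "compact M" 
    by (rule compact_coordwise_bounded[OF closedM, where C = "\<lambda>a. hnorm V v * hnorm V (action V a v)"])
      (rule le)
  have "continuous_on {0..1} (\<lambda>t a. of_real t * \<phi> a)"
    by (intro continuous_on_coordinatewise_then_product continuous_on_mult continuous_on_of_real
        continuous_on_id continuous_on_const)
  then have compactC: "compact C" unfolding C_def by (rule compact_continuous_image) simp
  have "mix_convex C"
    unfolding mix_convex_def C_def
  proof (intro ballI, elim imageE)
    fix x y s p q assume *: "s \<in> {0..1::real}" "p \<in> {0..1::real}" "q \<in> {0..1::real}"
      "x = (\<lambda>a. of_real p * \<phi> a)" "y = (\<lambda>a. of_real q * \<phi> a)"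
    have "mix s x y = (\<lambda>a. of_real (s * p + (1 - s) * q) * \<phi> a)"
      by (simp add: * mix_def fun_eq_iff algebra_simps)
    moreover have "s * p + (1 - s) * q \<in> {0..1}"
    proof -
      have "s * p + (1 - s) * q \<le> s * 1 + (1 - s) * 1" using * by (intro add_mono mult_left_mono) auto
      then show ?thesis using * by simp
    qed
    ultimately show "mix s x y \<in> (\<lambda>t a. of_real t * \<phi> a) ` {0..1}" by blast
  qed
  have "\<rho> \<in> C" if ext: "mix_extreme \<rho> M" for \<rho>
  proof -
    have \<rho>: "\<rho> \<in> M" using mix_faceD(1)[OF ext] by simp
    have pos: "positive_functional \<rho>" and dom: "\<And>b. Re (\<rho> (star b * b)) \<le> (hnorm V (action V b v))\<^sup>2"
      using \<rho> by (auto simp: M_def \<phi>_sq)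
    note D = positive_functionalD[OF pos]
    interpret F: semidefinite_form "\<lambda>x y. \<rho> (star y * x)"
      by (rule positive_functional_semidefinite_form[OF pos])
    have sn: "F.seminorm b \<le> hnorm V (action V b v)" for b
      using dom[of b] hnorm_nonneg[OF action_closed[OF v]]
      unfolding F.seminorm_power2[symmetric] by (rule power2_le_imp_le)
    define E where "E = range (\<lambda>a. action V a v)"
    define f where "f x = \<rho> (SOME a. action V a v = x)" for x
    have f: "f (action V a v) = \<rho> a" for a
    proof -
      define a' where "a' = (SOME a'. action V a' v = action V a v)"
      have a': "action V a' v = action V a v" unfolding a'_def by (rule someI) (rule refl)
      have "action V (a' - a) v = 0" using a' v by (simp add: action_diff_left)
      then have "\<rho> (a' - a) = 0" using le[OF \<rho>, of "a' - a"] by (simp add: hnorm_zero)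
      then show ?thesis by (simp add: f_def a'_def D(5))
    qed
    have E: "E \<subseteq> hcarrier V" "is_subspace E"
      using v action_closed orbit_subspace by (auto simp: E_def)
    obtain \<eta> X where \<eta>: "\<eta> \<in> hcarrier V" and X: "\<And>n::nat. X n \<in> E" "(\<lambda>n. hnorm V (X n - \<eta>)) \<longlonglongrightarrow> 0"
      and Riesz: "\<And>x. x \<in> E \<Longrightarrow> f x = hinner V x \<eta>"
    proof (rule Riesz_on_subspace[OF E, of f "hnorm V v"])
      show "f (x + y) = f x + f y" if xy: "x \<in> E" "y \<in> E" for x y
      proof -
        obtain a b where "x = action V a v" "y = action V b v" using xy by (auto simp: E_def)
        then show ?thesis using action_add_left[OF v, of a b, symmetric] by (simp add: f D)
      qed
      show "f (c *\<^sub>C x) = c * f x" if x: "x \<in> E" for c x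
      proof -
        obtain a where "x = action V a v" using x by (auto simp: E_def)
        then show ?thesis using action_scaleC_left[OF v, of c a, symmetric] by (simp add: f D)
      qed
      show "cmod (f x) \<le> hnorm V v * hnorm V x" if x: "x \<in> E" for x
        using x le[OF \<rho>] by (auto simp: E_def f)
    qed blast
    have rep: "\<rho> a = hinner V (action V a v) \<eta>" for a
      using Riesz[of "action V a v"] f by (simp add: E_def)
    have rep2: "\<rho> (star a * b) = hinner V (action V b v) (action V a \<eta>)" for a b
      using v \<eta> by (simp add: rep action_mult action_closed action_star star_star)
    \<comment> \<open>By \<open>rep2\<close>, pairing \<open>bv\<close> with \<open>a\<eta>\<close>
      is bounded by \<open>F.seminorm a\<close> times the norm of \<open>bv\<close>. Letting
      \<open>bv\<close> run through \<open>a (X n)\<close>, which tends to \<open>a\<eta>\<close>,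
      bounds the norm of \<open>a\<eta>\<close> by this seminorm.\<close>
    have \<eta>_le: "(hnorm V (action V a \<eta>))\<^sup>2 \<le> Re (\<rho> (star a * a))" for a
    proof -
      define r where "r = F.seminorm a"
      have small: "cmod (hinner V (action V b v) (action V a \<eta>)) \<le> r * hnorm V (action V b v)" for b
      proof -
        have "cmod (hinner V (action V b v) (action V a \<eta>)) \<le> F.seminorm b * F.seminorm a"
          using F.form_Cauchy_Schwarz[where x = b and y = a] by (simp add: rep2)
        also have "\<dots> \<le> hnorm V (action V b v) * F.seminorm a"
          using sn F.seminorm_nonneg by (intro mult_right_mono)
        finally show ?thesis by (simp add: r_def mult.commute)
      qed
      have XV: "X n \<in> hcarrier V" for n using X(1) E(1) by auto
      obtain K where K: "K > 0" "\<And>w. w \<in> hcarrier V \<Longrightarrow> hnorm V (action V a w) \<le> K * hnorm V w"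
        by (rule action_bounded_pos[where a = a]) (rule that)
      have lim: "(\<lambda>n. hnorm V (action V a (X n) - action V a \<eta>)) \<longlonglongrightarrow> 0"
      proof (rule Lim_null_comparison)
        show "\<forall>\<^sub>F n in sequentially.
            norm (hnorm V (action V a (X n) - action V a \<eta>)) \<le> K * hnorm V (X n - \<eta>)"
          using K(2)[OF diff_closed[OF XV \<eta>]] XV \<eta>
          by (simp add: action_diff_right[symmetric] hnorm_nonneg action_closed diff_closed)
        show "(\<lambda>n. K * hnorm V (X n - \<eta>)) \<longlonglongrightarrow> 0" using tendsto_mult_right_zero[OF X(2)] .
      qed
      have "cmod (hinner V (action V a (X n)) (action V a \<eta>))
          \<le> r * (hnorm V (action V a (X n) - action V a \<eta>) + hnorm V (action V a \<eta>))" for n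
      proof -
        obtain b where b: "X n = action V b v" using X(1)[of n] by (auto simp: E_def)
        have "cmod (hinner V (action V a (X n)) (action V a \<eta>)) \<le> r * hnorm V (action V a (X n))"
          using small[of "a * b"] v by (simp add: b action_mult)
        also have "\<dots> \<le> r * (hnorm V (action V a (X n) - action V a \<eta>) + hnorm V (action V a \<eta>))"
          using hnorm_triangle[of "action V a (X n) - action V a \<eta>" "action V a \<eta>"] XV[of n] \<eta>
          by (intro mult_left_mono) (simp_all add: action_closed diff_closed r_def F.seminorm_nonneg)
        finally show ?thesis .
      qed
      moreover have "(\<lambda>n. cmod (hinner V (action V a (X n)) (action V a \<eta>)))
          \<longlonglongrightarrow> cmod (hinner V (action V a \<eta>) (action V a \<eta>))"
        using XV \<eta> lim by (intro tendsto_norm tendsto_inner_left) (simp_all add: action_closed)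
      moreover have "(\<lambda>n. r * (hnorm V (action V a (X n) - action V a \<eta>) + hnorm V (action V a \<eta>)))
          \<longlonglongrightarrow> r * (0 + hnorm V (action V a \<eta>))"
        by (intro tendsto_mult tendsto_add tendsto_const lim)
      ultimately have "cmod (hinner V (action V a \<eta>) (action V a \<eta>)) \<le> r * (0 + hnorm V (action V a \<eta>))"
        using LIMSEQ_le by blast
      then have sq: "(hnorm V (action V a \<eta>))\<^sup>2 \<le> r * hnorm V (action V a \<eta>)"
        using \<eta> by (simp add: inner_self action_closed norm_power)
      have n0: "0 \<le> hnorm V (action V a \<eta>)" using \<eta> by (simp add: hnorm_nonneg action_closed)
      have "hnorm V (action V a \<eta>) \<le> r"
      proof (cases "hnorm V (action V a \<eta>) = 0")
        case True
        then show ?thesis by (simp add: r_def F.seminorm_nonneg)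
      next
        case False
        then show ?thesis using sq n0 by (simp add: power2_eq_square)
      qed
      then have "(hnorm V (action V a \<eta>))\<^sup>2 \<le> r\<^sup>2" using n0 by (rule power_mono)
      then show ?thesis by (simp add: r_def F.seminorm_power2)
    qed
    define \<rho>2 where "\<rho>2 = vector_functional V \<eta>"
    define \<rho>3 where "\<rho>3 a = 2 * \<rho> a - \<rho>2 a" for a
    have \<rho>2_sq: "Re (\<rho>2 (star a * a)) = (hnorm V (action V a \<eta>))\<^sup>2" for a
      using vector_functional_square[OF \<eta>, of a] by (simp add: \<rho>2_def del: of_real_power)
    note D2 = positive_functionalD[OF vector_functional_positive[OF \<eta>], folded \<rho>2_def]
    have "\<rho>2 \<in> M"
      unfolding M_def
    proof (intro CollectI conjI allI)
      show "positive_functional \<rho>2" unfolding \<rho>2_def using \<eta> by (rule vector_functional_positive)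
      show "Re (\<rho>2 (star a * a)) \<le> Re (\<phi> (star a * a))" for a
        using \<eta>_le[of a] dom[of a] by (simp add: \<rho>2_sq \<phi>_sq)
    qed
    moreover have "\<rho>3 \<in> M"
      unfolding M_def positive_functional_def
    proof (intro CollectI conjI allI)
      fix a b c
      show "\<rho>3 (a + b) = \<rho>3 a + \<rho>3 b" "\<rho>3 (c *\<^sub>C a) = c * \<rho>3 a" "\<rho>3 (star a) = cnj (\<rho>3 a)"
        by (simp_all add: \<rho>3_def D D2 algebra_simps)
      have Re3: "Re (\<rho>3 (star a * a)) = 2 * Re (\<rho> (star a * a)) - (hnorm V (action V a \<eta>))\<^sup>2"
        by (simp add: \<rho>3_def \<rho>2_sq)
      show "0 \<le> Re (\<rho>3 (star a * a))"
        unfolding Re3 using \<eta>_le[of a] zero_le_power2[of "hnorm V (action V a \<eta>)"] by linarith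
      \<comment> \<open>Domination of \<rho>3 by \<phi> is exactly the nonnegativity of |av -
        a\<eta>|^2.\<close>
      have "0 \<le> (hnorm V (action V a v - action V a \<eta>))\<^sup>2" by simp
      also have "\<dots> = (hnorm V (action V a v))\<^sup>2 + (hnorm V (action V a \<eta>))\<^sup>2 - 2 * Re (\<rho> (star a * a))"
        using v \<eta> unfolding rep2 by (intro hnorm_power2_diff action_closed)
      finally show "Re (\<rho>3 (star a * a)) \<le> Re (\<phi> (star a * a))"
        unfolding Re3 \<phi>_sq by simp
    qed
    moreover have "mix (1 / 2) \<rho>2 \<rho>3 = \<rho>" by (simp add: mix_def \<rho>3_def fun_eq_iff field_simps)
    ultimately have eq: "\<rho>2 = \<rho>" using mix_faceD(2)[OF ext, of \<rho>2 \<rho>3 "1 / 2"] by simp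
    have vn: "v - \<eta> \<in> hcarrier V" using v \<eta> by (rule diff_closed)
    \<comment> \<open>Equality of the two functionals says that \<eta> is orthogonal to the orbit of
      v - \<eta>, so one of the two vectors vanishes.\<close>
    have "hinner V \<eta> (action V a (v - \<eta>)) = 0" for a
    proof -
      have "hinner V (action V a (v - \<eta>)) \<eta> = 0"
        using fun_cong[OF eq, of a] v \<eta>
        by (simp add: \<rho>2_def vector_functional_def rep action_diff_right inner_diff_left action_closed)
      then show ?thesis using inner_cnj[OF action_closed[OF vn] \<eta>, of a] by simp
    qed
    then consider "\<eta> = 0" | "v - \<eta> = 0" using irreducible_orthogonal[OF irr vn \<eta>] by blast
    then show "\<rho> \<in> C"
    proof cases
      case 1
      then have "\<rho> = (\<lambda>a. of_real 0 * \<phi> a)"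
        using v by (simp add: fun_eq_iff rep inner_zero_right action_closed)
      then show ?thesis unfolding C_def by (rule image_eqI) simp
    next
      case 2
      then have "\<rho> = (\<lambda>a. of_real 1 * \<phi> a)"
        by (simp add: fun_eq_iff rep \<phi>_def vector_functional_def)
      then show ?thesis unfolding C_def by (rule image_eqI) simp
    qed
  qed
  then have "M \<subseteq> C"
    by (rule subset_if_mix_extreme_subset[OF compactM closedM compactC \<open>mix_convex C\<close>])
  moreover have "\<psi> \<in> M" using \<psi> by (simp add: M_def \<phi>_def)
  ultimately have "\<psi> \<in> C" by (rule subsetD)
  then show ?thesis using that by (auto simp: C_def \<phi>_def)
qed

text \<open>In a decomposition \<phi> = t x + (1 - t) y both summands are dominated by \<phi>, hence
  are multiples r \<phi> and q \<phi> with r + q = 1. Normalization of quasi-states gives r \<le> t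
  and q \<le> 1 - t, so equality holds and x = y = \<phi>.\<close>

lemma irreducible_vector_functional_extreme:
  fixes V :: "('a::idempotented_star_algebra, 'v::complex_vector) representation"
    and U :: "('a, 'u::complex_vector) representation"
  assumes irr: "irreducible_unitary_rep V" and v: "v \<in> hcarrier V" "hnorm V v = 1"
    and cone: "nonneg_cone U \<subseteq> nonneg_cone V"
  shows "mix_extreme (vector_functional V v) (quasi_states U)"
proof -
  have uV: "unitary_rep V" using irr by (simp add: irreducible_unitary_rep_def)
  then interpret unitary_rep V .
  define \<phi> where "\<phi> = vector_functional V v"
  have scalar: "x = (\<lambda>a. of_real (r / t) * \<phi> a)" "r \<le> t"
    if x: "x \<in> quasi_states U" and t: "t > 0" and r: "(\<lambda>a. of_real t * x a) = (\<lambda>a. of_real r * \<phi> a)"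
    for x r t
  proof -
    show xa: "x = (\<lambda>a. of_real (r / t) * \<phi> a)"
    proof
      fix a
      have "of_real t * x a = of_real r * \<phi> a" using fun_cong[OF r, of a] by simp
      then show "x a = of_real (r / t) * \<phi> a" using t by (simp add: field_simps)
    qed
    show "r \<le> t"
    proof (rule ccontr)
      assume "\<not> r \<le> t"
      then have rt: "t < r" by simp
      \<comment> \<open>If r > t, an idempotent with \<phi> e > t / r would give \<open>x\<close> a
        value above 1 at \<open>e\<close>.\<close>
      obtain e where e: "e * e = e" "star e = e" "1 - (1 - t / r) < Re (\<phi> e)"
        unfolding \<phi>_def
        by (rule idempotent_near_one[OF uV v finite.emptyI, of "1 - t / r"]) (use rt t in auto)
      have "r / t * (t / r) < r / t * Re (\<phi> e)" using e rt t by (intro mult_strict_left_mono) auto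
      also have "\<dots> \<le> 1" using quasi_state_idempotent(3)[OF x e(1,2)] by (simp add: xa del: of_real_divide)
      finally show False using rt t by simp
    qed
  qed
  have "x = \<phi> \<and> y = \<phi>" if x: "x \<in> quasi_states U" and y: "y \<in> quasi_states U"
    and t: "0 < t" "t < 1" and mix: "mix t x y = \<phi>" for x y t
  proof -
    note px = quasi_statesD(1)[OF x] and py = quasi_statesD(1)[OF y]
    have mixa: "of_real t * x a + of_real (1 - t) * y a = \<phi> a" for a
      using fun_cong[OF mix, of a] by (simp add: mix_def)
    have Re_mix: "t * Re (x a) + (1 - t) * Re (y a) = Re (\<phi> a)" for a
      using arg_cong[OF mixa[of a], of Re] by (simp del: of_real_diff)
    have pos: "positive_functional (\<lambda>a. of_real s * z a)" if "positive_functional z" "0 \<le> s" for s z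
      using positive_functionalD[OF that(1)] that(2) unfolding positive_functional_def
      by (auto simp: algebra_simps)
    have nnx: "0 \<le> (1 - t) * Re (y (star a * a))" and nny: "0 \<le> t * Re (x (star a * a))" for a
      using positive_functionalD(4)[OF px] positive_functionalD(4)[OF py] t by auto
    have dx: "Re (of_real t * x (star a * a)) \<le> Re (\<phi> (star a * a))"
      and dy: "Re (of_real (1 - t) * y (star a * a)) \<le> Re (\<phi> (star a * a))" for a
      using nnx[of a] nny[of a] Re_mix[of "star a * a"] by (simp_all del: of_real_diff)
    have tx: "positive_functional (\<lambda>a. of_real t * x a)" using pos[OF px, of t] t by simp
    have ty: "positive_functional (\<lambda>a. of_real (1 - t) * y a)" using pos[OF py, of "1 - t"] t by simp
    obtain r where r: "(\<lambda>a. of_real t * x a) = (\<lambda>a. of_real r * \<phi> a)"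
      using irreducible_dominated[OF irr v(1) tx dx[unfolded \<phi>_def]] unfolding \<phi>_def by metis
    obtain q where q: "(\<lambda>a. of_real (1 - t) * y a) = (\<lambda>a. of_real q * \<phi> a)"
      using irreducible_dominated[OF irr v(1) ty dy[unfolded \<phi>_def]] unfolding \<phi>_def by metis
    \<comment> \<open>Any element at which \<phi> does not vanish allows \<phi> to be
      cancelled.\<close>
    obtain e where e: "1 - 1 < Re (\<phi> e)"
      unfolding \<phi>_def by (rule idempotent_near_one[OF uV v finite.emptyI, of 1]) auto
    have "of_real r * \<phi> e + of_real q * \<phi> e = \<phi> e"
      using mixa[of e] fun_cong[OF r, of e] fun_cong[OF q, of e] by simp
    then have "complex_of_real (r + q) * \<phi> e = 1 * \<phi> e" by (simp add: distrib_right)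
    moreover have "\<phi> e \<noteq> 0" using e by auto
    ultimately have "complex_of_real (r + q) = of_real 1" by (simp only: mult_cancel_right) simp
    then have "r + q = 1" by (simp only: of_real_eq_iff)
    moreover have "r \<le> t" "q \<le> 1 - t"
      using scalar(2)[OF x _ r] scalar(2)[OF y _ q] t by auto
    ultimately have "r = t" "q = 1 - t" by auto
    then show ?thesis
      using scalar(1)[OF x _ r] scalar(1)[OF y _ q] t by simp
  qed
  moreover have "\<phi> \<in> quasi_states U"
    unfolding \<phi>_def using v cone by (intro vector_functional_quasi_state) auto
  ultimately show ?thesis unfolding mix_face_def \<phi>_def by auto
qed

section \<open>Weak containment\<close>

text \<open>Choquet's lemma at the extreme point given by \<open>v\<close>; linearity condenses the
  coordinate functional into evaluation at \<open>b\<close>.\<close>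

lemma irreducible_slice:
  fixes V :: "('a::idempotented_star_algebra, 'v::complex_vector) representation"
    and U :: "('a, 'u::complex_vector) representation"
  assumes irr: "irreducible_unitary_rep V" and v: "v \<in> hcarrier V" "hnorm V v = 1"
    and U: "unitary_rep U" and cone: "nonneg_cone U \<subseteq> nonneg_cone V"
    and T: "finite T" and \<epsilon>: "\<epsilon> > 0"
  obtains b \<alpha> where "\<alpha> < Re (vector_functional V v b)"
    "\<And>\<psi> a. \<psi> \<in> quasi_states U \<Longrightarrow> \<alpha> < Re (\<psi> b) \<Longrightarrow> a \<in> T \<Longrightarrow> cmod (\<psi> a - vector_functional V v a) < \<epsilon>"
proof -
  interpret unitary_rep V using irr by (simp add: irreducible_unitary_rep_def)
  have ext: "mix_extreme (vector_functional V v) (quasi_states U)"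
    by (rule irreducible_vector_functional_extreme[OF irr v cone])
  obtain S c \<alpha> where S: "\<alpha> < coord_functional S c (vector_functional V v)"
    "\<forall>\<psi>\<in>quasi_states U. \<alpha> < coord_functional S c \<psi> \<longrightarrow> (\<forall>a\<in>T. cmod (\<psi> a - vector_functional V v a) < \<epsilon>)"
    using mix_extreme_slice[OF compact_quasi_states[OF U] mix_convex_quasi_states ext T \<epsilon>] by metis
  define b where "b = (\<Sum>a\<in>S. c a *\<^sub>C a)"
  have "coord_functional S c \<psi> = Re (\<psi> b)" if "positive_functional \<psi>" for \<psi>
    using positive_functional_sum[OF that] by (simp add: coord_functional_def b_def)
  then show ?thesis
    using that[of \<alpha> b] S vector_functional_positive[OF v(1)] quasi_statesD(1) by metis
qed

text \<open>A stand-in for \<alpha> 1 - b. Since \<open>e * b * e = b\<close>, replacing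
  \<open>y\<close> by its image under \<open>e\<close> leaves the value at \<open>b\<close>
  unchanged, while the value of \<open>y\<close> at \<open>e\<close> is the squared norm of that
  image. Negated, it extracts a unit vector in the slice.\<close>

lemma shifted_idempotent_in_cone:
  fixes V :: "('a::star_algebra, 'v::complex_vector) representation"
  assumes "unitary_rep V" and e: "e * e = e" "star e = e" "e * b * e = b"
    and le: "\<And>y. y \<in> hcarrier V \<Longrightarrow> hnorm V y = 1 \<Longrightarrow> Re (vector_functional V y b) \<le> \<alpha>"
  shows "of_real \<alpha> *\<^sub>C e - b \<in> nonneg_cone V"
proof -
  interpret unitary_rep V by fact
  have "0 \<le> Re (vector_functional V y (of_real \<alpha> *\<^sub>C e - b))" if y: "y \<in> hcarrier V" for y
  proof -
    define x where "x = action V e y"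
    have x: "x \<in> hcarrier V" using y by (simp add: x_def action_closed)
    have eq: "vector_functional V y (of_real \<alpha> *\<^sub>C e - b) = of_real (\<alpha> * (hnorm V x)\<^sup>2) - vector_functional V x b"
      using y e vector_functional_action[OF y, of e b]
      by (simp add: vector_functional_linear vector_functional_idempotent x_def)
    show ?thesis
    proof (cases "x = 0")
      case True
      then have "vector_functional V x b = 0"
        using x by (simp add: vector_functional_def inner_zero_right action_closed)
      then show ?thesis unfolding eq using True by (simp add: hnorm_zero)
    next
      case False
      then have pos: "hnorm V x > 0" using x hnorm_nonneg[of x] hnorm_eq_0_iff[of x] by simp
      define z where "z = of_real (1 / hnorm V x) *\<^sub>C x"
      have z: "z \<in> hcarrier V" "hnorm V z = 1"
        using x pos by (simp_all add: z_def scaleC_closed hnorm_scaleC norm_divide)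
      have "vector_functional V z b = of_real ((1 / hnorm V x)\<^sup>2) * vector_functional V x b"
        using vector_functional_scaleC[OF x, of "of_real (1 / hnorm V x)" b] pos
        by (simp add: z_def norm_divide)
      then have "Re (vector_functional V z b) = (1 / hnorm V x)\<^sup>2 * Re (vector_functional V x b)"
        by (simp del: of_real_power of_real_divide)
      then have "Re (vector_functional V x b) \<le> \<alpha> * (hnorm V x)\<^sup>2"
        using le[OF z] pos by (simp add: power_divide divide_le_eq)
      then show ?thesis by (simp add: eq del: of_real_mult of_real_power)
    qed
  qed
  then show ?thesis by (simp add: nonneg_cone_def)
qed

lemma slice_idempotent:
  fixes V :: "('a::idempotented_star_algebra, 'v::complex_vector) representation"
  assumes V: "unitary_rep V" and v: "v \<in> hcarrier V" "hnorm V v = 1"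
    and \<alpha>: "\<alpha> < Re (vector_functional V v b)"
  obtains e where "e * e = e" "star e = e" "e * b * e = b" "of_real \<alpha> *\<^sub>C e - b \<notin> nonneg_cone V"
proof -
  interpret unitary_rep V by fact
  \<comment> \<open>Replacing 1 by \<open>e\<close> costs at most |\<alpha>| \<delta>, which must
    stay below the gap between \<alpha> and the value at \<open>b\<close>; the summand 1 covers
    \<alpha> = 0.\<close>
  define \<delta> where "\<delta> = (Re (vector_functional V v b) - \<alpha>) / (\<bar>\<alpha>\<bar> + 1)"
  have \<delta>: "\<delta> > 0" using \<alpha> by (simp add: \<delta>_def)
  obtain e where e: "e * e = e" "star e = e" "e * b * e = b"
    "1 - \<delta> < Re (vector_functional V v e)" "Re (vector_functional V v e) \<le> 1"
    by (rule idempotent_near_one[OF V v, of "{b}" \<delta>]) (use \<delta> in auto)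
  have "\<alpha> * Re (vector_functional V v e) - \<alpha> \<le> \<bar>\<alpha>\<bar> * (1 - Re (vector_functional V v e))"
    using e(5) mult_right_mono[of "-\<alpha>" "\<bar>\<alpha>\<bar>" "1 - Re (vector_functional V v e)"]
    by (simp add: algebra_simps)
  also have "\<dots> \<le> \<bar>\<alpha>\<bar> * \<delta>" using e(4) by (intro mult_left_mono) auto
  also have "\<dots> < (\<bar>\<alpha>\<bar> + 1) * \<delta>" using \<delta> by simp
  also have "\<dots> = Re (vector_functional V v b) - \<alpha>" by (simp add: \<delta>_def)
  finally have "Re (vector_functional V v (of_real \<alpha> *\<^sub>C e - b)) < 0"
    using v(1) by (simp add: vector_functional_linear)
  then have "of_real \<alpha> *\<^sub>C e - b \<notin> nonneg_cone V" using v(1) unfolding nonneg_cone_def by force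
  then show ?thesis using that e by blast
qed

lemma weakly_contained_iff:
  fixes V :: "('a::idempotented_star_algebra, 'v::complex_vector) representation"
    and V' :: "('a, 'w::complex_vector) representation"
  assumes irr: "irreducible_unitary_rep V" and V': "unitary_rep V'"
  shows "V \<prec> V' \<longleftrightarrow> nonneg_cone V' \<subseteq> nonneg_cone V"
proof
  have uV: "unitary_rep V" using irr by (simp add: irreducible_unitary_rep_def)
  then interpret unitary_rep V .
  assume wc: "V \<prec> V'"
  show "nonneg_cone V' \<subseteq> nonneg_cone V"
  proof
    fix b assume b: "b \<in> nonneg_cone V'"
    show "b \<in> nonneg_cone V"
    proof (rule nonneg_coneI_unit, rule field_le_epsilon)
      fix v and \<epsilon> :: real assume v: "v \<in> hcarrier V" "hnorm V v = 1" and \<epsilon>: "\<epsilon> > 0"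
      obtain v' where v': "v' \<in> hcarrier V'"
        "cmod (vector_functional V v b - vector_functional V' v' b) < \<epsilon>"
        using wc v \<epsilon> unfolding weakly_contained_def vector_functional_def
        by (metis finite.emptyI finite.insertI singletonI)
      have "0 \<le> Re (vector_functional V' v' b)" using b v'(1) by (simp add: nonneg_cone_def)
      then show "0 \<le> Re (vector_functional V v b) + \<epsilon>"
        using v'(2) abs_Re_le_cmod[of "vector_functional V v b - vector_functional V' v' b"] by simp
    qed
  qed
next
  have uV: "unitary_rep V" using irr by (simp add: irreducible_unitary_rep_def)
  interpret V': unitary_rep V' by fact
  assume cone: "nonneg_cone V' \<subseteq> nonneg_cone V"
  show "V \<prec> V'"
    unfolding weakly_contained_def
  proof (intro ballI allI impI)
    fix v and \<epsilon> :: real and T :: "'a set"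
    assume v: "v \<in> hcarrier V" "hnorm V v = 1" and \<epsilon>: "\<epsilon> > 0" and T: "finite T"
    obtain b \<alpha> where b: "\<alpha> < Re (vector_functional V v b)" and
      near: "\<And>\<psi> a. \<psi> \<in> quasi_states V' \<Longrightarrow> \<alpha> < Re (\<psi> b) \<Longrightarrow> a \<in> T \<Longrightarrow> cmod (\<psi> a - vector_functional V v a) < \<epsilon>"
      by (rule irreducible_slice[OF irr v V' cone T \<epsilon>]) (rule that)
    obtain e where e: "e * e = e" "star e = e" "e * b * e = b" "of_real \<alpha> *\<^sub>C e - b \<notin> nonneg_cone V"
      by (rule slice_idempotent[OF uV v b]) (rule that)
    have "of_real \<alpha> *\<^sub>C e - b \<notin> nonneg_cone V'" using e(4) cone by blast
    then obtain y where y: "y \<in> hcarrier V'" "hnorm V' y = 1" "\<alpha> < Re (vector_functional V' y b)"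
      using shifted_idempotent_in_cone[OF V' e(1-3), of \<alpha>] not_le by blast
    have yQ: "vector_functional V' y \<in> quasi_states V'"
      using y by (intro V'.vector_functional_quasi_state) auto
    have "cmod (vector_functional V v a - vector_functional V' y a) < \<epsilon>" if "a \<in> T" for a
      using near[OF yQ y(3) that] by (simp add: norm_minus_commute)
    then show "\<exists>v'\<in>hcarrier V'. hnorm V' v' = 1 \<and>
        (\<forall>a\<in>T. cmod (hinner V (action V a v) v - hinner V' (action V' a v') v') < \<epsilon>)"
      using y unfolding vector_functional_def by blast
  qed
qed

text \<open>A vector functional of the sum is the sum of those of the components, and each summand
  is embedded by extension with 0.\<close>

lemma nonneg_cone_direct_sum:
  fixes I :: "'i set"
    and V :: "'i \<Rightarrow> ('a::star_algebra, 'v::complex_vector) representation"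
  assumes V: "\<And>i. i \<in> I \<Longrightarrow> unitary_rep (V i)" and D: "unitary_rep (direct_sum I V)"
  shows "b \<in> nonneg_cone (direct_sum I V) \<longleftrightarrow> (\<forall>i\<in>I. b \<in> nonneg_cone (V i))"
proof
  interpret D: unitary_rep "direct_sum I V" by fact
  assume b: "b \<in> nonneg_cone (direct_sum I V)"
  show "\<forall>i\<in>I. b \<in> nonneg_cone (V i)"
    unfolding nonneg_cone_def
  proof (intro ballI CollectI)
    fix i y assume i: "i \<in> I" and y: "y \<in> hcarrier (V i)"
    define x where "x = (\<lambda>j. if j = i then y else 0)"
    have zero: "0 \<in> hcarrier (V j)" "hnorm (V j) 0 = 0" "hinner (V j) (action (V j) b 0) 0 = 0"
      if "j \<in> I" for j
    proof -
      interpret unitary_rep "V j" using V that .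
      show "0 \<in> hcarrier (V j)" "hnorm (V j) 0 = 0" "hinner (V j) (action (V j) b 0) 0 = 0"
        using zero_closed hnorm_zero inner_zero_right[OF action_closed[OF zero_closed]] by auto
    qed
    have "(\<lambda>j. (hnorm (V j) (x j))\<^sup>2) summable_on I"
      unfolding summable_on_def
      by (intro exI has_sum_finite_neutralI[where B = "{i}"]) (use i zero in \<open>auto simp: x_def\<close>)
    then have x: "x \<in> hcarrier (direct_sum I V)"
      using i y zero by (auto simp: direct_sum_simps x_def)
    have "((\<lambda>j. hinner (V j) (action (V j) b (x j)) (x j)) has_sum
        (\<Sum>j\<in>{i}. hinner (V j) (action (V j) b (x j)) (x j))) I"
      by (rule has_sum_finite_neutralI[where B = "{i}"]) (use i zero in \<open>auto simp: x_def\<close>)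
    then have "(\<Sum>\<^sub>\<infinity>j\<in>I. hinner (V j) (action (V j) b (x j)) (x j)) = vector_functional (V i) y b"
      by (simp add: infsumI vector_functional_def x_def)
    moreover have "vector_functional (direct_sum I V) x b
        = (\<Sum>\<^sub>\<infinity>j\<in>I. hinner (V j) (action (V j) b (x j)) (x j))"
      unfolding vector_functional_def direct_sum_simps by (intro infsum_cong) simp
    ultimately have "vector_functional (V i) y b = vector_functional (direct_sum I V) x b" by simp
    then show "0 \<le> Re (vector_functional (V i) y b)" using b x by (simp add: nonneg_cone_def)
  qed
next
  interpret D: unitary_rep "direct_sum I V" by fact
  assume b: "\<forall>i\<in>I. b \<in> nonneg_cone (V i)"
  show "b \<in> nonneg_cone (direct_sum I V)"
    unfolding nonneg_cone_def
  proof (intro CollectI ballI)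
    fix x assume x: "x \<in> hcarrier (direct_sum I V)"
    have "(\<lambda>i. hinner (V i) (action (direct_sum I V) b x i) (x i)) summable_on I"
      using V by (rule direct_sum_inner_summable) (use x D.action_closed in auto)
    then have "Re (vector_functional (direct_sum I V) x b)
        = (\<Sum>\<^sub>\<infinity>i\<in>I. Re (hinner (V i) (action (direct_sum I V) b x i) (x i)))"
      by (simp add: vector_functional_def direct_sum_simps(2) infsum_Re)
    also have "\<dots> \<ge> 0"
      using b x by (intro infsum_nonneg)
        (simp add: direct_sum_simps nonneg_cone_def vector_functional_def)
    finally show "0 \<le> Re (vector_functional (direct_sum I V) x b)" .
  qed
qed

section \<open>Neighbourhoods in the unitary dual\<close>

text \<open>Neighbourhoods and spectra consist of classes, each with its own representative; this
  moves a vector functional between representatives.\<close>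

lemma iso_vector_functional:
  assumes "V \<cong>\<^sub>u U" and "unitary_rep V" and "u \<in> hcarrier U"
  obtains x where "x \<in> hcarrier V" "vector_functional V x = vector_functional U u"
proof -
  interpret unitary_rep V by fact
  obtain f where f: "bij_betw f (hcarrier V) (hcarrier U)"
    and inner: "\<forall>x\<in>hcarrier V. \<forall>y\<in>hcarrier V. hinner U (f x) (f y) = hinner V x y"
    and act: "\<forall>a. \<forall>x\<in>hcarrier V. f (action V a x) = action U a (f x)"
    using assms(1) unfolding unitarily_isomorphic_def by blast
  obtain x where x: "x \<in> hcarrier V" "f x = u" using f assms(3) by (metis bij_betw_imp_surj_on imageE)
  have "vector_functional V x a = vector_functional U u a" for a
    using inner[rule_format, OF action_closed[OF x(1)] x(1), of a] act x
    by (simp add: vector_functional_def)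
  then show ?thesis using that x(1) by blast
qed

text \<open>Subbasic neighbourhoods of the class of \<open>V\<close> may be based at other representations and vectors.
  As \<open>v\<close> is cyclic, they contain a neighbourhood based at \<open>v\<close> itself.\<close>

lemma unitary_dual_nbhd:
  fixes V :: "'a::idempotented_star_algebra small_rep"
  assumes irr: "irreducible_unitary_rep V" and v: "v \<in> hcarrier V" "hnorm V v = 1"
    and N: "openin unitary_dual_topology N" "iso_class V \<in> N"
  shows "\<exists>T \<epsilon>. finite T \<and> \<epsilon> > 0 \<and>
    (\<forall>U :: 'a small_rep. \<forall>u\<in>hcarrier U. irreducible_unitary_rep U \<longrightarrow>
      (\<forall>a\<in>T. cmod (vector_functional U u a - vector_functional V v a) < \<epsilon>) \<longrightarrow> iso_class U \<in> N)"
proof -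
  have uV: "unitary_rep V" using irr by (simp add: irreducible_unitary_rep_def)
  then interpret unitary_rep V .
  have "v \<noteq> 0" using v hnorm_zero by auto
  then have cyc: "cyclic_vector V v" by (rule irreducible_cyclic[OF irr v(1)])
  show ?thesis
    using openin_topology_generated_by[OF N(1)[unfolded unitary_dual_topology_def]] N(2)
  proof (induction rule: generate_topology_on.induct)
    case Empty
    then show ?case by simp
  next
    case (Int A B)
    then have "iso_class V \<in> A" "iso_class V \<in> B" by simp_all
    let ?nbhd = "\<lambda>T \<epsilon> A. \<forall>U :: 'a small_rep. \<forall>u\<in>hcarrier U. irreducible_unitary_rep U \<longrightarrow>
      (\<forall>a\<in>T. cmod (vector_functional U u a - vector_functional V v a) < \<epsilon>) \<longrightarrow> iso_class U \<in> A"
    obtain T \<epsilon> where T: "finite T" "\<epsilon> > 0" "?nbhd T \<epsilon> A"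
      using Int.IH(1)[OF \<open>iso_class V \<in> A\<close>] by (elim exE conjE) (rule that)
    obtain T' \<epsilon>' where T': "finite T'" "\<epsilon>' > 0" "?nbhd T' \<epsilon>' B"
      using Int.IH(2)[OF \<open>iso_class V \<in> B\<close>] by (elim exE conjE) (rule that)
    show ?case
    proof (intro exI[of _ "T \<union> T'"] exI[of _ "min \<epsilon> \<epsilon>'"] conjI allI ballI impI IntI)
      fix U :: "'a small_rep" and u assume U: "u \<in> hcarrier U" "irreducible_unitary_rep U"
        and near: "\<forall>a\<in>T \<union> T'. cmod (vector_functional U u a - vector_functional V v a) < min \<epsilon> \<epsilon>'"
      show "iso_class U \<in> A" by (rule T(3)[rule_format, OF U]) (use near in simp)
      show "iso_class U \<in> B" by (rule T'(3)[rule_format, OF U]) (use near in simp)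
    qed (use T T' in simp_all)
  next
    case (UN K)
    then obtain k where k: "k \<in> K" "iso_class V \<in> k" by auto
    show ?case
      using UN.IH[OF k] by (elim exE conjE, intro exI conjI allI ballI impI UnionI[OF k(1)]) blast+
  next
    case (Basis N)
    then obtain W w \<delta> T where "N = dual_nbhd W w \<delta> T" and T: "finite T" by auto
    note N = this(1)
    then obtain U' :: "'a small_rep" and u' where U': "irreducible_unitary_rep U'" "iso_class V = iso_class U'"
      "u' \<in> hcarrier U'" "\<forall>a\<in>T. cmod (vector_functional W w a - vector_functional U' u' a) < \<delta>"
      using Basis.prems by (auto simp: dual_nbhd_def vector_functional_def)
    have "unitary_rep U'" using U'(1) by (simp add: irreducible_unitary_rep_def)
    then have "V \<cong>\<^sub>u U'" using U'(2) iso_class_eq_iff[OF uV] by blast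
    then obtain x where x: "x \<in> hcarrier V" "vector_functional V x = vector_functional U' u'"
      using iso_vector_functional[OF _ uV U'(3)] by blast
    \<comment> \<open>The witness of membership, carried to \<open>V\<close>, is approximated by
      vectors of the orbit of \<open>v\<close>. The strict inequalities survive for one
      \<open>bv\<close> in place of \<open>x\<close>.\<close>
    obtain s where s: "(\<lambda>n. hnorm V (action V (s n) v - x)) \<longlonglongrightarrow> 0"
      using limit_sequence[of x "\<lambda>a. action V a v"] cyc x(1) v(1) action_closed
      unfolding cyclic_vector_def by blast
    have "\<forall>\<^sub>F n in sequentially. \<forall>a\<in>T.
        cmod (vector_functional W w a - vector_functional V (action V (s n) v) a) < \<delta>"
    proof (intro eventually_ball_finite T ballI)
      fix a assume "a \<in> T"
      have "(\<lambda>n. cmod (vector_functional W w a - vector_functional V (action V (s n) v) a))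
          \<longlonglongrightarrow> cmod (vector_functional W w a - vector_functional V x a)"
        using v x s by (intro tendsto_norm tendsto_diff tendsto_const tendsto_vector_functional)
          (simp_all add: action_closed)
      then show "\<forall>\<^sub>F n in sequentially.
          cmod (vector_functional W w a - vector_functional V (action V (s n) v) a) < \<delta>"
        using U'(4) \<open>a \<in> T\<close> x(2) by (intro order_tendstoD(2)) auto
    qed
    then obtain b where b: "\<And>a. a \<in> T \<Longrightarrow>
        cmod (vector_functional W w a - vector_functional V (action V b v) a) < \<delta>"
      by (auto simp: eventually_sequentially)
    define g where "g a = \<delta> - cmod (vector_functional W w a - vector_functional V (action V b v) a)" for a
    \<comment> \<open>The least slack left by \<open>bv\<close> over \<open>T\<close>; the inserted
      1 covers empty \<open>T\<close>.\<close>
    define \<epsilon> where "\<epsilon> = Min (insert 1 (g ` T))"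
    have \<epsilon>: "\<epsilon> > 0" "\<And>a. a \<in> T \<Longrightarrow> \<epsilon> \<le> g a" using T b by (auto simp: \<epsilon>_def g_def)
    show ?case
    \<comment> \<open>The functional of \<open>bu\<close> at \<open>a\<close> is that of
      \<open>u\<close> at \<open>star b * a * b\<close>. So closeness of \<open>u\<close> to
      \<open>v\<close> at these elements makes \<open>bu\<close> a witness for the given
      neighbourhood.\<close>
    proof (intro exI[of _ "(\<lambda>a. star b * a * b) ` T"] exI[of _ \<epsilon>] conjI allI ballI impI)
      show "finite ((\<lambda>a. star b * a * b) ` T)" "\<epsilon> > 0" using T \<epsilon> by auto
      fix U :: "'a small_rep" and u assume u: "u \<in> hcarrier U" and irrU: "irreducible_unitary_rep U"
        and near: "\<forall>a\<in>(\<lambda>a. star b * a * b) ` T. cmod (vector_functional U u a - vector_functional V v a) < \<epsilon>"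
      interpret U: unitary_rep U using irrU by (simp add: irreducible_unitary_rep_def)
      have "cmod (vector_functional W w a - vector_functional U (action U b u) a) < \<delta>" if a: "a \<in> T" for a
      proof -
        have "cmod (vector_functional U (action U b u) a - vector_functional V (action V b v) a) < g a"
          using near \<epsilon>(2) a u v unfolding U.vector_functional_action[OF u] vector_functional_action[OF v(1)]
          by force
        then show ?thesis
          using norm_triangle_ineq4[of "vector_functional W w a - vector_functional V (action V b v) a"
              "vector_functional U (action U b u) a - vector_functional V (action V b v) a"]
          by (simp add: g_def)
      qed
      then show "iso_class U \<in> N"
        unfolding N dual_nbhd_def vector_functional_def using irrU U.action_closed[OF u, of b] by blast
    qed
  qed
qed

theorem theorem2p31:
  fixes I :: "'i set"
    and V :: "'i \<Rightarrow> ('a::idempotented_star_algebra, 'v::complex_vector) representation"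
  assumes "\<And>i. i \<in> I \<Longrightarrow> unitary_rep (V i)"
    and "unitary_rep (direct_sum I V)"
  shows "Spec (direct_sum I V) = unitary_dual_topology closure_of (\<Union>i\<in>I. Spec (V i))"
proof
  note V = assms(1) and D = assms(2)
  note cone_D = nonneg_cone_direct_sum[of I V, OF V D]
  show "Spec (direct_sum I V) \<subseteq> unitary_dual_topology closure_of (\<Union>i\<in>I. Spec (V i))"
  proof
    fix c assume "c \<in> Spec (direct_sum I V)"
    then obtain Y :: "'a small_rep" where c: "c = iso_class Y" and irr: "irreducible_unitary_rep Y"
      and wc: "Y \<prec> direct_sum I V"
      by (auto simp: Spec_def)
    have uY: "unitary_rep Y" using irr by (simp add: irreducible_unitary_rep_def)
    have cone: "nonneg_cone (direct_sum I V) \<subseteq> nonneg_cone Y"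
      using wc weakly_contained_iff[OF irr D] by blast
    obtain v where v: "v \<in> hcarrier Y" "hnorm Y v = 1"
      by (rule unitary_rep.exists_unit_vector[OF uY irr])
    define \<phi> where "\<phi> = vector_functional Y v"
    have "\<exists>y. y \<in> (\<Union>i\<in>I. Spec (V i)) \<and> y \<in> N" if N: "iso_class Y \<in> N" "openin unitary_dual_topology N" for N
    proof -
      obtain T \<epsilon> where T: "finite T" "\<epsilon> > 0" and nbhd: "\<And>(U :: 'a small_rep) u.
          u \<in> hcarrier U \<Longrightarrow> irreducible_unitary_rep U \<Longrightarrow>
          (\<forall>a\<in>T. cmod (vector_functional U u a - \<phi> a) < \<epsilon>) \<Longrightarrow> iso_class U \<in> N"
        using unitary_dual_nbhd[OF irr v N(2,1)] unfolding \<phi>_def by blast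
      \<comment> \<open>Every functional within 1/2 of \<phi> at \<open>e0\<close> is nonzero there,
        so the GNS vector found below is nonzero.\<close>
      obtain e0 where e0: "1 - 1 / 2 < Re (\<phi> e0)"
        unfolding \<phi>_def by (rule idempotent_near_one[OF uY v finite.emptyI, of "1 / 2"]) auto
      have fin: "finite (insert e0 T)" and min: "min \<epsilon> (1 / 2) > 0" using T by auto
      obtain b \<alpha> where b: "\<alpha> < Re (\<phi> b)" and
        near: "\<And>\<psi> a. \<psi> \<in> quasi_states (direct_sum I V) \<Longrightarrow> \<alpha> < Re (\<psi> b) \<Longrightarrow> a \<in> insert e0 T \<Longrightarrow>
          cmod (\<psi> a - \<phi> a) < min \<epsilon> (1 / 2)"
        by (rule irreducible_slice[OF irr v D cone fin min, folded \<phi>_def]) (rule that)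
      obtain e where e: "e * e = e" "star e = e" "e * b * e = b" "of_real \<alpha> *\<^sub>C e - b \<notin> nonneg_cone Y"
        by (rule slice_idempotent[OF uY v b[unfolded \<phi>_def]]) (rule that)
      then obtain i where i: "i \<in> I" "of_real \<alpha> *\<^sub>C e - b \<notin> nonneg_cone (V i)"
        using cone cone_D by blast
      then obtain y where y: "y \<in> hcarrier (V i)" "hnorm (V i) y = 1"
        "\<alpha> < Re (vector_functional (V i) y b)"
        using shifted_idempotent_in_cone[OF V[OF i(1)] e(1-3), of \<alpha>] not_le by blast
      let ?Q = "quasi_states (V i)"
      have yQ: "vector_functional (V i) y \<in> ?Q"
        using y V[OF i(1)] by (intro unitary_rep.vector_functional_quasi_state) auto
      \<comment> \<open>The functional of \<open>y\<close> need not be pure. A maximizer of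
        \<open>Re (\<psi> b)\<close> over the quasi-states of \<open>V i\<close> stays in the slice
        and can be chosen extreme.\<close>
      obtain \<psi> where \<psi>: "mix_extreme \<psi> ?Q"
        "\<forall>\<rho>\<in>?Q. coord_functional {b} (\<lambda>_. 1) \<rho> \<le> coord_functional {b} (\<lambda>_. 1) \<psi>"
        using exists_mix_extreme_argmax[OF compact_quasi_states[OF V[OF i(1)]] closed_quasi_states] yQ
        by blast
      have \<psi>b: "\<alpha> < Re (\<psi> b)" using \<psi>(2) yQ y(3) by (force simp: coord_functional_def)
      have \<psi>Q: "\<psi> \<in> ?Q" using mix_faceD(1)[OF \<psi>(1)] by simp
      have "nonneg_cone (direct_sum I V) \<subseteq> nonneg_cone (V i)" using cone_D i(1) by blast
      then have \<psi>D: "\<psi> \<in> quasi_states (direct_sum I V)" using quasi_states_mono \<psi>Q by blast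
      \<comment> \<open>This representation is irreducible by extremality, weakly contained in
        \<open>V i\<close> by the inclusion of cones, and near \<open>Y\<close> because its
        functional lies in the slice.\<close>
      obtain U :: "'a small_rep" and \<xi> where U: "unitary_rep U" "cyclic_vector U \<xi>" "hnorm U \<xi> \<le> 1"
        "vector_functional U \<xi> = \<psi>" "nonneg_cone (V i) \<subseteq> nonneg_cone U"
        by (rule gns_exists[OF V[OF i(1)] \<psi>Q]) (rule that)
      have "\<psi> e0 \<noteq> 0"
        using near[OF \<psi>D \<psi>b, of e0] e0 complex_Re_le_cmod[of "\<phi> e0"] by auto
      have \<xi>: "\<xi> \<in> hcarrier U" using U(2) by (simp add: cyclic_vector_def)
      have "\<xi> \<noteq> 0"
      proof
        interpret unitary_rep U by (rule U(1))
        assume "\<xi> = 0"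
        then have "\<psi> e0 = 0"
          using fun_cong[OF U(4), of e0] \<xi> by (simp add: vector_functional_def inner_zero_right action_closed)
        then show False using \<open>\<psi> e0 \<noteq> 0\<close> by simp
      qed
      have irrU: "irreducible_unitary_rep U"
        by (rule irreducible_if_extreme[OF U(1,2,3,5) \<open>\<xi> \<noteq> 0\<close>]) (use U(4) \<psi>(1) in simp)
      have "U \<prec> V i" using weakly_contained_iff[OF irrU V[OF i(1)]] U(5) by blast
      then have "iso_class U \<in> Spec (V i)" using irrU by (auto simp: Spec_def)
      moreover have "iso_class U \<in> N"
        using near[OF \<psi>D \<psi>b] U(4) by (intro nbhd[OF \<xi> irrU]) auto
      ultimately show ?thesis using i(1) by blast
    qed
    moreover have "c \<in> unitary_dual" using c irr by (auto simp: unitary_dual_def)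
    ultimately show "c \<in> unitary_dual_topology closure_of (\<Union>i\<in>I. Spec (V i))"
      unfolding in_closure_of topspace_unitary_dual_topology c by blast
  qed
  show "unitary_dual_topology closure_of (\<Union>i\<in>I. Spec (V i)) \<subseteq> Spec (direct_sum I V)"
  proof
    fix c assume c: "c \<in> unitary_dual_topology closure_of (\<Union>i\<in>I. Spec (V i))"
    then have "c \<in> unitary_dual" by (simp add: in_closure_of topspace_unitary_dual_topology)
    then obtain Y :: "'a small_rep" where Y: "c = iso_class Y" and irr: "irreducible_unitary_rep Y"
      by (auto simp: unitary_dual_def)
    interpret unitary_rep Y using irr by (simp add: irreducible_unitary_rep_def)
    have "b \<in> nonneg_cone Y" if b: "b \<in> nonneg_cone (direct_sum I V)" for b
    proof (rule nonneg_coneI_unit, rule field_le_epsilon)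
      fix v and \<epsilon> :: real assume v: "v \<in> hcarrier Y" "hnorm Y v = 1" and \<epsilon>: "\<epsilon> > 0"
      have "openin unitary_dual_topology (dual_nbhd Y v \<epsilon> {b})"
        unfolding unitary_dual_topology_def
        by (rule topology_generated_by_Basis) (use irr v \<epsilon> in blast)
      moreover have "c \<in> dual_nbhd Y v \<epsilon> {b}"
        unfolding Y dual_nbhd_def using irr v \<epsilon>
        by (intro CollectI exI[of _ Y] conjI bexI[of _ v] refl) auto
      ultimately obtain y where y: "y \<in> (\<Union>i\<in>I. Spec (V i))" "y \<in> dual_nbhd Y v \<epsilon> {b}"
        using c unfolding in_closure_of by blast
      then obtain i and W :: "'a small_rep" where i: "i \<in> I" and W: "y = iso_class W" "irreducible_unitary_rep W" "W \<prec> V i"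
        by (auto simp: Spec_def)
      \<comment> \<open>The vector \<open>u\<close> need not be a unit vector and \<open>U\<close>
        need not be the representative \<open>W\<close>. Neither matters, since the cone tests all
        vectors and is invariant under isomorphism.\<close>
      obtain U :: "'a small_rep" and u where U: "y = iso_class U" "irreducible_unitary_rep U" "u \<in> hcarrier U"
        "cmod (vector_functional Y v b - vector_functional U u b) < \<epsilon>"
        using y(2) by (auto simp: dual_nbhd_def vector_functional_def)
      have uW: "unitary_rep W" and uU: "unitary_rep U" using W U by (auto simp: irreducible_unitary_rep_def)
      have "W \<cong>\<^sub>u U" using iso_class_eq_iff[OF uW uU] W(1) U(1) by simp
      then obtain x where x: "x \<in> hcarrier W" "vector_functional W x = vector_functional U u"
        using iso_vector_functional[OF _ uW U(3)] by blast
      have "b \<in> nonneg_cone W"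
        using b cone_D i W weakly_contained_iff[OF W(2) V[OF i]] by blast
      then have "0 \<le> Re (vector_functional U u b)" using x by (auto simp: nonneg_cone_def)
      then show "0 \<le> Re (vector_functional Y v b) + \<epsilon>"
        using U(4) abs_Re_le_cmod[of "vector_functional Y v b - vector_functional U u b"] by simp
    qed
    then have "Y \<prec> direct_sum I V" using weakly_contained_iff[OF irr D] by blast
    then show "c \<in> Spec (direct_sum I V)" using Y irr by (auto simp: Spec_def)
  qed
qed

end
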